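(* Assume the generalised Riemann hypothesis (GRH). Fix a sufficiently small $\varepsilon>0$, set $y=x^{\varepsilon}$, let $k>2$ be an integer with $k\asymp x^{\delta}$, and let $a$ be an integer with $\gcd(a,k)=1$. Then for all sufficiently large $x$: if $\delta\in(\tfrac14,\tfrac13]$, then $$\mathcal N_k(a;x,y,x^{1/2})=\frac{\#\mathcal P_k(y)}{\varphi(k)}\,\Phi(x,x^{1/2}) + O\!\left(\frac{x^{1-\varepsilon+o(1)}\,y}{k}\right);$$ and if $\delta\in(\tfrac13,\tfrac25)$, then $$\mathcal N_k(a;x,y,x^{1/2})\ge \frac{(0.7533+o(1))\,xy}{\varphi(k)(\log x)(\log y)}.$$
   Context: $\mathcal N_k(a;x,y,z)$ denotes the number of pairs $(u,v)$ with $u$ an integer in $[2,x]$, $v$ a prime with $v\le y$, $uv\equiv a \pmod k$, and $P^-(u)\ge z$, where $P^-(m)$ is the smallest prime factor of $m$ for $m\ge 2$ (and $P^-(1)=\infty$). $\mathcal P_k(y)=\{p\le y: p \text{ prime}, \gcd(p,k)=1\}$. For $\beta\ge0$, $\Phi(x,x^{\beta})=\#\{n\le x: P^-(n)\ge x^{\beta}\}$. $\varphi$ is Euler's totient function. $A\asymp B$ means $A\ll B$ and $B\ll A$. The $o(1)$ terms are as $x\to\infty$. *)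

theory Defs
  imports "HOL-Complex_Analysis.Complex_Analysis" "HOL-Number_Theory.Number_Theory"
begin

definition dirichlet_character :: "nat \<Rightarrow> (nat \<Rightarrow> complex) \<Rightarrow> bool" where
  "dirichlet_character q chi \<longleftrightarrow>
     q > 0 \<and>
     (\<forall>n. chi (n + q) = chi n) \<and>
     (\<forall>m n. chi (m * n) = chi m * chi n) \<and>
     (\<forall>n. chi n \<noteq> 0 \<longleftrightarrow> coprime n q)"

definition principal_character :: "nat \<Rightarrow> nat \<Rightarrow> complex" where
  "principal_character q n = (if coprime n q then 1 else 0)"

(* L is the analytic continuation of the Dirichlet series of chi: to the whole plane if
   chi is non-principal, and to the plane without the pole s = 1 otherwise. By the identity
   theorem these conditions determine L on that domain. *)
definition is_dirichlet_L :: "nat \<Rightarrow> (nat \<Rightarrow> complex) \<Rightarrow> (complex \<Rightarrow> complex) \<Rightarrow> bool" where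
  "is_dirichlet_L q chi L \<longleftrightarrow>
     L holomorphic_on (if chi = principal_character q then - {1} else UNIV) \<and>
     (\<forall>s. Re s > 1 \<longrightarrow> (\<lambda>n. chi (Suc n) / of_nat (Suc n) powr s) sums L s)"

(* Imprimitive characters are included; they contribute no further zeros in the open strip.
   The case q = 1 is the Riemann hypothesis for zeta. *)
definition GRH :: bool where
  "GRH \<longleftrightarrow>
     (\<forall>q chi L. dirichlet_character q chi \<and> is_dirichlet_L q chi L \<longrightarrow>
        (\<forall>s. 0 < Re s \<and> Re s < 1 \<and> L s = 0 \<longrightarrow> Re s = 1 / 2))"

(* Smallest prime factor; the infimum of the empty set gives the value \<infinity> at m = 1. *)
definition Pminus :: "nat \<Rightarrow> ereal" where
  "Pminus m = (INF p\<in>{p. prime p \<and> p dvd m}. ereal (real p))"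

definition count_pairs :: "nat \<Rightarrow> int \<Rightarrow> real \<Rightarrow> real \<Rightarrow> real \<Rightarrow> nat" where
  "count_pairs k a x y z =
     card {(u, v). 2 \<le> u \<and> real u \<le> x \<and> prime v \<and> real v \<le> y \<and>
                   [int (u * v) = a] (mod int k) \<and> ereal z \<le> Pminus u}"

definition primes_coprime_upto :: "nat \<Rightarrow> real \<Rightarrow> nat set" where
  "primes_coprime_upto k y = {p. prime p \<and> real p \<le> y \<and> coprime p k}"

definition rough_count :: "real \<Rightarrow> real \<Rightarrow> nat" where
  "rough_count x z = card {n. 1 \<le> n \<and> real n \<le> x \<and> ereal z \<le> Pminus n}"

end

theory Submission
  imports Defs "HOL-Real_Asymp.Real_Asymp"
begin

text \<open>Apart from the value \<open>x\<close>, an integer \<open>u\<close> in \<open>[2, x]\<close> without prime factors below \<open>sqrt x\<close> is a prime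
  in \<open>[sqrt x, x]\<close>. So for each of the primes \<open>v\<close> one counts such primes in one reduced residue class
  modulo \<open>k\<close>. As \<open>k\<close> is at most about \<open>x powr (2/5)\<close>, it suffices to know this count with an error
  \<open>x powr (1 - \<kappa>) / k\<close>, and a power is to spare compared with the error \<open>x powr (1/2 + o(1))\<close> that GRH
  gives. Under GRH, and by the classical non-vanishing on \<open>Re s = 1\<close>, the functions \<open>L s\<close> of the
  nonprincipal characters have no zero with \<open>Re s > 1/2\<close>, whence \<open>L'/L\<close> grows at most like a logarithm
  there (Borel-Caratheodory); moving the line of integration to \<open>Re s = 13/25\<close> in Perron's formula bounds the
  Riesz means of \<open>\<Lambda>(n) \<chi>(n)\<close>, and differencing these over intervals of length \<open>x powr (49/50)\<close>
  compares any two reduced residue classes. The main term then is an average over the classes and needs no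
  analysis; for the lower bound, Chebyshev's constant \<open>0.921\<close> is enough, because \<open>0.88 * 0.88 > 0.7533\<close>.\<close>

section \<open>Dirichlet characters\<close>

text \<open>\<open>GRH\<close> speaks of a function \<open>L\<close> subject to
  \<open>is_dirichlet_L\<close>, and only of the open strip. To apply it, an entire continuation of
  the Dirichlet series has to be exhibited, and the half-plane Re s \<ge> 1 has to be cleared of
  zeros by other means. The continuation comes from repeated summation by parts, which uses of a
  nonprincipal character only that it is periodic with sum zero over a period. The kernel 1 / (s (s
  + 1)) is preferred to 1 / s for its quadratic decay: against a logarithmic derivative that is
  bounded by a multiple of sqrt (1 + |Im s|) the integral over the shifted line converges
  absolutely, and no truncation error survives. The price is a smooth weight, removed by
  differencing over intervals of length h: this costs a factor x / h in the Riesz means and adds the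
  trivial count h / k of a class in a short interval. The result is uniform for \<open>k\<close> up
  to a multiple of x powr (2/5), so a single estimate serves both ranges of the exponent, and the
  second range only needs a lower bound for its main term.\<close>

lemma dc_mod:
  assumes "dirichlet_character q chi"
  shows "chi (n mod q) = chi n"
proof -
  have "chi (r + m * q) = chi r" for r m
  proof (induction m)
    case (Suc m)
    have "chi (r + Suc m * q) = chi ((r + m * q) + q)" by (simp add: algebra_simps)
    also have "\<dots> = chi (r + m * q)" using assms unfolding dirichlet_character_def by blast
    finally show ?case using Suc by simp
  qed auto
  from this[of "n mod q" "n div q"] show ?thesis by (simp add: mult.commute)
qed

lemma dc_cong:
  assumes "dirichlet_character q chi" "[m = n] (mod q)"
  shows "chi m = chi n"
  using assms dc_mod[of q chi m] dc_mod[of q chi n] by (simp add: cong_def)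

lemma dc_mult: "dirichlet_character q chi \<Longrightarrow> chi (m * n) = chi m * chi n"
  unfolding dirichlet_character_def by blast

lemma dc_nz_iff: "dirichlet_character q chi \<Longrightarrow> chi n \<noteq> 0 \<longleftrightarrow> coprime n q"
  unfolding dirichlet_character_def by blast

lemma dc_eq_0: "dirichlet_character q chi \<Longrightarrow> \<not> coprime n q \<Longrightarrow> chi n = 0"
  using dc_nz_iff by blast

lemma dc_pos: "dirichlet_character q chi \<Longrightarrow> q > 0"
  unfolding dirichlet_character_def by blast

lemma dc_1: assumes "dirichlet_character q chi" shows "chi 1 = 1"
proof -
  have "chi 1 * chi 1 = chi 1 * 1" using dc_mult[OF assms, of 1 1] by simp
  moreover have "chi 1 \<noteq> 0" using dc_nz_iff[OF assms, of 1] by simp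
  ultimately show ?thesis by (simp only: mult_cancel_left) simp
qed

lemma dc_power: assumes "dirichlet_character q chi" shows "chi (n ^ k) = chi n ^ k"
  by (induction k) (use dc_1[OF assms] in \<open>simp_all add: dc_mult[OF assms]\<close>)

lemma dc_root_of_unity:
  assumes "dirichlet_character q chi" "coprime n q"
  shows "chi n ^ totient q = 1"
proof -
  have "chi n ^ totient q = chi (n ^ totient q)" by (simp add: dc_power[OF assms(1)])
  also have "\<dots> = chi 1" using euler_theorem[OF assms(2)] by (intro dc_cong[OF assms(1)])
  finally show ?thesis using dc_1[OF assms(1)] by simp
qed

lemma dc_norm_1:
  assumes "dirichlet_character q chi" "coprime n q"
  shows "norm (chi n) = 1"
proof -
  have "norm (chi n) ^ totient q = 1"
    using dc_root_of_unity[OF assms] by (metis norm_one norm_power)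
  moreover have "totient q > 0" using dc_pos[OF assms(1)] by simp
  ultimately show ?thesis
    using power_eq_imp_eq_base[of "norm (chi n)" "totient q" 1] by simp
qed

lemma dc_norm_le_1:
  assumes "dirichlet_character q chi"
  shows "norm (chi n) \<le> 1"
  using dc_norm_1[OF assms] dc_eq_0[OF assms] by (cases "coprime n q") auto

lemma dc_principal:
  assumes "q > 0"
  shows "dirichlet_character q (principal_character q)"
proof -
  have "coprime (n + q) q \<longleftrightarrow> coprime n q" for n by (metis coprime_iff_gcd_eq_1 gcd_add1)
  with assms show ?thesis by (auto simp: dirichlet_character_def principal_character_def)
qed

lemma dc_nonprincipal_ex:
  assumes "dirichlet_character q chi" "chi \<noteq> principal_character q"
  obtains b where "coprime b q" "chi b \<noteq> 1"
proof -
  from assms(2) obtain b where b: "chi b \<noteq> principal_character q b" by auto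
  have "coprime b q"
    using b dc_eq_0[OF assms(1), of b] by (cases "coprime b q") (auto simp: principal_character_def)
  with b that[of b] show ?thesis by (auto simp: principal_character_def)
qed

lemma dc_eqI:
  assumes "dirichlet_character q chi" "dirichlet_character q psi"
    and "\<And>n. n < q \<Longrightarrow> coprime n q \<Longrightarrow> chi n = psi n"
  shows "chi = psi"
proof
  fix n
  have "chi (n mod q) = psi (n mod q)"
    using assms(3)[of "n mod q"] dc_pos[OF assms(1)] dc_eq_0[OF assms(1)] dc_eq_0[OF assms(2)]
    by (cases "coprime (n mod q) q") auto
  then show "chi n = psi n" by (simp add: dc_mod[OF assms(1)] dc_mod[OF assms(2)])
qed

lemma bij_betw_mult_mod:
  assumes "coprime b q" "q > (0::nat)"
  shows "bij_betw (\<lambda>n. (b * n) mod q) {..<q} {..<q}"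
proof -
  have inj: "inj_on (\<lambda>n. (b * n) mod q) {..<q}"
  proof (rule inj_onI)
    fix m n assume "m \<in> {..<q}" "n \<in> {..<q}" "(b * m) mod q = (b * n) mod q"
    then have "[m = n] (mod q)" using assms(1) by (metis cong_def cong_mult_lcancel_nat)
    then show "m = n" using \<open>m \<in> _\<close> \<open>n \<in> _\<close> by (simp add: cong_def)
  qed
  moreover have "(\<lambda>n. (b * n) mod q) ` {..<q} \<subseteq> {..<q}" using assms(2) by auto
  ultimately show ?thesis
    by (simp add: bij_betw_def endo_inj_surj)
qed

lemma dc_sum_period:
  assumes "dirichlet_character q chi" "chi \<noteq> principal_character q"
  shows "(\<Sum>n<q. chi n) = 0"
proof -
  obtain b where b: "coprime b q" "chi b \<noteq> 1" using dc_nonprincipal_ex[OF assms] .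
  have "(\<Sum>n<q. chi n) = (\<Sum>n<q. chi ((b * n) mod q))"
    using sum.reindex_bij_betw[OF bij_betw_mult_mod[OF b(1) dc_pos[OF assms(1)]], of chi] by simp
  also have "\<dots> = chi b * (\<Sum>n<q. chi n)"
    by (simp add: dc_mod[OF assms(1)] dc_mult[OF assms(1)] sum_distrib_left)
  finally show ?thesis using b(2) by (metis mult_cancel_right1 mult.commute)
qed

text \<open>A character of a subgroup of the units modulo \<open>q\<close>. The subgroup is encoded
  as the union \<open>H\<close> of its residue classes in the naturals, so that no quotient is
  formed; outside \<open>H\<close> the function is arbitrary. Such characters are extended one
  generator at a time until they are Dirichlet characters.\<close>

definition partial_character :: "nat \<Rightarrow> nat set \<Rightarrow> (nat \<Rightarrow> complex) \<Rightarrow> bool" where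
  "partial_character q H chi \<longleftrightarrow> 1 \<in> H \<and> (\<forall>n\<in>H. coprime n q) \<and>
     (\<forall>m\<in>H. \<forall>n\<in>H. m * n \<in> H \<and> chi (m * n) = chi m * chi n) \<and>
     (\<forall>m\<in>H. \<forall>n. [m = n] (mod q) \<longrightarrow> n \<in> H \<and> chi n = chi m) \<and> chi 1 = 1"

lemma partial_characterD:
  assumes "partial_character q H chi"
  shows "1 \<in> H" "chi 1 = 1" "n \<in> H \<Longrightarrow> coprime n q"
    "m \<in> H \<Longrightarrow> n \<in> H \<Longrightarrow> m * n \<in> H"
    "m \<in> H \<Longrightarrow> n \<in> H \<Longrightarrow> chi (m * n) = chi m * chi n"
    "m \<in> H \<Longrightarrow> [m = n] (mod q) \<Longrightarrow> n \<in> H"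
    "m \<in> H \<Longrightarrow> [m = n] (mod q) \<Longrightarrow> chi n = chi m"
  using assms unfolding partial_character_def by blast+

lemma partial_character_power:
  assumes "partial_character q H chi" "h \<in> H"
  shows "h ^ k \<in> H \<and> chi (h ^ k) = chi h ^ k"
proof (induction k)
  case 0
  then show ?case using partial_characterD(1,2)[OF assms(1)] by simp
next
  case (Suc k)
  then show ?case using partial_characterD(4,5)[OF assms(1) assms(2), of "h ^ k"] by simp
qed

text \<open>Closure under division. Inverses need not be postulated:
  \<open>h ^ (totient q - 1)\<close> lies in \<open>H\<close> and inverts \<open>h\<close> by
  Euler's theorem.\<close>

lemma partial_character_cancel:
  assumes "partial_character q H chi" "q > 0" "h \<in> H" "h' \<in> H" "[h * t = h'] (mod q)"
  shows "t \<in> H \<and> chi h' = chi h * chi t"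
proof -
  have H: "m * n \<in> H" "chi (m * n) = chi m * chi n" if "m \<in> H" "n \<in> H" for m n
    using partial_characterD(4,5)[OF assms(1) that] by simp_all
  have C: "n \<in> H" "chi n = chi m" if "m \<in> H" "[m = n] (mod q)" for m n
    using partial_characterD(6,7)[OF assms(1) that] by simp_all
  have cop: "coprime h q" using partial_characterD(3)[OF assms(1,3)] .
  define i where "i = h ^ (totient q - 1)"
  have i: "i \<in> H" using partial_character_power[OF assms(1,3)] by (simp add: i_def)
  have "i * h = h ^ totient q"
    using assms(2) by (simp add: i_def power_Suc2[symmetric] del: power_Suc)
  then have ih: "[i * h = 1] (mod q)" using euler_theorem[OF cop] by simp
  have "[i * h' = i * (h * t)] (mod q)" using assms(5) by (intro cong_mult) (auto simp: cong_sym)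
  also have "i * (h * t) = (i * h) * t" by simp
  also have "[(i * h) * t = 1 * t] (mod q)" using ih by (intro cong_mult) auto
  finally have "[i * h' = t] (mod q)" by simp
  with C H i assms(4) have t: "t \<in> H" by blast
  then show ?thesis using C(2)[OF H(1)[OF assms(3) t] assms(5)] H(2)[OF assms(3) t] by simp
qed

text \<open>\<open>H'\<close> is the subgroup generated by \<open>H\<close> and \<open>g\<close>,
  with elements h * g ^ i. As \<open>m\<close> is the order of \<open>g\<close> modulo
  \<open>H\<close>, the value at \<open>g\<close> may be any \<open>m\<close>-th root of
  \<open>chi (g ^ m)\<close>; this freedom is what later separates elements.\<close>

lemma partial_character_extend:
  assumes pc: "partial_character q H chi" and q: "q > 0" and g: "coprime g q"
    and m: "m > 0" "g ^ m \<in> H" "\<And>i. 0 < i \<Longrightarrow> i < m \<Longrightarrow> g ^ i \<notin> H"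
    and z: "z ^ m = chi (g ^ m)"
  obtains H' chi' where "partial_character q H' chi'" "H \<subseteq> H'" "g \<in> H'" "chi' g = z"
    "\<And>h. h \<in> H \<Longrightarrow> chi' h = chi h"
proof -
  have H: "a * b \<in> H" "chi (a * b) = chi a * chi b" if "a \<in> H" "b \<in> H" for a b
    using partial_characterD(4,5)[OF pc that] by simp_all
  have C: "b \<in> H" "chi b = chi a" if "a \<in> H" "[a = b] (mod q)" for a b
    using partial_characterD(6,7)[OF pc that] by simp_all
  have one: "1 \<in> H" "chi 1 = 1" using partial_characterD(1,2)[OF pc] by simp_all
  have cop: "coprime h q" if "h \<in> H" for h using partial_characterD(3)[OF pc that] .
  \<comment> \<open>Minimality of \<open>m\<close> makes it divide every \<open>d\<close> with
    \<open>g ^ d\<close> in \<open>H\<close>. So \<open>z\<close> agrees with \<open>chi\<close> on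
    all powers of \<open>g\<close> that lie in \<open>H\<close>, the only place where a conflict
    could arise.\<close>
  have pw: "g ^ d \<in> H \<Longrightarrow> chi (g ^ d) = z ^ d" for d
  proof -
    assume d: "g ^ d \<in> H"
    have eq: "g ^ d = (g ^ m) ^ (d div m) * g ^ (d mod m)"
      by (simp add: power_mult[symmetric] power_add[symmetric])
    have 1: "(g ^ m) ^ (d div m) \<in> H" "chi ((g ^ m) ^ (d div m)) = chi (g ^ m) ^ (d div m)"
      using partial_character_power[OF pc m(2)] by blast+
    have 2: "g ^ (d mod m) \<in> H \<and> chi (g ^ d) = chi ((g ^ m) ^ (d div m)) * chi (g ^ (d mod m))"
      by (rule partial_character_cancel[OF pc q 1(1) d]) (simp add: eq[symmetric])
    then have "d mod m = 0" using m(3)[of "d mod m"] m(1) by (metis gr0I mod_less_divisor)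
    then have "chi (g ^ d) = (z ^ m) ^ (d div m)" using 2 1 one z by simp
    also have "\<dots> = z ^ d" using \<open>d mod m = 0\<close> by (metis dvd_mult_div_cancel mod_0_imp_dvd power_mult)
    finally show "chi (g ^ d) = z ^ d" .
  qed
  have wd0: "chi h * z ^ i = chi h' * z ^ j"
    if "h \<in> H" "h' \<in> H" "[h * g ^ i = h' * g ^ j] (mod q)" "j \<le> i" for h h' i j
  proof -
    have "[(h * g ^ (i - j)) * g ^ j = h' * g ^ j] (mod q)"
      using that(3,4) by (simp add: mult.assoc power_add[symmetric])
    then have "[h * g ^ (i - j) = h'] (mod q)"
      using g cong_mult_rcancel_nat[of "g ^ j" q] by (simp add: coprime_power_left_iff)
    from partial_character_cancel[OF pc q that(1,2) this] pw[of "i - j"]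
    have "chi h' = chi h * z ^ (i - j)" by auto
    then show ?thesis using that(4) by (simp add: mult.assoc power_add[symmetric])
  qed
  have wd: "chi h * z ^ i = chi h' * z ^ j"
    if "h \<in> H" "h' \<in> H" "[h * g ^ i = h' * g ^ j] (mod q)" for h h' i j
    using wd0[OF that(1,2,3)] wd0[OF that(2,1) cong_sym[OF that(3)]] by (cases "j \<le> i") auto
  define H' where "H' = {n. \<exists>h\<in>H. \<exists>i. [n = h * g ^ i] (mod q)}"
  \<comment> \<open>The value is read off from some representation h * g ^ i; by \<open>wd\<close>
    every other representation gives the same.\<close>
  define chi' where "chi' = (\<lambda>n. SOME w. \<exists>h\<in>H. \<exists>i. [n = h * g ^ i] (mod q) \<and> w = chi h * z ^ i)"
  have chi': "chi' n = chi h * z ^ i" if "h \<in> H" "[n = h * g ^ i] (mod q)" for n h i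
  proof -
    have "\<exists>w. \<exists>h\<in>H. \<exists>i. [n = h * g ^ i] (mod q) \<and> w = chi h * z ^ i" using that by blast
    from someI_ex[OF this] obtain h' j where "h' \<in> H" "[n = h' * g ^ j] (mod q)" "chi' n = chi h' * z ^ j"
      unfolding chi'_def by blast
    with wd[of h h' i j] that show ?thesis by (metis cong_sym cong_trans)
  qed
  have "partial_character q H' chi'"
    unfolding partial_character_def
  proof (intro conjI ballI allI impI)
    show "1 \<in> H'" unfolding H'_def using one by (auto intro!: bexI[of _ 1] exI[of _ 0])
    show "chi' 1 = 1" using chi'[of 1 1 0] one by simp
  next
    fix n assume "n \<in> H'"
    then obtain h i where "h \<in> H" "[n = h * g ^ i] (mod q)" by (auto simp: H'_def)
    moreover from this cop g have "coprime (h * g ^ i) q" by (simp add: coprime_power_left_iff)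
    ultimately show "coprime n q" by (metis cong_imp_coprime cong_sym coprime_commute)
  next
    fix a b assume "a \<in> H'" "b \<in> H'"
    then obtain h i h' j where *: "h \<in> H" "[a = h * g ^ i] (mod q)" "h' \<in> H" "[b = h' * g ^ j] (mod q)"
      by (auto simp: H'_def)
    have "[a * b = (h * g ^ i) * (h' * g ^ j)] (mod q)" using * by (intro cong_mult)
    also have "(h * g ^ i) * (h' * g ^ j) = (h * h') * g ^ (i + j)" by (simp add: power_add)
    finally have **: "[a * b = (h * h') * g ^ (i + j)] (mod q)" .
    show "a * b \<in> H'" unfolding H'_def using ** H(1)[OF *(1,3)] by blast
    show "chi' (a * b) = chi' a * chi' b"
      using chi'[OF H(1)[OF *(1,3)] **] chi'[OF *(1,2)] chi'[OF *(3,4)] H(2)[OF *(1,3)]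
      by (simp add: power_add)
  next
    fix a b assume "a \<in> H'" and ab: "[a = b] (mod q)"
    then obtain h i where *: "h \<in> H" "[a = h * g ^ i] (mod q)" by (auto simp: H'_def)
    have **: "[b = h * g ^ i] (mod q)" using ab * by (metis cong_sym cong_trans)
    show "b \<in> H'" unfolding H'_def using * ** by blast
    show "chi' b = chi' a" using chi'[OF *] chi'[OF *(1) **] by simp
  qed
  moreover have "H \<subseteq> H'" unfolding H'_def by (auto intro!: bexI exI[of _ 0])
  moreover have "g \<in> H'" unfolding H'_def using one by (auto intro!: bexI[of _ 1] exI[of _ 1])
  moreover have "chi' g = z" using chi'[of 1 g 1] one by simp
  moreover have "chi' h = chi h" if "h \<in> H" for h using chi'[OF that, of h 0] by simp
  ultimately show ?thesis using that by blast
qed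

lemma least_power_in:
  assumes "partial_character q H chi" "q > 0" "coprime g q"
  obtains m where "m > 0" "g ^ m \<in> H" "\<And>i. 0 < i \<Longrightarrow> i < m \<Longrightarrow> g ^ i \<notin> H"
proof -
  have "[1 = g ^ totient q] (mod q)" using euler_theorem[OF assms(3)] by (simp add: cong_sym)
  then have "g ^ totient q \<in> H" using partial_characterD(1,6)[OF assms(1)] by blast
  then have *: "\<exists>m. m > 0 \<and> g ^ m \<in> H" using assms(2) by (intro exI[of _ "totient q"]) auto
  define m where "m = (LEAST m. m > 0 \<and> g ^ m \<in> H)"
  have "m > 0" "g ^ m \<in> H" using LeastI_ex[OF *] by (simp_all add: m_def)
  moreover have "g ^ i \<notin> H" if "0 < i" "i < m" for i
    using not_less_Least[of i "\<lambda>m. m > 0 \<and> g ^ m \<in> H"] that by (auto simp: m_def)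
  ultimately show ?thesis using that by metis
qed

text \<open>Induction on the number of residues below \<open>q\<close> outside \<open>H\<close>: a
  missing unit can always be adjoined because complex numbers have \<open>m\<close>-th roots. Once
  \<open>H\<close> contains all units, extension by 0 gives a Dirichlet character.\<close>

lemma partial_character_total:
  assumes "partial_character q H chi" "q > 0"
  obtains chi' where "dirichlet_character q chi'" "\<And>h. h \<in> H \<Longrightarrow> chi' h = chi h"
proof -
  have "\<exists>chi'. dirichlet_character q chi' \<and> (\<forall>h\<in>H. chi' h = chi h)"
    using assms(1)
  proof (induction "q - card (H \<inter> {..<q})" arbitrary: H chi rule: less_induct)
    case less
    show ?case
    proof (cases "\<exists>g. coprime g q \<and> g \<notin> H")
      case True
      then obtain g where g: "coprime g q" "g \<notin> H" by blast
      obtain m where m: "m > 0" "g ^ m \<in> H" "\<And>i. 0 < i \<Longrightarrow> i < m \<Longrightarrow> g ^ i \<notin> H"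
        using least_power_in[OF less.prems assms(2) g(1)] by blast
      obtain z where z: "z ^ m = chi (g ^ m)"
      proof (cases "chi (g ^ m) = 0")
        case True
        then show ?thesis using that[of 0] m(1) by (simp add: power_0_left)
      next
        case False
        then show ?thesis
          using that[of "exp (Ln (chi (g ^ m)) / of_nat m)"] m(1) by (simp add: exp_of_nat_mult[symmetric])
      qed
      obtain H' chi' where H': "partial_character q H' chi'" "H \<subseteq> H'" "g \<in> H'" "\<And>h. h \<in> H \<Longrightarrow> chi' h = chi h"
        using partial_character_extend[OF less.prems assms(2) g(1) m z] by metis
      have "[g = g mod q] (mod q)" by (simp add: cong_def)
      then have "g mod q \<in> H'" "g mod q \<notin> H"
        using partial_characterD(6)[OF H'(1) H'(3)] partial_characterD(6)[OF less.prems, of "g mod q" g] g(2)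
        by (auto dest: cong_sym)
      then have "H \<inter> {..<q} \<subset> H' \<inter> {..<q}" using H'(2) assms(2) mod_less_divisor by auto
      then have "card (H \<inter> {..<q}) < card (H' \<inter> {..<q})" by (intro psubset_card_mono) auto
      moreover have "card (H' \<inter> {..<q}) \<le> q" using card_mono[of "{..<q}" "H' \<inter> {..<q}"] by auto
      ultimately have "q - card (H' \<inter> {..<q}) < q - card (H \<inter> {..<q})" by linarith
      from less.hyps[OF this H'(1)] H'(2,4) show ?thesis by (metis subsetD)
    next
      case False
      then have H: "H = {n. coprime n q}" using partial_characterD(3)[OF less.prems] by blast
      define psi where "psi = (\<lambda>n. if coprime n q then chi n else 0)"
      have nz: "chi n \<noteq> 0" if "coprime n q" for n
      proof -
        have "[n ^ totient q = 1] (mod q)" using euler_theorem[OF that] .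
        then have "chi (n ^ totient q) = 1"
          using partial_characterD(1,2)[OF less.prems] partial_characterD(7)[OF less.prems, of 1 "n ^ totient q"]
          by (simp add: cong_sym_eq)
        then have "chi n ^ totient q = 1"
          using partial_character_power[OF less.prems, of n] that H by simp
        then show ?thesis using assms(2) by (auto simp: power_0_left split: if_splits)
      qed
      have "dirichlet_character q psi"
        unfolding dirichlet_character_def
      proof (intro conjI allI)
        fix n
        have "coprime (n + q) q \<longleftrightarrow> coprime n q" by (metis coprime_iff_gcd_eq_1 gcd_add1)
        moreover have "[n = n + q] (mod q)" by (simp add: cong_def)
        ultimately show "psi (n + q) = psi n"
          using partial_characterD(7)[OF less.prems, of n "n + q"] H by (simp add: psi_def)
      next
        fix m n show "psi (m * n) = psi m * psi n"
          using partial_characterD(5)[OF less.prems, of m n] H by (simp add: psi_def)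
      qed (use assms nz in \<open>auto simp: psi_def\<close>)
      then show ?thesis using H by (auto simp: psi_def)
    qed
  qed
  then show ?thesis using that by blast
qed

text \<open>Start from the trivial character on the class of 1 and adjoin \<open>n\<close>. Its
  order \<open>m\<close> is at least 2, so a primitive \<open>m\<close>-th root of unity, which
  differs from 1, is an admissible value.\<close>

lemma dc_separates:
  assumes "coprime n q" "q > 0" "\<not> [n = 1] (mod q)"
  obtains chi where "dirichlet_character q chi" "chi n \<noteq> 1"
proof -
  have pc: "partial_character q {n. [n = 1] (mod q)} (\<lambda>_. 1)"
    unfolding partial_character_def
  proof (intro conjI ballI allI impI)
    fix a b assume "a \<in> {n. [n = 1] (mod q)}" "b \<in> {n. [n = 1] (mod q)}"
    then show "a * b \<in> {n. [n = 1] (mod q)}" using cong_mult[of a 1 q b 1] by simp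
  next
    fix a assume "a \<in> {n. [n = 1] (mod q)}"
    then show "coprime a q" using cong_imp_coprime[of 1 a q] by (simp add: cong_sym_eq)
  next
    fix a b assume "a \<in> {n. [n = 1] (mod q)}" "[a = b] (mod q)"
    then show "b \<in> {n. [n = 1] (mod q)}" by (auto intro: cong_trans cong_sym)
  qed auto
  obtain m where m: "m > 0" "n ^ m \<in> {n. [n = 1] (mod q)}"
      "\<And>i. 0 < i \<Longrightarrow> i < m \<Longrightarrow> n ^ i \<notin> {n. [n = 1] (mod q)}"
    using least_power_in[OF pc assms(2,1)] by blast
  have "m \<noteq> 1" using m(2) assms(3) by auto
  then have m2: "m \<ge> 2" using m(1) by linarith
  define z where "z = cis (2 * pi / real m)"
  have z: "z ^ m = 1" using m(1) by (simp add: z_def Complex.DeMoivre)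
  have "z \<noteq> 1"
  proof
    assume "z = 1"
    then have "cos (2 * pi / real m) = 1" by (simp add: z_def complex_eq_iff)
    then obtain k :: int where k: "2 * pi / real m = of_int k * 2 * pi" using cos_one_2pi_int by blast
    then have k': "1 = real m * of_int k" using m2 by (simp add: field_simps)
    then have "(1::int) = int m * k" by (metis of_int_1 of_int_eq_iff of_int_mult of_int_of_nat_eq)
    then show False using m2 by (simp add: zmult_eq_1_iff eq_commute[of 1])
  qed
  obtain H' chi' where H': "partial_character q H' chi'" "n \<in> H'" "chi' n = z"
    using partial_character_extend[OF pc assms(2,1) m z] by metis
  obtain chi where "dirichlet_character q chi" "\<And>h. h \<in> H' \<Longrightarrow> chi h = chi' h"
    using partial_character_total[OF H'(1) assms(2)] by blast
  with H' \<open>z \<noteq> 1\<close> that show ?thesis by metis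
qed

section \<open>Finiteness and orthogonality of the characters modulo q\<close>

definition dcharacters :: "nat \<Rightarrow> (nat \<Rightarrow> complex) set" where
  "dcharacters q = {chi. dirichlet_character q chi}"

lemma finite_dcharacters:
  assumes "q > 0"
  shows "finite (dcharacters q)"
proof -
  define A where "A = insert 0 {z::complex. z ^ totient q = 1}"
  have "finite A" using assms by (simp add: A_def finite_nth_roots)
  then have fin: "finite (PiE {..<q} (\<lambda>_. A))" by (intro finite_PiE) auto
  have "inj_on (\<lambda>chi. restrict chi {..<q}) (dcharacters q)"
  proof (rule inj_onI)
    fix chi psi assume "chi \<in> dcharacters q" "psi \<in> dcharacters q"
      and eq: "restrict chi {..<q} = restrict psi {..<q}"
    then show "chi = psi"
      by (intro dc_eqI[of q]) (auto simp: dcharacters_def restrict_def fun_eq_iff, metis)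
  qed
  moreover have "(\<lambda>chi. restrict chi {..<q}) ` dcharacters q \<subseteq> PiE {..<q} (\<lambda>_. A)"
  proof (rule image_subsetI)
    fix chi assume "chi \<in> dcharacters q"
    then have chi: "dirichlet_character q chi" by (simp add: dcharacters_def)
    have "chi n \<in> A" for n
      using dc_root_of_unity[OF chi, of n] dc_nz_iff[OF chi, of n] by (auto simp: A_def)
    then show "restrict chi {..<q} \<in> PiE {..<q} (\<lambda>_. A)" by auto
  qed
  ultimately show ?thesis using finite_imageD[OF finite_subset[OF _ fin]] by metis
qed

lemma dc_times:
  assumes "dirichlet_character q chi" "dirichlet_character q psi"
  shows "dirichlet_character q (\<lambda>n. chi n * psi n)"
  using assms unfolding dirichlet_character_def by auto

text \<open>Twisting by one character \<open>psi\<close> with \<open>psi n \<noteq> 1\<close>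
  permutes all characters and multiplies the sum by \<open>psi n\<close>. The number of characters
  is left uncomputed: it cancels where the relation is applied.\<close>

lemma sum_dcharacters:
  assumes "q > 0"
  shows "(\<Sum>chi\<in>dcharacters q. chi n) = (if [n = 1] (mod q) then of_nat (card (dcharacters q)) else 0)"
proof (cases "coprime n q")
  case False
  then have "\<not> [n = 1] (mod q)" by (metis cong_imp_coprime cong_sym coprime_1_left)
  then show ?thesis using False dc_eq_0[of q _ n] by (auto simp: dcharacters_def intro!: sum.neutral)
next
  case True
  show ?thesis
  proof (cases "[n = 1] (mod q)")
    case True
    then have "chi n = 1" if "chi \<in> dcharacters q" for chi
      using that dc_cong[of q chi n 1] dc_1 by (auto simp: dcharacters_def)
    then have "(\<Sum>chi\<in>dcharacters q. chi n) = (\<Sum>chi\<in>dcharacters q. 1)" by (rule sum.cong[OF refl])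
    with True show ?thesis by simp
  next
    case False
    obtain psi where psi: "dirichlet_character q psi" "psi n \<noteq> 1"
      using dc_separates[OF \<open>coprime n q\<close> assms False] .
    define T where "T = (\<lambda>chi::nat \<Rightarrow> complex. (\<lambda>n. psi n * chi n))"
    have "inj_on T (dcharacters q)"
    proof (rule inj_onI)
      fix a b assume ab: "a \<in> dcharacters q" "b \<in> dcharacters q" "T a = T b"
      then show "a = b"
        by (intro dc_eqI[of q]) (auto simp: dcharacters_def T_def fun_eq_iff dc_nz_iff[OF psi(1)]
            dest!: dc_nz_iff[OF psi(1), THEN iffD2] spec)
    qed
    moreover have "T ` dcharacters q \<subseteq> dcharacters q"
      using dc_times[OF psi(1)] by (auto simp: T_def dcharacters_def)
    ultimately have "bij_betw T (dcharacters q) (dcharacters q)"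
      using finite_dcharacters[OF assms] by (simp add: bij_betw_def endo_inj_surj)
    then have "(\<Sum>chi\<in>dcharacters q. chi n) = (\<Sum>chi\<in>dcharacters q. T chi n)"
      using sum.reindex_bij_betw[of T _ _ "\<lambda>chi. chi n"] by metis
    also have "\<dots> = psi n * (\<Sum>chi\<in>dcharacters q. chi n)" by (simp add: T_def sum_distrib_left)
    finally have "(\<Sum>chi\<in>dcharacters q. chi n) = 0" using psi(2) by (metis mult_cancel_right1 mult.commute)
    with False show ?thesis by simp
  qed
qed

section \<open>Analytic continuation\<close>

lemma has_field_derivative_of_real_powr:
  fixes s :: complex
  assumes "t > 0"
  shows "((\<lambda>t. of_real t powr (-s)) has_vector_derivative - s * of_real t powr (- s - 1)) (at t within A)"
proof -
  have "((\<lambda>z::complex. z powr (-s)) has_field_derivative (-s) * of_real t powr (-s - 1)) (at (of_real t))"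
    using assms by (intro has_field_derivative_powr) auto
  then show ?thesis
    by (rule has_vector_derivative_real_field[THEN has_vector_derivative_at_within])
qed

text \<open>Up to the sign (-1) ^ m this is the \<open>m\<close>-th forward difference of u powr
  (-s) at \<open>x\<close>, the weight that remains after \<open>m\<close> summations by
  parts.\<close>

primrec pdiff :: "nat \<Rightarrow> complex \<Rightarrow> real \<Rightarrow> complex" where
  "pdiff 0 s x = of_real x powr (-s)"
| "pdiff (Suc m) s x = pdiff m s x - pdiff m s (x + 1)"

lemma pdiff_holomorphic: "x > 0 \<Longrightarrow> (\<lambda>s. pdiff m s x) holomorphic_on A"
  by (induction m arbitrary: x) (auto intro!: holomorphic_intros)

lemma pdiff_deriv:
  "x > 0 \<Longrightarrow> (pdiff m s has_vector_derivative - s * pdiff m (s + 1) x) (at x within A)"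
proof (induction m arbitrary: x A)
  case 0
  have "pdiff 0 s = (\<lambda>x. of_real x powr (-s))" "pdiff 0 (s + 1) x = of_real x powr (- s - 1)"
    by (auto simp: fun_eq_iff)
  then show ?case using has_field_derivative_of_real_powr[OF 0, of s A] by (simp only:)
next
  case (Suc m)
  have "((\<lambda>x. pdiff m s (x + 1)) has_vector_derivative (- s * pdiff m (s + 1) (x + 1))) (at x within A)"
  proof -
    have "((\<lambda>x. x + 1) has_vector_derivative 1) (at x within A)" by (auto intro!: derivative_eq_intros)
    from vector_diff_chain_within[OF this Suc.IH[of "x + 1"]] show ?thesis using Suc.prems by (simp add: o_def)
  qed
  from has_vector_derivative_diff[OF Suc.IH[OF Suc.prems] this]
  have "((\<lambda>x. pdiff m s x - pdiff m s (x + 1)) has_vector_derivative - s * pdiff (Suc m) (s + 1) x) (at x within A)"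
    by (simp add: right_diff_distrib)
  moreover have "pdiff (Suc m) s = (\<lambda>x. pdiff m s x - pdiff m s (x + 1))" by (simp add: fun_eq_iff)
  ultimately show ?case by (simp only:)
qed

text \<open>Each difference is bounded through the derivative on [x, x + 1], which lowers the
  exponent by 1 and contributes one factor of s (s + 1) ... (s + m - 1). The condition on
  \<open>Re s\<close> makes the resulting powers decreasing, so that the left end point gives the
  maximum.\<close>

lemma norm_pdiff_le:
  assumes "x \<ge> 1" "Re s + real m \<ge> 0"
  shows "norm (pdiff m s x) \<le> (\<Prod>i<m. norm (s + of_nat i)) * x powr (- Re s - real m)"
  using assms
proof (induction m arbitrary: s x)
  case 0
  then show ?case by (simp add: norm_powr_real_powr)
next
  case (Suc m)
  define B where "B = norm s * ((\<Prod>i<m. norm (s + 1 + of_nat i)) * x powr (- Re s - real (Suc m)))"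
  have "norm (pdiff m s (x + 1) - pdiff m s x) \<le> B * norm ((x + 1) - x)"
  proof (rule differentiable_bound[where S="{x..x+1}" and f'="\<lambda>t h. h *\<^sub>R (- s * pdiff m (s + 1) t)"])
    show "(pdiff m s has_derivative (\<lambda>h. h *\<^sub>R (- s * pdiff m (s + 1) t))) (at t within {x..x + 1})"
      if "t \<in> {x..x+1}" for t
      using pdiff_deriv[of t m s "{x..x+1}"] that Suc.prems by (auto simp: has_vector_derivative_def)
    show "onorm (\<lambda>h. h *\<^sub>R (- s * pdiff m (s + 1) t)) \<le> B" if "t \<in> {x..x+1}" for t
    proof (rule onorm_bound)
      have "norm (pdiff m (s + 1) t) \<le> (\<Prod>i<m. norm (s + 1 + of_nat i)) * t powr (- Re (s + 1) - real m)"
        using that Suc.prems by (intro Suc.IH) auto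
      also have "\<dots> \<le> (\<Prod>i<m. norm (s + 1 + of_nat i)) * x powr (- Re s - real (Suc m))"
      proof -
        have eq: "- Re (s + 1) - real m = - Re s - real (Suc m)" by simp
        show ?thesis unfolding eq
          using that Suc.prems by (intro mult_left_mono prod_nonneg powr_mono2') auto
      qed
      finally have "norm s * norm (pdiff m (s + 1) t) \<le> B" unfolding B_def by (intro mult_left_mono) auto
      then show "norm (h *\<^sub>R (- s * pdiff m (s + 1) t)) \<le> B * norm h" for h
        using mult_left_mono[of "norm s * norm (pdiff m (s + 1) t)" B "\<bar>h\<bar>"] by (simp add: norm_mult mult.commute[of B])
      show "0 \<le> B" unfolding B_def by (intro mult_nonneg_nonneg prod_nonneg) auto
    qed
  qed auto
  also have "\<dots> = (\<Prod>i<Suc m. norm (s + of_nat i)) * x powr (- Re s - real (Suc m))"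
    unfolding B_def by (subst prod.lessThan_Suc_shift) (simp add: algebra_simps)
  finally show ?case by (simp add: norm_minus_commute)
qed

lemma summable_powr_Suc:
  assumes "r > 1"
  shows "summable (\<lambda>n. C * real (Suc n) powr (-r))"
proof -
  have "summable (\<lambda>n. real n powr (-r))" using assms summable_real_powr_iff[of "-r"] by simp
  then have "summable (\<lambda>n. real (Suc n) powr (-r))" by (subst summable_Suc_iff)
  then show ?thesis by (rule summable_mult)
qed

text \<open>The local Weierstrass test. Termwise differentiation is included because the derivative
  of a Dirichlet series is needed as a series, in the convolution identity for the logarithmic
  derivative.\<close>

lemma holomorphic_series:
  fixes f :: "nat \<Rightarrow> complex \<Rightarrow> complex"
  assumes "open S" "\<And>n. f n holomorphic_on S"
    and "\<And>x. x \<in> S \<Longrightarrow> \<exists>d h. 0 < d \<and> summable h \<and> (\<forall>n. \<forall>y\<in>ball x d \<inter> S. norm (f n y) \<le> h n)"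
  obtains g where "g holomorphic_on S" "\<And>x. x \<in> S \<Longrightarrow> (\<lambda>n. f n x) sums g x"
    "\<And>x. x \<in> S \<Longrightarrow> (\<lambda>n. deriv (f n) x) sums deriv g x"
proof -
  have "\<exists>g g'. \<forall>x\<in>S. ((\<lambda>n. f n x) sums g x) \<and> ((\<lambda>n. deriv (f n) x) sums g' x) \<and> (g has_field_derivative g' x) (at x)"
  proof (rule series_and_derivative_comparison_local[OF assms(1)])
    show "(f n has_field_derivative deriv (f n) x) (at x)" if "x \<in> S" for n x
      using assms(1,2) that holomorphic_derivI by blast
    show "\<exists>d h. 0 < d \<and> summable h \<and> (\<forall>\<^sub>F n in sequentially. \<forall>y\<in>ball x d \<inter> S. norm (f n y) \<le> h n)"
      if x: "x \<in> S" for x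
    proof -
      obtain d h where "0 < d" "summable h" "\<forall>n. \<forall>y\<in>ball x d \<inter> S. norm (f n y) \<le> h n"
        using assms(3)[OF x] by blast
      then show ?thesis by (intro exI[of _ d] exI[of _ h] conjI always_eventually) auto
    qed
  qed
  then obtain g g' where g: "\<forall>x\<in>S. ((\<lambda>n. f n x) sums g x) \<and> ((\<lambda>n. deriv (f n) x) sums g' x) \<and> (g has_field_derivative g' x) (at x)"
    by blast
  then have "g holomorphic_on S" using holomorphic_on_open[OF assms(1)] by blast
  moreover have "deriv g x = g' x" if "x \<in> S" for x using g that by (intro DERIV_imp_deriv) auto
  ultimately show ?thesis using g that by metis
qed

lemma pdiff_series:
  fixes g :: "nat \<Rightarrow> complex"
  assumes B: "\<And>n. norm (g n) \<le> B"
  obtains G where "G holomorphic_on {s. Re s > 1 - real m}"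
    "\<And>s. Re s > 1 - real m \<Longrightarrow> (\<lambda>n. g n * pdiff m s (real (Suc n))) sums G s"
proof (rule holomorphic_series[of "{s. Re s > 1 - real m}" "\<lambda>n s. g n * pdiff m s (real (Suc n))"])
  show "open {s. 1 - real m < Re s}" by (rule open_halfspace_Re_gt)
  show "(\<lambda>s. g n * pdiff m s (real (Suc n))) holomorphic_on {s. 1 - real m < Re s}" for n
    by (intro holomorphic_intros pdiff_holomorphic) auto
  fix s0 assume s0: "s0 \<in> {s. 1 - real m < Re s}"
  define d where "d = (Re s0 - (1 - real m)) / 2"
  have d: "d > 0" using s0 by (simp add: d_def)
  define C where "C = (\<Prod>i<m. norm s0 + d + real i)"
  have B0: "B \<ge> 0" using B[of 0] norm_ge_zero order_trans by blast
  show "\<exists>d h. 0 < d \<and> summable h \<and> (\<forall>n. \<forall>y\<in>ball s0 d \<inter> {s. 1 - real m < Re s}. norm (g n * pdiff m y (real (Suc n))) \<le> h n)"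
  proof (intro exI conjI allI ballI)
    show "summable (\<lambda>n. (B * C) * real (Suc n) powr (-(1 + d)))" using d by (intro summable_powr_Suc) auto
    fix n y assume y: "y \<in> ball s0 d \<inter> {s. 1 - real m < Re s}"
    then have dist: "norm (y - s0) < d" by (simp add: dist_norm norm_minus_commute)
    then have Re: "Re y \<ge> Re s0 - d" using abs_Re_le_cmod[of "y - s0"] by simp
    then have Re': "Re y + real m \<ge> 1 + d" by (simp add: d_def field_simps)
    have "norm (pdiff m y (real (Suc n))) \<le> (\<Prod>i<m. norm (y + of_nat i)) * real (Suc n) powr (- Re y - real m)"
      using Re' d by (intro norm_pdiff_le) auto
    also have "\<dots> \<le> C * real (Suc n) powr (-(1 + d))"
    proof (intro mult_mono)
      show "(\<Prod>i<m. norm (y + of_nat i)) \<le> C" unfolding C_def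
      proof (intro prod_mono conjI)
        fix i
        have "norm (y + of_nat i) \<le> norm y + real i" using norm_triangle_ineq[of y "of_nat i"] by simp
        also have "norm y \<le> norm s0 + d" using dist norm_triangle_ineq2[of y s0] by simp
        finally show "norm (y + of_nat i) \<le> norm s0 + d + real i" by simp
      qed auto
      show "real (Suc n) powr (- Re y - real m) \<le> real (Suc n) powr (- (1 + d))" using Re' by (intro powr_mono) auto
      show "0 \<le> C" unfolding C_def using d by (intro prod_nonneg) auto
    qed auto
    finally have "norm (g n) * norm (pdiff m y (real (Suc n))) \<le> B * (C * real (Suc n) powr (-(1 + d)))"
      using B B0 by (intro mult_mono) auto
    then show "norm (g n * pdiff m y (real (Suc n))) \<le> (B * C) * real (Suc n) powr (-(1 + d))"
      by (simp add: norm_mult mult_ac)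
  qed (use d in auto)
qed (use that in auto)

text \<open>The constant \<open>c\<close> is a free shift of the partial sums. It will be chosen so
  that the shifted sums are again admissible coefficients, which allows the summation by parts to be
  iterated.\<close>

lemma abel_summation:
  fixes f :: "nat \<Rightarrow> complex" and phi :: "nat \<Rightarrow> complex" and c :: complex
  defines "g \<equiv> \<lambda>n. (\<Sum>i\<le>n. f i) + c"
  shows "(\<Sum>n<N. f n * phi n) = (\<Sum>n<N. g n * (phi n - phi (Suc n))) - c * phi 0 + (g N - f N) * phi N"
proof (induction N)
  case 0
  then show ?case by (simp add: g_def)
next
  case (Suc N)
  have "g (Suc N) - f (Suc N) = g N" by (simp add: g_def)
  then show ?case unfolding sum.lessThan_Suc Suc.IH by (simp add: algebra_simps)
qed

section \<open>Periodic coefficients with sum zero over a period\<close>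

definition null_periodic :: "nat \<Rightarrow> (nat \<Rightarrow> complex) \<Rightarrow> bool" where
  "null_periodic q f \<longleftrightarrow> q > 0 \<and> (\<forall>n. f (n + q) = f n) \<and> (\<Sum>n<q. f n) = 0"

lemma periodic_mod:
  fixes f :: "nat \<Rightarrow> 'a"
  assumes "\<And>n. f (n + q) = f n"
  shows "f (n mod q) = f n"
proof -
  have "f (r + k * q) = f r" for r k
  proof (induction k)
    case (Suc k)
    then show ?case using assms[of "r + k * q"] by (simp add: algebra_simps)
  qed auto
  from this[of "n mod q" "n div q"] show ?thesis by (simp add: mult.commute)
qed

lemma periodic_bounded:
  fixes f :: "nat \<Rightarrow> complex"
  assumes "q > 0" "\<And>n. f (n + q) = f n"
  obtains B where "\<And>n. norm (f n) \<le> B"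
proof -
  have mod: "f (n mod q) = f n" for n by (rule periodic_mod) (rule assms(2))
  have "norm (f n) \<le> Max ((\<lambda>n. norm (f n)) ` {..<q})" for n
    using assms(1) mod[of n] by (intro Max_ge) (auto intro!: image_eqI[of _ _ "n mod q"])
  then show ?thesis using that by blast
qed

text \<open>The vanishing sum over a period makes the partial sums periodic; subtracting their mean
  restores the vanishing sum, so the property reproduces itself.\<close>

lemma null_periodic_sums:
  assumes "null_periodic q f"
  obtains c where "null_periodic q (\<lambda>n. (\<Sum>i\<le>n. f i) + c)"
proof -
  define S where "S = (\<lambda>n. \<Sum>i\<le>n. f i)"
  have q: "q > 0" and per: "\<And>n. f (n + q) = f n" and s0: "(\<Sum>n<q. f n) = 0"
    using assms by (auto simp: null_periodic_def)
  have S: "S (n + q) = S n" for n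
  proof (induction n)
    case 0
    have "S q = (\<Sum>i<q. f i) + f q" by (simp add: S_def lessThan_Suc_atMost[symmetric])
    then show ?case using s0 per[of 0] by (simp add: S_def)
  next
    case (Suc n)
    then show ?case using per[of "Suc n"] by (simp add: S_def)
  qed
  define c where "c = - (\<Sum>n<q. S n) / of_nat q"
  have "(\<Sum>n<q. S n + c) = 0" using q by (simp add: sum_subtractf c_def)
  then show ?thesis using that[of c] q S by (simp add: null_periodic_def S_def)
qed

lemma pdiff_tendsto_0:
  assumes "Re s > 0"
  shows "(\<lambda>n. pdiff m s (real (Suc n))) \<longlonglongrightarrow> 0"
proof (rule Lim_null_comparison)
  define C where "C = (\<Prod>i<m. norm (s + of_nat i))"
  show "\<forall>\<^sub>F n in sequentially. norm (pdiff m s (real (Suc n))) \<le> C * real (Suc n) powr (- Re s)"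
  proof (intro always_eventually allI)
    fix n
    have "norm (pdiff m s (real (Suc n))) \<le> C * real (Suc n) powr (- Re s - real m)"
      unfolding C_def using assms by (intro norm_pdiff_le) auto
    also have "\<dots> \<le> C * real (Suc n) powr (- Re s)"
      by (intro mult_left_mono powr_mono) (auto simp: C_def intro!: prod_nonneg)
    finally show "norm (pdiff m s (real (Suc n))) \<le> C * real (Suc n) powr (- Re s)" .
  qed
  have "(\<lambda>n. real n powr (- Re s)) \<longlonglongrightarrow> 0" using assms by (intro tendsto_neg_powr filterlim_real_sequentially) auto
  then have "(\<lambda>n. real (Suc n) powr (- Re s)) \<longlonglongrightarrow> 0" by (rule LIMSEQ_Suc)
  then show "(\<lambda>n. C * real (Suc n) powr (- Re s)) \<longlonglongrightarrow> 0" by (rule tendsto_mult_right_zero)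
qed

lemma null_periodic_bounded:
  assumes "null_periodic q f" shows "\<exists>B. \<forall>n. norm (f n) \<le> B"
proof -
  obtain B where "norm (f n) \<le> B" for n
    using periodic_bounded[of q f] assms unfolding null_periodic_def by metis
  then show ?thesis by blast
qed

lemma pdiff_sums_step:
  fixes f :: "nat \<Rightarrow> complex"
  assumes "\<And>n. norm (f n) \<le> B" "\<And>n. norm ((\<Sum>i\<le>n. f i) + c) \<le> B" "Re s > 0"
    and "(\<lambda>n. ((\<Sum>i\<le>n. f i) + c) * pdiff (Suc m) s (real (Suc n))) sums G"
  shows "(\<lambda>n. f n * pdiff m s (real (Suc n))) sums (G - c * pdiff m s 1)"
proof -
  define g where "g = (\<lambda>n. (\<Sum>i\<le>n. f i) + c)"
  have lim: "(\<lambda>N. (g N - f N) * pdiff m s (real (Suc N))) \<longlonglongrightarrow> 0"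
  proof (rule Lim_null_comparison)
    show "\<forall>\<^sub>F n in sequentially. norm ((g n - f n) * pdiff m s (real (Suc n))) \<le> (B + B) * norm (pdiff m s (real (Suc n)))"
    proof (intro always_eventually allI)
      fix n
      have "norm (g n - f n) \<le> B + B"
        using assms(1)[of n] assms(2)[of n] norm_triangle_ineq4[of "g n" "f n"] by (simp add: g_def)
      then show "norm ((g n - f n) * pdiff m s (real (Suc n))) \<le> (B + B) * norm (pdiff m s (real (Suc n)))"
        unfolding norm_mult by (intro mult_right_mono) auto
    qed
    show "(\<lambda>n. (B + B) * norm (pdiff m s (real (Suc n)))) \<longlonglongrightarrow> 0"
      using pdiff_tendsto_0[OF assms(3), of m] by (intro tendsto_mult_right_zero tendsto_norm_zero)
  qed
  have "(\<lambda>N. (\<Sum>n<N. g n * pdiff (Suc m) s (real (Suc n))) - c * pdiff m s 1 + (g N - f N) * pdiff m s (real (Suc N)))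
      \<longlonglongrightarrow> G - c * pdiff m s 1 + 0"
    using assms(4) lim unfolding sums_def g_def by (intro tendsto_intros)
  moreover have "(\<Sum>n<N. f n * pdiff m s (real (Suc n))) =
     (\<Sum>n<N. g n * pdiff (Suc m) s (real (Suc n))) - c * pdiff m s 1 + (g N - f N) * pdiff m s (real (Suc N))" for N
    using abel_summation[of f "\<lambda>n. pdiff m s (real (Suc n))" N c] by (simp add: g_def add.commute)
  ultimately show ?thesis unfolding sums_def by simp
qed

text \<open>\<open>A\<close> collects the boundary terms, multiples of \<open>pdiff m s 1\<close>,
  which are entire in \<open>s\<close>. Convergence of the transformed series is kept as a premise;
  it comes separately, from the powers saved in \<open>norm_pdiff_le\<close>.\<close>

lemma pdiff_iterate:
  assumes "null_periodic q f"
  shows "\<exists>A g. A holomorphic_on UNIV \<and> null_periodic q g \<and>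
    (\<forall>s G. Re s > 1 \<longrightarrow> (\<lambda>n. g n * pdiff m s (real (Suc n))) sums G \<longrightarrow>
       (\<lambda>n. f n * of_nat (Suc n) powr (-s)) sums (A s + G))"
proof (induction m)
  case 0
  show ?case using assms by (intro exI[of _ "\<lambda>_. 0"] exI[of _ f]) (auto simp del: of_nat_Suc)
next
  case (Suc m)
  then obtain A g where A: "A holomorphic_on UNIV" "null_periodic q g"
    "\<And>s G. Re s > 1 \<Longrightarrow> (\<lambda>n. g n * pdiff m s (real (Suc n))) sums G \<Longrightarrow>
       (\<lambda>n. f n * of_nat (Suc n) powr (-s)) sums (A s + G)" by blast
  obtain c where c: "null_periodic q (\<lambda>n. (\<Sum>i\<le>n. g i) + c)" using null_periodic_sums[OF A(2)] .
  obtain B1 where B1: "\<And>n. norm (g n) \<le> B1" using null_periodic_bounded[OF A(2)] by blast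
  obtain B2 where B2: "\<And>n. norm ((\<Sum>i\<le>n. g i) + c) \<le> B2" using null_periodic_bounded[OF c] by blast
  show ?case
  proof (intro exI conjI allI impI)
    show "(\<lambda>s. A s - c * pdiff m s 1) holomorphic_on UNIV" using A(1) by (intro holomorphic_intros pdiff_holomorphic) auto
    show "null_periodic q (\<lambda>n. (\<Sum>i\<le>n. g i) + c)" by (rule c)
    fix s G assume s: "Re s > 1" "(\<lambda>n. ((\<Sum>i\<le>n. g i) + c) * pdiff (Suc m) s (real (Suc n))) sums G"
    have "(\<lambda>n. g n * pdiff m s (real (Suc n))) sums (G - c * pdiff m s 1)"
      by (rule pdiff_sums_step[of _ "max B1 B2"]) (use s B1 B2 in \<open>auto simp: le_max_iff_disj\<close>)
    from A(3)[OF s(1) this] show "(\<lambda>n. f n * of_nat (Suc n) powr (-s)) sums (A s - c * pdiff m s 1 + G)"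
      by (simp add: algebra_simps)
  qed
qed

text \<open>Each summation by parts gains one power of \<open>n\<close>: after \<open>m\<close> of them the series converges for \<open>Re s > 1 - m\<close>.\<close>
theorem null_periodic_entire:
  assumes "null_periodic q f"
  obtains L where "L holomorphic_on UNIV" "\<And>s. Re s > 1 \<Longrightarrow> (\<lambda>n. f n * of_nat (Suc n) powr (-s)) sums L s"
proof -
  have "\<exists>H. H holomorphic_on {s. Re s > 1 - real m} \<and> (\<forall>s. Re s > 1 \<longrightarrow> (\<lambda>n. f n * of_nat (Suc n) powr (-s)) sums H s)" for m
  proof -
    obtain A g where A: "A holomorphic_on UNIV" "null_periodic q g"
      "\<And>s G. Re s > 1 \<Longrightarrow> (\<lambda>n. g n * pdiff m s (real (Suc n))) sums G \<Longrightarrow>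
         (\<lambda>n. f n * of_nat (Suc n) powr (-s)) sums (A s + G)" using pdiff_iterate[OF assms, of m] by blast
    obtain B where B: "\<And>n. norm (g n) \<le> B" using null_periodic_bounded[OF A(2)] by blast
    obtain G where G: "G holomorphic_on {s. Re s > 1 - real m}"
      "\<And>s. Re s > 1 - real m \<Longrightarrow> (\<lambda>n. g n * pdiff m s (real (Suc n))) sums G s"
      using pdiff_series[of g B m, OF B] by blast
    show ?thesis
      by (intro exI[of _ "\<lambda>s. A s + G s"] conjI holomorphic_intros G holomorphic_on_subset[OF A(1)] allI impI A(3)) auto
  qed
  then obtain H where H: "\<And>m. H m holomorphic_on {s. Re s > 1 - real m}"
    "\<And>m s. Re s > 1 \<Longrightarrow> (\<lambda>n. f n * of_nat (Suc n) powr (-s)) sums H m s" by metis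
  have eq: "H m s = H k s" if "Re s > 1 - real m" "m \<le> k" for m k s
  proof (rule analytic_continuation_open[of "{s. Re s > 1}" "{s. Re s > 1 - real m}" "H m" "H k"])
    show "connected {s. Re s > 1 - real m}" by (intro convex_connected convex_halfspace_Re_gt)
    show "H k holomorphic_on {s. Re s > 1 - real m}" by (rule holomorphic_on_subset[OF H(1)]) (use that in auto)
    have "2 \<in> {s. Re s > 1}" by simp
    then show "{s. Re s > 1} \<noteq> {}" by blast
    show "H m z = H k z" if "z \<in> {s. Re s > 1}" for z using H(2) that sums_unique2 by blast
  qed (use that H in \<open>auto intro: open_halfspace_Re_gt\<close>)
  \<comment> \<open>Selects for each \<open>s\<close> one half-plane containing it. By
    \<open>eq\<close> the choice is immaterial, and on every half-plane \<open>L\<close> coincides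
    with the holomorphic \<open>H m\<close>.\<close>
  define idx where "idx = (\<lambda>s. nat \<lceil>2 - Re s\<rceil>)"
  have idx: "Re s > 1 - real (idx s)" for s unfolding idx_def by linarith
  define L where "L = (\<lambda>s. H (idx s) s)"
  have L: "L s = H m s" if "Re s > 1 - real m" for m s
  proof (cases "m \<le> idx s")
    case True
    show ?thesis unfolding L_def using eq[OF that True] by (rule sym)
  next
    case False
    then have "idx s \<le> m" by simp
    show ?thesis unfolding L_def by (rule eq[OF idx \<open>idx s \<le> m\<close>])
  qed
  have "L holomorphic_on UNIV"
  proof (subst holomorphic_on_open, simp, safe)
    fix s :: complex
    define m where "m = idx s"
    have op: "open {s. Re s > 1 - real m}" by (rule open_halfspace_Re_gt)
    have "(H m has_field_derivative deriv (H m) s) (at s)"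
      using holomorphic_derivI[OF H(1) op] idx[of s] by (auto simp: m_def)
    then have "(L has_field_derivative deriv (H m) s) (at s)"
      by (rule has_field_derivative_transform_within_open[OF _ op]) (use L idx[of s] in \<open>auto simp: m_def\<close>)
    then show "\<exists>D. (L has_field_derivative D) (at s)" by blast
  qed
  moreover have "(\<lambda>n. f n * of_nat (Suc n) powr (-s)) sums L s" if "Re s > 1" for s
    using H(2)[OF that] by (simp add: L_def)
  ultimately show ?thesis using that by blast
qed

section \<open>Perron's formula\<close>

lemma contour_integral_rectpath:
  assumes "continuous_on (path_image (rectpath a c)) f"
  defines "b \<equiv> Complex (Re c) (Im a)" and "d \<equiv> Complex (Re a) (Im c)"
  shows "contour_integral (rectpath a c) f = contour_integral (linepath a b) f +
     contour_integral (linepath b c) f + contour_integral (linepath c d) f + contour_integral (linepath d a) f"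
proof -
  have img: "path_image (rectpath a c) = closed_segment a b \<union> closed_segment b c \<union> closed_segment c d \<union> closed_segment d a"
    by (simp add: rectpath_def Let_def path_image_join Un_assoc b_def d_def)
  have "f contour_integrable_on (linepath a b)" "f contour_integrable_on (linepath b c)"
    "f contour_integrable_on (linepath c d)" "f contour_integrable_on (linepath d a)"
    by (rule contour_integrable_continuous_linepath, rule continuous_on_subset[OF assms(1)], use img in blast)+
  then show ?thesis
    by (simp add: rectpath_def Let_def b_def[symmetric] d_def[symmetric] valid_path_join
        contour_integrable_join add.assoc)
qed

text \<open>Moving a vertical line costs the integral around the rectangle and the two horizontal
  edges. Only the edges are estimated here; the closed integral is evaluated at the point of use by
  Cauchy's formula or theorem.\<close>

lemma rectangle_right_edge_bound:
  fixes f :: "complex \<Rightarrow> complex"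
  assumes "a < b" "T > 0" and cont: "continuous_on (path_image (rectpath (Complex a (-T)) (Complex b T))) f"
    and hor: "\<And>s. \<bar>Im s\<bar> = T \<Longrightarrow> a \<le> Re s \<Longrightarrow> Re s \<le> b \<Longrightarrow> norm (f s) \<le> M"
  shows "norm (contour_integral (linepath (Complex b (-T)) (Complex b T)) f
       - contour_integral (linepath (Complex a (-T)) (Complex a T)) f
       - contour_integral (rectpath (Complex a (-T)) (Complex b T)) f) \<le> 2 * (b - a) * M"
proof -
  have img: "path_image (rectpath (Complex a (-T)) (Complex b T)) =
     closed_segment (Complex a (-T)) (Complex b (-T)) \<union> closed_segment (Complex b (-T)) (Complex b T)
     \<union> closed_segment (Complex b T) (Complex a T) \<union> closed_segment (Complex a T) (Complex a (-T))"
    by (simp add: rectpath_def Let_def path_image_join Un_assoc)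
  have M: "M \<ge> 0" using order_trans[OF norm_ge_zero hor[of "Complex a T"]] assms(1,2) by simp
  have int: "f contour_integrable_on (linepath (Complex a (-T)) (Complex b (-T)))"
    "f contour_integrable_on (linepath (Complex b T) (Complex a T))"
    by (rule contour_integrable_continuous_linepath, rule continuous_on_subset[OF cont], use img in blast)+
  have rev: "contour_integral (linepath (Complex a T) (Complex a (-T))) f =
      - contour_integral (linepath (Complex a (-T)) (Complex a T)) f"
    by (rule contour_integral_reverse_linepath, rule continuous_on_subset[OF cont], use img in blast)
  have "norm (contour_integral (linepath (Complex a (-T)) (Complex b (-T))) f) \<le> M * norm (Complex b (-T) - Complex a (-T))"
    using assms(1,2) by (intro contour_integral_bound_linepath int M hor)
      (auto simp: closed_segment_same_Im closed_segment_eq_real_ivl)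
  moreover have "norm (contour_integral (linepath (Complex b T) (Complex a T)) f) \<le> M * norm (Complex a T - Complex b T)"
    using assms(1,2) by (intro contour_integral_bound_linepath int M hor)
      (auto simp: closed_segment_same_Im closed_segment_eq_real_ivl)
  moreover have "Complex b (-T) - Complex a (-T) = of_real (b - a)" "Complex a T - Complex b T = of_real (a - b)"
    by (auto simp: complex_eq_iff)
  ultimately have
    "norm (contour_integral (linepath (Complex a (-T)) (Complex b (-T))) f) \<le> (b - a) * M"
    "norm (contour_integral (linepath (Complex b T) (Complex a T)) f) \<le> (b - a) * M"
    using assms(1) by (simp_all add: mult.commute abs_if del: of_real_diff)
  then have "norm (- contour_integral (linepath (Complex a (-T)) (Complex b (-T))) f
       - contour_integral (linepath (Complex b T) (Complex a T)) f) \<le> 2 * (b - a) * M"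
    using norm_triangle_ineq4[of "- contour_integral (linepath (Complex a (-T)) (Complex b (-T))) f"
        "contour_integral (linepath (Complex b T) (Complex a T)) f"] by (simp add: algebra_simps)
  moreover have "contour_integral (linepath (Complex b (-T)) (Complex b T)) f
       - contour_integral (linepath (Complex a (-T)) (Complex a T)) f
       - contour_integral (rectpath (Complex a (-T)) (Complex b T)) f =
       - contour_integral (linepath (Complex a (-T)) (Complex b (-T))) f
       - contour_integral (linepath (Complex b T) (Complex a T)) f"
    unfolding contour_integral_rectpath[OF cont] using rev by simp
  ultimately show ?thesis by (simp only:)
qed

lemma vertical_edge_bound:
  assumes "T > 0" "\<And>s. Re s = a \<Longrightarrow> \<bar>Im s\<bar> \<le> T \<Longrightarrow> norm (f s) \<le> M"
    "continuous_on {s. Re s = a \<and> \<bar>Im s\<bar> \<le> T} f"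
  shows "norm (contour_integral (linepath (Complex a (-T)) (Complex a T)) f) \<le> 2 * T * M"
proof -
  have seg: "closed_segment (Complex a (-T)) (Complex a T) = {s. Re s = a \<and> \<bar>Im s\<bar> \<le> T}"
    using assms(1) by (auto simp: closed_segment_same_Re closed_segment_eq_real_ivl)
  have M: "M \<ge> 0" using order_trans[OF norm_ge_zero assms(2)[of "Complex a 0"]] assms(1) by simp
  have "norm (contour_integral (linepath (Complex a (-T)) (Complex a T)) f) \<le> M * norm (Complex a T - Complex a (-T))"
    by (intro contour_integral_bound_linepath contour_integrable_continuous_linepath M)
       (use assms seg in auto)
  moreover have "Complex a T - Complex a (-T) = of_real (2 * T) * \<i>" by (auto simp: complex_eq_iff)
  then have "norm (Complex a T - Complex a (-T)) = 2 * T"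
    using assms(1) by (simp add: norm_mult del: of_real_mult)
  ultimately show ?thesis by (simp add: mult.commute)
qed

lemma integral_powr_bound:
  fixes T :: real assumes "T > 0"
  shows "(\<lambda>t. (1 + \<bar>t\<bar>) powr (-3/2)) integrable_on {-T..T}"
    and "integral {-T..T} (\<lambda>t. (1 + \<bar>t\<bar>) powr (-3/2)) \<le> 4"
proof -
  \<comment> \<open>An antiderivative glued at 0; its increment over the interval is 4 - 4 * (1 + T)
    powr (-1/2).\<close>
  define G where "G = (\<lambda>t::real. if t \<ge> 0 then 2 - 2 * (1 + t) powr (-1/2) else 2 * (1 - t) powr (-1/2) - 2)"
  have "((\<lambda>t. (1 + \<bar>t\<bar>) powr (-3/2)) has_integral (G T - G (-T))) {-T..T}"
  proof (rule fundamental_theorem_of_calculus_interior_strong[of "{0}"])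
    fix t assume t: "t \<in> {- T<..<T} - {0::real}"
    show "(G has_vector_derivative (1 + \<bar>t\<bar>) powr (-3/2)) (at t)"
    proof (cases "t > 0")
      case True
      have "((\<lambda>t. 2 - 2 * (1 + t) powr (-1/2)) has_real_derivative (1 + \<bar>t\<bar>) powr (-3/2)) (at t)"
        using True by (auto intro!: derivative_eq_intros simp: powr_diff[symmetric] divide_simps)
      then have "(G has_real_derivative (1 + \<bar>t\<bar>) powr (-3/2)) (at t)"
        by (rule has_field_derivative_transform_within_open[of _ _ _ "{0<..}"]) (use True in \<open>auto simp: G_def\<close>)
      then show ?thesis by (simp add: has_real_derivative_iff_has_vector_derivative)
    next
      case False
      then have f: "t < 0" using t by auto
      have "((\<lambda>t. 2 * (1 - t) powr (-1/2) - 2) has_real_derivative (1 + \<bar>t\<bar>) powr (-3/2)) (at t)"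
        using f by (auto intro!: derivative_eq_intros simp: powr_diff[symmetric] divide_simps)
      then have "(G has_real_derivative (1 + \<bar>t\<bar>) powr (-3/2)) (at t)"
        by (rule has_field_derivative_transform_within_open[of _ _ _ "{..<0}"]) (use f in \<open>auto simp: G_def\<close>)
      then show ?thesis by (simp add: has_real_derivative_iff_has_vector_derivative)
    qed
  next
    have "{-T..T} = {0..T} \<union> {-T..0}" using assms by auto
    moreover have "continuous_on ({0..T} \<union> {-T..0}) G"
      unfolding G_def
      by (rule continuous_on_cases[of "{0..T}" "{-T..0}"]) (auto intro!: continuous_intros)
    ultimately show "continuous_on {-T..T} G" by simp
  qed (use assms in auto)
  moreover have "G T - G (-T) \<le> 4" using assms by (simp add: G_def)
  ultimately show "(\<lambda>t. (1 + \<bar>t\<bar>) powr (-3/2)) integrable_on {-T..T}"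
    and "integral {-T..T} (\<lambda>t. (1 + \<bar>t\<bar>) powr (-3/2)) \<le> 4"
    by (auto simp: integral_unique)
qed

text \<open>The exponent -3/2 = 1/2 - 2 is what growth like sqrt (1 + |t|) leaves of the quadratic
  decay of the kernel. Being below -1, it makes the bound independent of \<open>T\<close>.\<close>

lemma vertical_edge_bound_decay:
  assumes "T > 0" "\<And>t. norm (f (Complex a t)) \<le> M * (1 + \<bar>t\<bar>) powr (-3/2)"
    "continuous_on {s. Re s = a} f"
  shows "norm (contour_integral (linepath (Complex a (-T)) (Complex a T)) f) \<le> 4 * M"
proof -
  have M: "M \<ge> 0" using order_trans[OF norm_ge_zero assms(2)[of 0]] by simp
  have c: "continuous_on {-T..T} (\<lambda>x. f (Complex a x))"
    by (rule continuous_on_compose2[OF assms(3)]) (auto intro!: continuous_intros simp: Complex_eq)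
  have "contour_integral (linepath (Complex a (-T)) (Complex a T)) f = \<i> * integral {-T..T} (\<lambda>x. f (Complex a x))"
    using assms(1) by (intro contour_integral_linepath_same_Re) auto
  then have "norm (contour_integral (linepath (Complex a (-T)) (Complex a T)) f) = norm (integral {-T..T} (\<lambda>x. f (Complex a x)))"
    by (simp add: norm_mult)
  also have "\<dots> \<le> integral {-T..T} (\<lambda>t. M * (1 + \<bar>t\<bar>) powr (-3/2))"
    by (intro integral_norm_bound_integral integrable_continuous_real c assms(2)
         integrable_on_mult_right integral_powr_bound(1)[OF assms(1)])
  also have "\<dots> = M * integral {-T..T} (\<lambda>t. (1 + \<bar>t\<bar>) powr (-3/2))" by simp
  also have "\<dots> \<le> M * 4" by (intro mult_left_mono integral_powr_bound(2) assms M)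
  finally show ?thesis by simp
qed


section \<open>The truncated Perron integral of the kernel\<close>

lemma powr_over_poly_holomorphic:
  assumes "y > (0::real)"
  shows "(\<lambda>s. of_real y powr s / (s * (s + 1))) holomorphic_on (- {0, -1})"
  using assms by (auto intro!: holomorphic_intros simp: add_eq_0_iff2)

lemma norm_mult_Suc_ge:
  assumes "\<bar>Im s\<bar> \<ge> T" "T > 0"
  shows "norm (s * (s + 1)) \<ge> T ^ 2"
proof -
  have "T \<le> norm s" using assms abs_Im_le_cmod[of s] by linarith
  moreover have "T \<le> norm (s + 1)" using assms abs_Im_le_cmod[of "s + 1"] by simp
  ultimately show ?thesis using assms by (simp add: norm_mult power2_eq_square mult_mono)
qed

text \<open>For y \<ge> 1 the factor y powr s does not grow to the left, so the line moves to Re s =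
  -T. The poles 0 and -1 are crossed, and their residues 1 and -1/y make up the weight of the Riesz
  mean. The factor y ^ 2 in the error becomes x ^ 2 / n ^ 2 in the application, which is summable
  against the coefficients.\<close>

lemma perron_kernel_ge_1:
  fixes y T :: real
  assumes y: "y \<ge> 1" and T: "T \<ge> 2"
  shows "norm (contour_integral (linepath (Complex 2 (-T)) (Complex 2 T)) (\<lambda>s. of_real y powr s / (s * (s + 1)))
     - 2 * pi * \<i> * (1 - 1 / y)) \<le> 8 * y ^ 2 / T"
proof -
  define f where "f = (\<lambda>s::complex. of_real y powr s / (s * (s + 1)))"
  define R where "R = rectpath (Complex (-T) (-T)) (Complex 2 T)"
  have img: "path_image R \<subseteq> - {0, -1}"
    using T unfolding R_def by (subst path_image_rectpath) auto
  have cont: "continuous_on (- {0, -1}) f"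
    unfolding f_def using y by (intro holomorphic_on_imp_continuous_on powr_over_poly_holomorphic) auto
  have nf: "norm (f s) \<le> y ^ 2 / D" if "Re s \<le> 2" "norm (s * (s + 1)) \<ge> D" "D > 0" for s D
  proof -
    have "norm (of_real y powr s :: complex) = y powr Re s" using y by (simp add: norm_powr_real_powr)
    also have "\<dots> \<le> y powr 2" using y that by (intro powr_mono) auto
    also have "\<dots> = y ^ 2" using y by simp
    finally show ?thesis using that(2,3) unfolding f_def norm_divide by (intro frac_le) auto
  qed
  have wn: "winding_number R 0 = 1" "winding_number R (-1) = 1"
    unfolding R_def using T by (auto intro!: winding_number_rectpath simp: in_box_complex_iff)
  have hol: "(\<lambda>s::complex. of_real y powr s) holomorphic_on UNIV" using y by (auto intro!: holomorphic_intros)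
  \<comment> \<open>Partial fractions: 1 / (s (s + 1)) = 1 / s - 1 / (s + 1), with Cauchy's formula
    for each summand.\<close>
  have "((\<lambda>s. of_real y powr s / (s - 0)) has_contour_integral (2 * pi * \<i> * winding_number R 0 * (of_real y powr 0))) R"
    by (rule Cauchy_integral_formula_convex_simple[OF _ hol]) (use img in \<open>auto simp: R_def\<close>)
  moreover have "((\<lambda>s. of_real y powr s / (s - (-1))) has_contour_integral (2 * pi * \<i> * winding_number R (-1) * (of_real y powr (-1)))) R"
    by (rule Cauchy_integral_formula_convex_simple[OF _ hol]) (use img in \<open>auto simp: R_def\<close>)
  ultimately have "((\<lambda>s. of_real y powr s / (s - 0) - of_real y powr s / (s - (-1))) has_contour_integral
      (2 * pi * \<i> * winding_number R 0 * (of_real y powr 0) - 2 * pi * \<i> * winding_number R (-1) * (of_real y powr (-1)))) R"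
    by (rule has_contour_integral_diff)
  moreover have "(2 * pi * \<i> * winding_number R 0 * (of_real y powr 0) - 2 * pi * \<i> * winding_number R (-1) * (of_real y powr (-1)))
      = 2 * pi * \<i> * (1 - 1 / y)"
    using y by (simp add: wn powr_minus field_simps)
  ultimately have "((\<lambda>s. of_real y powr s / (s - 0) - of_real y powr s / (s - (-1))) has_contour_integral
      (2 * pi * \<i> * (1 - 1 / y))) R" by (simp only:)
  then have "(f has_contour_integral (2 * pi * \<i> * (1 - 1 / y))) R"
  proof (rule has_contour_integral_eq)
    fix s assume "s \<in> path_image R"
    then have "s \<noteq> 0" "s + 1 \<noteq> 0" using img by (auto simp: add_eq_0_iff2)
    then show "of_real y powr s / (s - 0) - of_real y powr s / (s - (-1)) = f s"
      by (simp add: f_def divide_simps) (simp add: algebra_simps)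
  qed
  then have int: "contour_integral R f = 2 * pi * \<i> * (1 - 1 / y)" by (rule contour_integral_unique)
  have "norm (contour_integral (linepath (Complex 2 (-T)) (Complex 2 T)) f
       - contour_integral (linepath (Complex (-T) (-T)) (Complex (-T) T)) f - contour_integral R f)
      \<le> 2 * (2 - (-T)) * (y ^ 2 / T ^ 2)"
    unfolding R_def
    by (rule rectangle_right_edge_bound)
       (use T img in \<open>auto simp: R_def intro!: continuous_on_subset[OF cont] nf norm_mult_Suc_ge\<close>)
  also have "\<dots> \<le> 4 * y ^ 2 / T"
  proof -
    have "2 * (2 - (-T)) \<le> 4 * T" using T by simp
    then have "2 * (2 - (-T)) * (y ^ 2 / T ^ 2) \<le> 4 * T * (y ^ 2 / T ^ 2)" by (intro mult_right_mono) auto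
    then show ?thesis using T by (simp add: power2_eq_square)
  qed
  finally have 1: "norm (contour_integral (linepath (Complex 2 (-T)) (Complex 2 T)) f
       - contour_integral (linepath (Complex (-T) (-T)) (Complex (-T) T)) f - contour_integral R f) \<le> 4 * y ^ 2 / T" .
  have "norm (contour_integral (linepath (Complex (-T) (-T)) (Complex (-T) T)) f) \<le> 2 * T * (y ^ 2 / (T ^ 2 / 2))"
  proof (rule vertical_edge_bound)
    fix s assume s: "Re s = - T" "\<bar>Im s\<bar> \<le> T"
    have "T \<le> norm s" using s abs_Re_le_cmod[of s] T by linarith
    moreover have "T - 1 \<le> norm (s + 1)" using s abs_Re_le_cmod[of "s + 1"] T by simp
    ultimately have "T * (T - 1) \<le> norm (s * (s + 1))" using T unfolding norm_mult by (intro mult_mono) auto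
    moreover have "2 * T \<le> T * T" using T by (intro mult_right_mono) auto
    then have "T ^ 2 / 2 \<le> T * (T - 1)" unfolding power2_eq_square right_diff_distrib by linarith
    ultimately show "norm (f s) \<le> y ^ 2 / (T ^ 2 / 2)" using T s by (intro nf) auto
  next
    show "continuous_on {s. Re s = - T \<and> \<bar>Im s\<bar> \<le> T} f"
      by (rule continuous_on_subset[OF cont]) (use T in auto)
  qed (use T in auto)
  also have "\<dots> = 4 * y ^ 2 / T" using T by (simp add: power2_eq_square)
  finally have 2: "norm (contour_integral (linepath (Complex (-T) (-T)) (Complex (-T) T)) f) \<le> 4 * y ^ 2 / T" .
  have "contour_integral (linepath (Complex 2 (-T)) (Complex 2 T)) f - 2 * pi * \<i> * (1 - 1 / y)
      = (contour_integral (linepath (Complex 2 (-T)) (Complex 2 T)) f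
       - contour_integral (linepath (Complex (-T) (-T)) (Complex (-T) T)) f - contour_integral R f)
       + contour_integral (linepath (Complex (-T) (-T)) (Complex (-T) T)) f"
    by (simp add: int)
  then have "norm (contour_integral (linepath (Complex 2 (-T)) (Complex 2 T)) f - 2 * pi * \<i> * (1 - 1 / y))
      \<le> 4 * y ^ 2 / T + 4 * y ^ 2 / T"
    using norm_triangle_mono[OF 1 2] by (simp only:)
  then show ?thesis by (simp add: f_def)
qed

text \<open>For y \<le> 1 the line moves to the right instead, to Re s = 2 + T: no pole is met, and
  y powr s only shrinks.\<close>

lemma perron_kernel_le_1:
  fixes y T :: real
  assumes y: "y > 0" "y \<le> 1" and T: "T \<ge> 2"
  shows "norm (contour_integral (linepath (Complex 2 (-T)) (Complex 2 T)) (\<lambda>s. of_real y powr s / (s * (s + 1)))) \<le> 8 * y ^ 2 / T"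
proof -
  define f where "f = (\<lambda>s::complex. of_real y powr s / (s * (s + 1)))"
  define R where "R = rectpath (Complex 2 (-T)) (Complex (2 + T) T)"
  have img: "path_image R \<subseteq> {s. Re s > 0}"
    using T unfolding R_def by (subst path_image_rectpath) auto
  have hol: "f holomorphic_on {s. Re s > 0}"
    unfolding f_def by (rule holomorphic_on_subset[OF powr_over_poly_holomorphic]) (use y in auto)
  note cont = holomorphic_on_imp_continuous_on[OF hol]
  have nf: "norm (f s) \<le> y ^ 2 / T ^ 2" if "Re s \<ge> 2" "norm (s * (s + 1)) \<ge> T ^ 2" for s
  proof -
    have "norm (of_real y powr s :: complex) = y powr Re s" using y by (simp add: norm_powr_real_powr)
    also have "\<dots> \<le> y powr 2" using y that by (intro powr_mono') auto
    also have "\<dots> = y ^ 2" using y by simp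
    finally show ?thesis using that(2) T unfolding f_def norm_divide by (intro frac_le) auto
  qed
  have "(f has_contour_integral 0) R"
    by (rule Cauchy_theorem_convex_simple[OF hol]) (use img in \<open>auto simp: R_def convex_halfspace_Re_gt\<close>)
  then have int: "contour_integral R f = 0" by (rule contour_integral_unique)
  have "norm (contour_integral (linepath (Complex (2 + T) (-T)) (Complex (2 + T) T)) f
       - contour_integral (linepath (Complex 2 (-T)) (Complex 2 T)) f - contour_integral R f)
      \<le> 2 * (2 + T - 2) * (y ^ 2 / T ^ 2)"
    unfolding R_def
    by (rule rectangle_right_edge_bound)
       (use T img nf norm_mult_Suc_ge[of T] in \<open>auto simp: R_def intro!: continuous_on_subset[OF cont]\<close>)
  also have "\<dots> = 2 * y ^ 2 / T" using T by (simp add: power2_eq_square)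
  finally have 1: "norm (contour_integral (linepath (Complex (2 + T) (-T)) (Complex (2 + T) T)) f
       - contour_integral (linepath (Complex 2 (-T)) (Complex 2 T)) f) \<le> 2 * y ^ 2 / T" by (simp add: int)
  have "norm (contour_integral (linepath (Complex (2 + T) (-T)) (Complex (2 + T) T)) f) \<le> 2 * T * (y ^ 2 / T ^ 2)"
  proof (rule vertical_edge_bound)
    fix s assume s: "Re s = 2 + T" "\<bar>Im s\<bar> \<le> T"
    have "T \<le> norm s" using s abs_Re_le_cmod[of s] T by linarith
    moreover have "T \<le> norm (s + 1)" using s abs_Re_le_cmod[of "s + 1"] T by simp
    ultimately have "T * T \<le> norm (s * (s + 1))" using T unfolding norm_mult by (intro mult_mono) auto
    then show "norm (f s) \<le> y ^ 2 / T ^ 2" using T s by (intro nf) (auto simp: power2_eq_square)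
  next
    show "continuous_on {s. Re s = 2 + T \<and> \<bar>Im s\<bar> \<le> T} f"
      by (rule continuous_on_subset[OF cont]) (use T in auto)
  qed (use T in auto)
  also have "\<dots> = 2 * y ^ 2 / T" using T by (simp add: power2_eq_square)
  finally have 2: "norm (contour_integral (linepath (Complex (2 + T) (-T)) (Complex (2 + T) T)) f) \<le> 2 * y ^ 2 / T" .
  have "norm (contour_integral (linepath (Complex 2 (-T)) (Complex 2 T)) f) \<le> 2 * y ^ 2 / T + 2 * y ^ 2 / T"
    using 1 2 norm_triangle_ineq4[of "contour_integral (linepath (Complex (2 + T) (-T)) (Complex (2 + T) T)) f"
      "contour_integral (linepath (Complex (2 + T) (-T)) (Complex (2 + T) T)) f
       - contour_integral (linepath (Complex 2 (-T)) (Complex 2 T)) f"] by simp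
  also have "\<dots> \<le> 8 * y ^ 2 / T" using T by (simp add: divide_right_mono)
  finally show ?thesis by (simp add: f_def)
qed

lemma perron_kernel:
  fixes y T :: real
  assumes "y > 0" "T \<ge> 2"
  shows "norm (contour_integral (linepath (Complex 2 (-T)) (Complex 2 T)) (\<lambda>s. of_real y powr s / (s * (s + 1)))
     - 2 * pi * \<i> * of_real (max 0 (1 - 1 / y))) \<le> 8 * y ^ 2 / T"
proof (cases "y \<ge> 1")
  case True
  then have "max 0 (1 - 1 / y) = 1 - 1 / y" by auto
  then show ?thesis using perron_kernel_ge_1[OF True assms(2)] by simp
next
  case False
  then have "max 0 (1 - 1 / y) = 0" using assms(1) by (auto simp: max_def)
  then show ?thesis using perron_kernel_le_1[of y T] False assms by simp
qed


lemma kernel_decay: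
  assumes "Re s \<ge> 1/2"
  shows "norm (s * (s + 1)) \<ge> (1 + \<bar>Im s\<bar>) ^ 2 / 6"
proof -
  have "norm s \<ge> 1/2" "norm s \<ge> \<bar>Im s\<bar>" using assms abs_Re_le_cmod[of s] abs_Im_le_cmod[of s] by auto
  then have 1: "norm s \<ge> (1 + \<bar>Im s\<bar>) / 3" by (simp add: field_simps)
  have "norm (s + 1) \<ge> 1" "norm (s + 1) \<ge> \<bar>Im s\<bar>"
    using assms abs_Re_le_cmod[of "s + 1"] abs_Im_le_cmod[of "s + 1"] by auto
  then have 2: "norm (s + 1) \<ge> (1 + \<bar>Im s\<bar>) / 2" by (simp add: field_simps)
  have "(1 + \<bar>Im s\<bar>) / 3 * ((1 + \<bar>Im s\<bar>) / 2) \<le> norm s * norm (s + 1)"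
    using 1 2 by (intro mult_mono) auto
  then show ?thesis by (simp add: norm_mult power2_eq_square)
qed

text \<open>Perron's formula with the kernel \<open>x ^ s / (s (s + 1))\<close>, the line of integration being moved
  from \<open>Re s = 2\<close> to \<open>Re s = c\<close>.\<close>
theorem riesz_mean_bound:
  fixes a :: "nat \<Rightarrow> complex" and F :: "complex \<Rightarrow> complex" and x c B :: real
  assumes hol: "F holomorphic_on {s. Re s > 1/2}"
    and sums: "\<And>s. Re s = 2 \<Longrightarrow> (\<lambda>n. a (Suc n) / of_nat (Suc n) powr s) sums F s"
    and summ: "summable (\<lambda>n. norm (a (Suc n)) / real (Suc n) ^ 2)"
    and c: "1/2 < c" "c < 2" and B: "B \<ge> 0"
    and bound: "\<And>s. c \<le> Re s \<Longrightarrow> Re s \<le> 2 \<Longrightarrow> norm (F s) \<le> B * sqrt (1 + \<bar>Im s\<bar>)"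
    and x: "x \<ge> 1"
  shows "norm (\<Sum>n | 0 < n \<and> real n \<le> x. a n * of_real (1 - real n / x)) \<le> 4 * B * x powr c"
proof -
  define S where "S = (\<Sum>n | 0 < n \<and> real n \<le> x. a n * of_real (1 - real n / x))"
  define A where "A = (\<Sum>n. norm (a (Suc n)) / real (Suc n) ^ 2)"
  define K where "K = (\<lambda>s::complex. of_real x powr s / (s * (s + 1)))"
  define P where "P = (\<lambda>N s. \<Sum>n<N. a (Suc n) / of_nat (Suc n) powr s)"
  \<comment> \<open>Tail of the absolutely convergent series on Re s = 2. It bounds, uniformly on
    that line, the error of replacing \<open>F\<close> by a partial sum, which justifies integrating
    term by term.\<close>
  define R where "R = (\<lambda>N. \<Sum>n. norm (a (Suc (n + N))) / real (Suc (n + N)) ^ 2)"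
  have R0: "R \<longlonglongrightarrow> 0"
    using suminf_exist_split2[OF summ] unfolding R_def by simp
  have holK: "K holomorphic_on {s. Re s > 0}"
    unfolding K_def by (rule holomorphic_on_subset[OF powr_over_poly_holomorphic]) (use x in auto)
  have nK: "norm (K s) \<le> x powr Re s * 6 / (1 + \<bar>Im s\<bar>) ^ 2" if "Re s \<ge> 1/2" for s
  proof -
    have "norm (K s) = x powr Re s / norm (s * (s + 1))"
      using x by (simp add: K_def norm_divide norm_powr_real_powr)
    also have "\<dots> \<le> x powr Re s / ((1 + \<bar>Im s\<bar>) ^ 2 / 6)"
      using kernel_decay[OF that] by (intro divide_left_mono mult_pos_pos) (auto intro: less_le_trans[rotated])
    finally show ?thesis by simp
  qed
  \<comment> \<open>\<open>T\<close> is fixed inside: the number of terms tends to infinity first,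
    and the two contributions that depend on \<open>T\<close> vanish only afterwards.\<close>
  have main: "2 * pi * norm S \<le> 24 * B * x powr c + 8 * x ^ 2 * A / T + 2 * (2 - c) * (6 * B * x ^ 2 * sqrt (1 + T) / T ^ 2)"
    if T: "T \<ge> 2" for T
  proof -
    define \<gamma> where "\<gamma> = linepath (Complex 2 (-T)) (Complex 2 T)"
    have seg: "closed_segment (Complex 2 (-T)) (Complex 2 T) = {s. Re s = 2 \<and> \<bar>Im s\<bar> \<le> T}"
      using T by (auto simp: closed_segment_same_Re closed_segment_eq_real_ivl)
    have cK: "continuous_on {s. Re s > 1/2} K"
      by (rule holomorphic_on_imp_continuous_on[OF holomorphic_on_subset[OF holK]]) auto
    have cF: "continuous_on {s. Re s > 1/2} F" by (rule holomorphic_on_imp_continuous_on[OF hol])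
    have cP: "continuous_on UNIV (P N)" for N unfolding P_def
      by (intro holomorphic_on_imp_continuous_on holomorphic_intros) auto
    have sub: "closed_segment (Complex 2 (-T)) (Complex 2 T) \<subseteq> {s. Re s > 1/2}" using seg by auto
    note cKs = continuous_on_subset[OF cK sub]
    note cFs = continuous_on_subset[OF cF sub]
    have iFK: "(\<lambda>s. F s * K s) contour_integrable_on \<gamma>" unfolding \<gamma>_def
      by (intro contour_integrable_continuous_linepath continuous_intros cKs cFs)
    have iPK: "(\<lambda>s. P N s * K s) contour_integrable_on \<gamma>" for N unfolding \<gamma>_def
      by (intro contour_integrable_continuous_linepath continuous_intros cKs continuous_on_subset[OF cP]) auto
    define J where "J = (\<lambda>n. contour_integral \<gamma> (\<lambda>s. of_real (x / real (Suc n)) powr s / (s * (s + 1))))"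
    have intP: "contour_integral \<gamma> (\<lambda>s. P N s * K s) = (\<Sum>n<N. a (Suc n) * J n)" for N
    proof -
      have eq: "P N s * K s = (\<Sum>n<N. a (Suc n) * (of_real (x / real (Suc n)) powr s / (s * (s + 1))))" for s
      proof -
        have "of_real (x / real (Suc n)) powr s = of_real x powr s / (of_nat (Suc n) powr s :: complex)" for n
        proof -
          have "ln (x / real (Suc n)) = ln x - ln (real (Suc n))" using x by (intro ln_divide_pos) auto
          moreover have "Ln (of_real (x / real (Suc n))) = of_real (ln (x / real (Suc n)))"
            "Ln (of_nat (Suc n) :: complex) = of_real (ln (real (Suc n)))" "Ln (of_real x) = of_real (ln x)"
            using x Ln_of_real[of "x / real (Suc n)"] Ln_of_real[of "real (Suc n)"] Ln_of_real[of x] by simp_all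
          ultimately show ?thesis using x
            by (simp add: powr_def exp_diff[symmetric] right_diff_distrib del: of_nat_Suc)
        qed
        then show ?thesis unfolding P_def K_def sum_distrib_right by (intro sum.cong) auto
      qed
      have int: "(\<lambda>s. of_real (x / real (Suc n)) powr s / (s * (s + 1))) contour_integrable_on \<gamma>" for n
        unfolding \<gamma>_def
        by (intro contour_integrable_continuous_linepath
             continuous_on_subset[OF holomorphic_on_imp_continuous_on[OF powr_over_poly_holomorphic]])
           (use x sub in auto)
      have "contour_integral \<gamma> (\<lambda>s. \<Sum>n<N. a (Suc n) * (of_real (x / real (Suc n)) powr s / (s * (s + 1))))
          = (\<Sum>n<N. contour_integral \<gamma> (\<lambda>s. a (Suc n) * (of_real (x / real (Suc n)) powr s / (s * (s + 1)))))"
        by (rule contour_integral_sum) (intro finite_lessThan contour_integrable_lmul int)+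
      also have "\<dots> = (\<Sum>n<N. a (Suc n) * J n)"
        unfolding J_def by (intro sum.cong refl contour_integral_lmul int)
      finally have "contour_integral \<gamma> (\<lambda>s. \<Sum>n<N. a (Suc n) * (of_real (x / real (Suc n)) powr s / (s * (s + 1))))
          = (\<Sum>n<N. a (Suc n) * J n)" .
      then show ?thesis by (simp only: eq)
    qed
    have S_eq: "S = (\<Sum>n<N. a (Suc n) * of_real (max 0 (1 - 1 / (x / real (Suc n)))))" if N: "real N \<ge> x" for N
    proof -
      have "(\<Sum>n<N. a (Suc n) * of_real (max 0 (1 - 1 / (x / real (Suc n))))) =
            (\<Sum>n\<in>Suc ` {..<N}. a n * of_real (max 0 (1 - real n / x)))"
        by (subst sum.reindex) auto
      also have "\<dots> = (\<Sum>n | 0 < n \<and> real n \<le> x. a n * of_real (max 0 (1 - real n / x)))"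
      proof (rule sum.mono_neutral_right)
        show "{n. 0 < n \<and> real n \<le> x} \<subseteq> Suc ` {..<N}"
        proof
          fix n assume "n \<in> {n. 0 < n \<and> real n \<le> x}"
          then have "n = Suc (n - 1)" "n - 1 < N" using N by auto
          then show "n \<in> Suc ` {..<N}" by blast
        qed
        show "\<forall>i\<in>Suc ` {..<N} - {n. 0 < n \<and> real n \<le> x}. a i * of_real (max 0 (1 - real i / x)) = 0"
          using x by (auto simp: max_def field_simps)
      qed auto
      also have "\<dots> = S" unfolding S_def using x by (intro sum.cong) (auto simp: max_def field_simps)
      finally show ?thesis by simp
    qed
    have bnd: "norm (contour_integral \<gamma> (\<lambda>s. F s * K s) - 2 * pi * \<i> * S) \<le> 8 * x ^ 2 * A / T + R N * (6 * x ^ 2) * (2 * T)"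
      if N: "real N \<ge> x" for N
    proof -
      have tail: "norm (F s - P N s) \<le> R N" if "Re s = 2" for s
      proof -
        have "(\<lambda>n. a (Suc (n + N)) / of_nat (Suc (n + N)) powr s) sums (F s - P N s)"
          using sums_split_initial_segment[OF sums[OF that], of N] by (simp add: P_def)
        moreover have eq: "norm (a (Suc (n + N)) / of_nat (Suc (n + N)) powr s) = norm (a (Suc (n + N))) / real (Suc (n + N)) ^ 2" for n
          using that norm_powr_real_powr[of "of_nat (Suc (n + N))" s]
          by (simp add: norm_divide del: of_nat_Suc)
        moreover have "summable (\<lambda>n. norm (a (Suc (n + N))) / real (Suc (n + N)) ^ 2)"
          using summable_ignore_initial_segment[OF summ, of N] by simp
        ultimately show ?thesis
          using summable_norm[of "\<lambda>n. a (Suc (n + N)) / of_nat (Suc (n + N)) powr s"]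
          by (simp add: sums_iff R_def)
      qed
      have "norm (contour_integral \<gamma> (\<lambda>s. (F s - P N s) * K s)) \<le> 2 * T * (R N * (6 * x ^ 2))"
        unfolding \<gamma>_def
      proof (rule vertical_edge_bound)
        fix s assume s: "Re s = 2" "\<bar>Im s\<bar> \<le> T"
        have "norm (K s) \<le> x powr Re s * 6 / (1 + \<bar>Im s\<bar>) ^ 2" using s by (intro nK) auto
        also have "\<dots> \<le> x powr Re s * 6 / 1" by (intro divide_left_mono) auto
        also have "\<dots> = 6 * x ^ 2" using s x by simp
        finally show "norm ((F s - P N s) * K s) \<le> R N * (6 * x ^ 2)"
          using tail[OF s(1)] unfolding norm_mult by (intro mult_mono) (auto intro: order_trans[OF norm_ge_zero])
      next
        show "continuous_on {s. Re s = 2 \<and> \<bar>Im s\<bar> \<le> T} (\<lambda>s. (F s - P N s) * K s)"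
          by (intro continuous_intros continuous_on_subset[OF cF] continuous_on_subset[OF cK] continuous_on_subset[OF cP]) auto
      qed (use T in auto)
      then have 1: "norm (contour_integral \<gamma> (\<lambda>s. F s * K s) - (\<Sum>n<N. a (Suc n) * J n)) \<le> R N * (6 * x ^ 2) * (2 * T)"
        unfolding left_diff_distrib contour_integral_diff[OF iFK iPK[of N]] intP[of N] by (simp add: mult_ac)
      have "(\<Sum>n<N. a (Suc n) * J n) - 2 * pi * \<i> * S =
         (\<Sum>n<N. a (Suc n) * (J n - 2 * pi * \<i> * of_real (max 0 (1 - 1 / (x / real (Suc n))))))"
        unfolding S_eq[OF N] sum_distrib_left sum_subtractf[symmetric]
        by (intro sum.cong refl) (simp add: algebra_simps)
      also have "norm \<dots> \<le> (\<Sum>n<N. norm (a (Suc n)) / real (Suc n) ^ 2 * (8 * x ^ 2 / T))"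
      proof (rule sum_norm_le)
        fix n
        have "norm (J n - 2 * pi * \<i> * of_real (max 0 (1 - 1 / (x / real (Suc n))))) \<le> 8 * (x / real (Suc n)) ^ 2 / T"
          unfolding J_def \<gamma>_def using x T by (intro perron_kernel) auto
        then have "norm (a (Suc n)) * norm (J n - 2 * pi * \<i> * of_real (max 0 (1 - 1 / (x / real (Suc n))))) \<le>
            norm (a (Suc n)) * (8 * (x / real (Suc n)) ^ 2 / T)" by (intro mult_left_mono) auto
        then show "norm (a (Suc n) * (J n - 2 * pi * \<i> * of_real (max 0 (1 - 1 / (x / real (Suc n)))))) \<le>
          norm (a (Suc n)) / real (Suc n) ^ 2 * (8 * x ^ 2 / T)"
          unfolding norm_mult by (simp add: power_divide mult_ac del: of_nat_Suc)
      qed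
      also have "\<dots> = (\<Sum>n<N. norm (a (Suc n)) / real (Suc n) ^ 2) * (8 * x ^ 2 / T)" by (simp only: sum_distrib_right)
      also have "\<dots> \<le> A * (8 * x ^ 2 / T)"
        unfolding A_def using T by (intro mult_right_mono sum_le_suminf summ) auto
      finally have 2: "norm ((\<Sum>n<N. a (Suc n) * J n) - 2 * pi * \<i> * S) \<le> 8 * x ^ 2 * A / T" by (simp add: mult_ac)
      show ?thesis using norm_triangle_mono[OF 1 2] by simp
    qed
    have "(\<lambda>N. 8 * x ^ 2 * A / T + R N * (6 * x ^ 2) * (2 * T)) \<longlonglongrightarrow> 8 * x ^ 2 * A / T + 0 * (6 * x ^ 2) * (2 * T)"
      by (intro tendsto_intros R0)
    then have "norm (contour_integral \<gamma> (\<lambda>s. F s * K s) - 2 * pi * \<i> * S) \<le> 8 * x ^ 2 * A / T + 0 * (6 * x ^ 2) * (2 * T)"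
    proof (rule tendsto_lowerbound)
      show "\<forall>\<^sub>F N in sequentially. norm (contour_integral \<gamma> (\<lambda>s. F s * K s) - 2 * pi * \<i> * S)
            \<le> 8 * x ^ 2 * A / T + R N * (6 * x ^ 2) * (2 * T)"
        using eventually_ge_at_top[of "nat \<lceil>x\<rceil>"] by eventually_elim (rule bnd, linarith)
    qed auto
    then have B1: "norm (2 * pi * \<i> * S - contour_integral \<gamma> (\<lambda>s. F s * K s)) \<le> 8 * x ^ 2 * A / T" 
      by (simp add: norm_minus_commute)
    \<comment> \<open>The rectangle between Re s = c and Re s = 2 contains no singularity:
      \<open>F\<close> is holomorphic for Re s > 1/2, and the poles of the kernel lie further to the
      left.\<close>
    define Q where "Q = rectpath (Complex c (-T)) (Complex 2 T)"
    have img: "path_image Q \<subseteq> {s. Re s > 1/2}"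
      using T c unfolding Q_def by (subst path_image_rectpath) auto
    have holFK: "(\<lambda>s. F s * K s) holomorphic_on {s. Re s > 1/2}"
      by (intro holomorphic_intros hol holomorphic_on_subset[OF holK]) auto
    note cFK = holomorphic_on_imp_continuous_on[OF holFK]
    have "((\<lambda>s. F s * K s) has_contour_integral 0) Q"
      by (rule Cauchy_theorem_convex_simple[OF holFK convex_halfspace_Re_gt]) (use img in \<open>auto simp: Q_def convex_halfspace_Re_gt\<close>)
    then have int0: "contour_integral Q (\<lambda>s. F s * K s) = 0" by (rule contour_integral_unique)
    have "norm (contour_integral \<gamma> (\<lambda>s. F s * K s)
       - contour_integral (linepath (Complex c (-T)) (Complex c T)) (\<lambda>s. F s * K s) - contour_integral Q (\<lambda>s. F s * K s))
      \<le> 2 * (2 - c) * (6 * B * x ^ 2 * sqrt (1 + T) / T ^ 2)"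
      unfolding Q_def \<gamma>_def
    proof (rule rectangle_right_edge_bound)
      fix s assume s: "\<bar>Im s\<bar> = T" "c \<le> Re s" "Re s \<le> 2"
      have "norm (K s) \<le> x powr Re s * 6 / (1 + \<bar>Im s\<bar>) ^ 2" using s c by (intro nK) auto
      also have "\<dots> \<le> x powr 2 * 6 / T ^ 2"
        using s x T by (intro frac_le mult_right_mono powr_mono power_mono) auto
      also have "\<dots> = 6 * x ^ 2 / T ^ 2" using x by simp
      finally have "norm (F s) * norm (K s) \<le> (B * sqrt (1 + \<bar>Im s\<bar>)) * (6 * x ^ 2 / T ^ 2)"
        using bound[OF s(2,3)] by (intro mult_mono) (auto intro: order_trans[OF norm_ge_zero])
      then show "norm (F s * K s) \<le> 6 * B * x ^ 2 * sqrt (1 + T) / T ^ 2"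
        by (simp add: norm_mult s(1) mult_ac)
    qed (use c T img cFK in \<open>auto simp: Q_def intro: continuous_on_subset\<close>)
    then have B2: "norm (contour_integral \<gamma> (\<lambda>s. F s * K s)
       - contour_integral (linepath (Complex c (-T)) (Complex c T)) (\<lambda>s. F s * K s))
       \<le> 2 * (2 - c) * (6 * B * x ^ 2 * sqrt (1 + T) / T ^ 2)" by (simp add: int0)
    have B3: "norm (contour_integral (linepath (Complex c (-T)) (Complex c T)) (\<lambda>s. F s * K s)) \<le> 4 * (6 * B * x powr c)"
    proof (rule vertical_edge_bound_decay)
      fix t :: real
      have "norm (K (Complex c t)) \<le> x powr c * 6 / (1 + \<bar>t\<bar>) ^ 2" using nK[of "Complex c t"] c by simp
      then have "norm (F (Complex c t)) * norm (K (Complex c t)) \<le> (B * sqrt (1 + \<bar>t\<bar>)) * (x powr c * 6 / (1 + \<bar>t\<bar>) ^ 2)"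
        using bound[of "Complex c t"] c by (intro mult_mono) (auto intro: order_trans[OF norm_ge_zero])
      also have "\<dots> = 6 * B * x powr c * (sqrt (1 + \<bar>t\<bar>) / (1 + \<bar>t\<bar>) ^ 2)" by simp
      also have "sqrt (1 + \<bar>t\<bar>) / (1 + \<bar>t\<bar>) ^ 2 = (1 + \<bar>t\<bar>) powr (1/2 - 2)"
        by (subst powr_diff) (auto simp: powr_half_sqrt)
      finally show "norm (F (Complex c t) * K (Complex c t)) \<le> 6 * B * x powr c * (1 + \<bar>t\<bar>) powr (-3/2)"
        by (simp add: norm_mult)
    next
      show "continuous_on {s. Re s = c} (\<lambda>s. F s * K s)" by (rule continuous_on_subset[OF cFK]) (use c in auto)
    qed (use T in auto)
    have "norm (2 * pi * \<i> * S) \<le> 8 * x ^ 2 * A / T + 2 * (2 - c) * (6 * B * x ^ 2 * sqrt (1 + T) / T ^ 2) + 4 * (6 * B * x powr c)"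
      using norm_triangle_mono[OF norm_triangle_mono[OF B1 B2] B3] by simp
    then show ?thesis by (simp add: norm_mult)
  qed
  have "((\<lambda>T. 24 * B * x powr c + 8 * x ^ 2 * A / T + 2 * (2 - c) * (6 * B * x ^ 2 * sqrt (1 + T) / T ^ 2)) \<longlongrightarrow> 
      24 * B * x powr c + 0 + 2 * (2 - c) * 0) at_top"
  proof (intro tendsto_intros)
    show "((\<lambda>T. 8 * x ^ 2 * A / T) \<longlongrightarrow> 0) at_top" by real_asymp
    have "((\<lambda>T. sqrt (1 + T) / T ^ 2) \<longlongrightarrow> 0) at_top" by real_asymp
    from tendsto_mult_right_zero[OF this, of "6 * B * x ^ 2"]
    show "((\<lambda>T. 6 * B * x ^ 2 * sqrt (1 + T) / T ^ 2) \<longlongrightarrow> 0) at_top" by simp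
  qed
  then have "2 * pi * norm S \<le> 24 * B * x powr c + 0 + 2 * (2 - c) * 0"
  proof (rule tendsto_lowerbound)
    show "\<forall>\<^sub>F T in at_top. 2 * pi * norm S \<le> 24 * B * x powr c + 8 * x ^ 2 * A / T + 2 * (2 - c) * (6 * B * x ^ 2 * sqrt (1 + T) / T ^ 2)"
      using eventually_ge_at_top[of "2::real"] by eventually_elim (rule main)
  qed auto
  \<comment> \<open>Dividing 24 by this 6 gives the constant 4 of the statement.\<close>
  moreover have "6 * norm S \<le> 2 * pi * norm S" using pi_gt3 by (intro mult_right_mono) auto
  ultimately show ?thesis unfolding S_def[symmetric] by simp
qed

section \<open>Logarithmic derivatives\<close>

text \<open>Fubini for an absolutely convergent double series, reordered along n = d * e; the
  successors account for indices that start at 1. It serves both Dirichlet convolution and the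
  Lambert series in the proof that L does not vanish at 1.\<close>

lemma divisor_regroup:
  fixes F :: "nat \<Rightarrow> nat \<Rightarrow> complex"
  assumes rows: "\<And>d. summable (\<lambda>e. norm (F (Suc d) (Suc e)))"
    and total: "summable (\<lambda>d. \<Sum>e. norm (F (Suc d) (Suc e)))"
    and g: "\<And>d. (\<lambda>e. F (Suc d) (Suc e)) sums g d" and S: "g sums S"
  shows "(\<lambda>n. \<Sum>d | d dvd Suc n. F d (Suc n div d)) sums S"
proof -
  define f where "f = (\<lambda>(d, e). F (Suc d) (Suc e))"
  have "(\<lambda>p. norm (f p)) summable_on (UNIV \<times> UNIV)"
  proof (rule summable_on_SigmaI)
    show "((\<lambda>e. norm (f (d, e))) has_sum (\<Sum>e. norm (F (Suc d) (Suc e)))) UNIV" for d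
      unfolding f_def using rows[of d] by (intro norm_summable_imp_has_sum) (auto simp: summable_sums)
    show "(\<lambda>d. \<Sum>e. norm (F (Suc d) (Suc e))) summable_on UNIV"
      using total rows by (subst summable_on_UNIV_nonneg_real_iff) (auto intro: suminf_nonneg)
  qed auto
  then have summ: "f summable_on (UNIV \<times> UNIV)" by (rule abs_summable_summable)
  have gbound: "norm (g d) \<le> (\<Sum>e. norm (F (Suc d) (Suc e)))" for d
    using summable_norm[OF rows[of d]] g[of d] by (simp add: sums_iff)
  have "(f has_sum S) (UNIV \<times> UNIV)"
  proof (rule has_sum_SigmaI[OF _ _ summ])
    show "((\<lambda>e. f (d, e)) has_sum g d) UNIV" for d
      unfolding f_def using rows[of d] g[of d] by (intro norm_summable_imp_has_sum) auto
    show "(g has_sum S) UNIV"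
      using S by (intro norm_summable_imp_has_sum summable_comparison_test'[OF total, of 0]) (auto intro: gbound)
  qed
  moreover have "((\<lambda>(n, d). F d (Suc n div d)) has_sum S) (SIGMA n:UNIV. {d. d dvd Suc n}) \<longleftrightarrow> (f has_sum S) (UNIV \<times> UNIV)"
  proof (rule has_sum_reindex_bij_witness[of _ "\<lambda>(d, e). (Suc d * Suc e - 1, Suc d)" "\<lambda>(n, d). (d - 1, Suc n div d - 1)"])
    fix p :: "nat \<times> nat" assume "p \<in> (SIGMA n:UNIV. {d. d dvd Suc n})"
    then obtain n d where "p = (n, d)" "d dvd Suc n" by auto
    then obtain e where p: "p = (n, d)" "Suc n = d * e" by (auto elim: dvdE)
    moreover from p(2) have "d > 0" "e > 0" by (auto intro: Nat.gr0I)
    ultimately show "(case (case p of (n, d) \<Rightarrow> (d - 1, Suc n div d - 1)) of (d, e) \<Rightarrow> (Suc d * Suc e - 1, Suc d)) = p"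
      "f (case p of (n, d) \<Rightarrow> (d - 1, Suc n div d - 1)) = (case p of (n, d) \<Rightarrow> F d (Suc n div d))"
      by (auto simp: f_def simp del: mult_Suc mult_Suc_right)
  next
    fix p :: "nat \<times> nat"
    obtain d e where p: "p = (d, e)" by force
    have *: "Suc (Suc d * Suc e - 1) = Suc d * Suc e" by simp
    show "(case (case p of (d, e) \<Rightarrow> (Suc d * Suc e - 1, Suc d)) of (n, d) \<Rightarrow> (d - 1, Suc n div d - 1)) = p"
      unfolding p prod.case * by (simp only: nonzero_mult_div_cancel_left[of "Suc d", OF Suc_not_Zero] diff_Suc_1)
    show "(case p of (d, e) \<Rightarrow> (Suc d * Suc e - 1, Suc d)) \<in> (SIGMA n:UNIV. {d. d dvd Suc n})"
      unfolding p prod.case by (auto simp: * simp del: mult_Suc mult_Suc_right)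
  qed auto
  ultimately have "((\<lambda>(n, d). F d (Suc n div d)) has_sum S) (SIGMA n:UNIV. {d. d dvd Suc n})" by simp
  then have "((\<lambda>n. \<Sum>d | d dvd Suc n. F d (Suc n div d)) has_sum S) UNIV"
    by (rule has_sum_SigmaD) (auto intro!: has_sum_finiteI)
  then show ?thesis by (rule has_sum_imp_sums)
qed

section \<open>Dirichlet series with coefficients of logarithmic size\<close>

lemma log_powr_summable:
  assumes "\<sigma> > 1"
  shows "summable (\<lambda>n. (ln (real (Suc n)) + 1) * real (Suc n) powr (-\<sigma>))"
proof (rule summable_comparison_test')
  define d where "d = (\<sigma> - 1) / 2"
  have d: "d > 0" using assms by (simp add: d_def)
  show "summable (\<lambda>n. (1 / d + 1) * real (Suc n) powr (-(1 + d)))" using d by (intro summable_powr_Suc) auto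
  fix n
  define x where "x = real (Suc n)"
  have x: "x \<ge> 1" by (simp add: x_def)
  have "ln x + 1 \<le> x powr d / d + x powr d"
    using x d ln_powr_bound[of x d] by (intro add_mono) (auto intro: ge_one_powr_ge_zero)
  also have "\<dots> = (1 / d + 1) * x powr d" by (simp add: algebra_simps)
  finally have "(ln x + 1) * x powr (-\<sigma>) \<le> ((1 / d + 1) * x powr d) * x powr (-\<sigma>)" by (intro mult_right_mono) auto
  also have "\<dots> = (1 / d + 1) * x powr (d + - \<sigma>)" by (simp only: powr_add mult.assoc)
  also have "d + - \<sigma> = - (1 + d)" by (simp add: d_def field_simps)
  finally show "norm ((ln (real (Suc n)) + 1) * real (Suc n) powr (-\<sigma>)) \<le> (1 / d + 1) * real (Suc n) powr (-(1 + d))"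
    using x by (simp add: x_def abs_mult)
qed

lemma norm_dirichlet_term:
  "norm (a / of_nat (Suc n) powr s) = norm a * real (Suc n) powr (- Re s)"
  using norm_powr_real_powr[of "of_nat (Suc n)" s] by (simp add: norm_divide norm_mult norm_inverse powr_minus divide_inverse del: of_nat_Suc)

lemma dirichlet_series_abs_summable:
  assumes "\<And>n. norm (a n) \<le> ln (real (Suc n)) + 1" "Re s > 1"
  shows "summable (\<lambda>n. norm (a n / of_nat (Suc n) powr s))"
  unfolding norm_dirichlet_term
  by (rule summable_comparison_test'[OF log_powr_summable[OF assms(2)], of 0])
     (use assms(1) in \<open>auto simp: abs_mult intro!: mult_right_mono\<close>)

lemma deriv_dirichlet_term:
  fixes a s :: complex
  shows
  "deriv (\<lambda>s. a / of_nat (Suc n) powr s) s = - of_real (ln (real (Suc n))) * a / of_nat (Suc n) powr s"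
proof (rule DERIV_imp_deriv)
  have "Ln (of_nat (Suc n) :: complex) = of_real (ln (real (Suc n)))"
    using Ln_of_real[of "real (Suc n)"] by simp
  moreover have "((\<lambda>s. a / of_nat (Suc n) powr s) has_field_derivative
      - (a * (of_nat (Suc n) powr s * Ln (of_nat (Suc n)))) / (of_nat (Suc n) powr s * of_nat (Suc n) powr s)) (at s)"
    by (auto intro!: derivative_eq_intros has_field_derivative_powr_right simp del: of_nat_Suc)
  ultimately show "((\<lambda>s. a / of_nat (Suc n) powr s) has_field_derivative
       - of_real (ln (real (Suc n))) * a / of_nat (Suc n) powr s) (at s)"
    by (simp add: divide_simps mult_ac del: of_nat_Suc)
qed

lemma dirichlet_series_holomorphic:
  fixes a :: "nat \<Rightarrow> complex"
  assumes "\<And>n. norm (a n) \<le> ln (real (Suc n)) + 1"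
  shows "\<exists>G. G holomorphic_on {s. Re s > 1} \<and>
    (\<forall>s. Re s > 1 \<longrightarrow> (\<lambda>n. a n / of_nat (Suc n) powr s) sums G s) \<and>
    (\<forall>s. Re s > 1 \<longrightarrow> (\<lambda>n. - of_real (ln (real (Suc n))) * a n / of_nat (Suc n) powr s) sums deriv G s)"
proof (rule holomorphic_series[of "{s. Re s > 1}" "\<lambda>n s. a n / of_nat (Suc n) powr s"])
  show "open {s. 1 < Re s}" by (rule open_halfspace_Re_gt)
  show "(\<lambda>s. a n / of_nat (Suc n) powr s) holomorphic_on {s. 1 < Re s}" for n
    by (intro holomorphic_intros) (auto simp del: of_nat_Suc)
  fix s0 assume s0: "s0 \<in> {s. 1 < Re s}"
  define d where "d = (Re s0 - 1) / 2"
  have d: "d > 0" using s0 by (simp add: d_def)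
  show "\<exists>d h. 0 < d \<and> summable h \<and> (\<forall>n. \<forall>y\<in>ball s0 d \<inter> {s. 1 < Re s}. norm (a n / of_nat (Suc n) powr y) \<le> h n)"
  proof (intro exI conjI allI ballI)
    show "summable (\<lambda>n. (ln (real (Suc n)) + 1) * real (Suc n) powr (-(1 + d)))"
      using d by (intro log_powr_summable) auto
    fix n y assume "y \<in> ball s0 d \<inter> {s. 1 < Re s}"
    then have "norm (y - s0) < d" by (simp add: dist_norm norm_minus_commute)
    then have "Re y \<ge> Re s0 - d" using abs_Re_le_cmod[of "y - s0"] by simp
    then have "Re y \<ge> 1 + d" by (simp add: d_def field_simps)
    then show "norm (a n / of_nat (Suc n) powr y) \<le> (ln (real (Suc n)) + 1) * real (Suc n) powr (-(1 + d))"
      unfolding norm_dirichlet_term using assms[of n] by (intro mult_mono powr_mono) auto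
  qed (use d in auto)
next
  fix g assume "g holomorphic_on {s. 1 < Re s}" "\<And>x. x \<in> {s. 1 < Re s} \<Longrightarrow> (\<lambda>n. a n / of_nat (Suc n) powr x) sums g x"
    "\<And>x. x \<in> {s. 1 < Re s} \<Longrightarrow> (\<lambda>n. deriv (\<lambda>s. a n / of_nat (Suc n) powr s) x) sums deriv g x"
  then show ?thesis unfolding deriv_dirichlet_term by (intro exI[of _ g]) blast
qed

text \<open>The common ground of Dirichlet characters and the constant 1, whose series is zeta; the
  results on logarithmic derivatives apply to both.\<close>

definition cmult_bounded :: "(nat \<Rightarrow> complex) \<Rightarrow> bool" where
  "cmult_bounded chi \<longleftrightarrow> (\<forall>m n. chi (m * n) = chi m * chi n) \<and> (\<forall>n. norm (chi n) \<le> 1) \<and> chi 1 = 1"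

lemma dc_cmult_bounded: "dirichlet_character q chi \<Longrightarrow> cmult_bounded chi"
  by (simp add: cmult_bounded_def dc_mult dc_norm_le_1 dc_1[simplified])

lemma cmult_bounded_one: "cmult_bounded (\<lambda>_. 1)"
  by (simp add: cmult_bounded_def)

text \<open>The first term is 1/4, and the rest is compared with a telescoping series of sum 1/2.
  What matters is a total below 1.\<close>

lemma sum_inverse_squares_le:
  "summable (\<lambda>n. real (Suc (Suc n)) powr (-2))" "(\<Sum>n. real (Suc (Suc n)) powr (-2)) \<le> 3 / 4"
proof -
  have s0: "summable (\<lambda>n. real (Suc n) powr (-2))" using summable_powr_Suc[of 2 1] by simp
  then show s1: "summable (\<lambda>n. real (Suc (Suc n)) powr (-2))" by (subst summable_Suc_iff)
  then have s2: "summable (\<lambda>n. real (Suc (Suc (Suc n))) powr (-2))" by (subst summable_Suc_iff)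
  have "(\<lambda>n. 1 / real (Suc (Suc n)) - 1 / real (Suc (Suc (Suc n)))) sums (1 / real (Suc (Suc 0)) - 0)"
  proof (rule telescope_sums')
    have "(\<lambda>n. 1 / real n) \<longlonglongrightarrow> 0" by (rule lim_1_over_n)
    from LIMSEQ_Suc[OF LIMSEQ_Suc[OF this]] show "(\<lambda>n. 1 / real (Suc (Suc n))) \<longlonglongrightarrow> 0" .
  qed
  then have t: "(\<lambda>n. 1 / real (Suc (Suc n)) - 1 / real (Suc (Suc (Suc n)))) sums (1 / 2)" by simp
  have "(\<Sum>n. real (Suc (Suc (Suc n))) powr (-2)) \<le> (\<Sum>n. 1 / real (Suc (Suc n)) - 1 / real (Suc (Suc (Suc n))))"
  proof (rule suminf_le[OF _ s2 sums_summable[OF t]])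
    fix n :: nat
    define u where "u = real (Suc (Suc n))"
    have "real (Suc (Suc (Suc n))) powr (-2) = 1 / (u + 1) ^ 2" by (simp add: powr_minus u_def field_simps)
    also have "\<dots> \<le> 1 / (u * (u + 1))" by (intro divide_left_mono) (auto simp: u_def power2_eq_square)
    also have "\<dots> = 1 / u - 1 / (u + 1)" by (simp add: u_def field_simps)
    finally show "real (Suc (Suc (Suc n))) powr (-2) \<le> 1 / real (Suc (Suc n)) - 1 / real (Suc (Suc (Suc n)))"
      by (simp add: u_def add_ac)
  qed
  then have "(\<Sum>n. real (Suc (Suc (Suc n))) powr (-2)) \<le> 1 / 2" using t by (simp add: sums_iff)
  moreover have "(\<Sum>n. real (Suc (Suc n)) powr (-2)) = (\<Sum>n. real (Suc (Suc (Suc n))) powr (-2)) + real (Suc (Suc 0)) powr (-2)"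
    using suminf_split_head[OF s1] by simp
  ultimately show "(\<Sum>n. real (Suc (Suc n)) powr (-2)) \<le> 3 / 4" by (simp add: powr_minus)
qed

text \<open>On Re s = 2 the first term 1 dominates the others, whose norms add up to at most 3/4.
  The bound starts off the non-vanishing for Re s > 1, and it controls the centre of the disc in the
  estimate of the logarithmic derivative.\<close>

lemma dirichlet_series_lower_bound:
  assumes "cmult_bounded chi" "Re s = 2" "(\<lambda>n. chi (Suc n) / of_nat (Suc n) powr s) sums D"
  shows "norm D \<ge> 1 / 4"
proof -
  have one: "chi 1 = 1" and n1: "\<And>n. norm (chi n) \<le> 1" using assms(1) by (auto simp: cmult_bounded_def)
  have "(\<lambda>n. chi (Suc (Suc n)) / of_nat (Suc (Suc n)) powr s) sums (D - chi 1)"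
    using assms(3) by (subst sums_Suc_iff) (simp add: one)
  then have eq: "D - 1 = (\<Sum>n. chi (Suc (Suc n)) / of_nat (Suc (Suc n)) powr s)" by (simp add: sums_iff one[simplified])
  have le: "norm (chi (Suc (Suc n)) / of_nat (Suc (Suc n)) powr s) \<le> real (Suc (Suc n)) powr (-2)" for n
    unfolding norm_dirichlet_term assms(2) using n1[of "Suc (Suc n)"] by (intro mult_left_le_one_le) auto
  then have s: "summable (\<lambda>n. norm (chi (Suc (Suc n)) / of_nat (Suc (Suc n)) powr s))"
    by (intro summable_comparison_test'[OF sum_inverse_squares_le(1), of 0]) auto
  have "norm (D - 1) \<le> (\<Sum>n. norm (chi (Suc (Suc n)) / of_nat (Suc (Suc n)) powr s))"
    unfolding eq by (rule summable_norm[OF s])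
  also have "\<dots> \<le> 3 / 4"
    using suminf_le[OF le s sum_inverse_squares_le(1)] sum_inverse_squares_le(2) by linarith
  finally show ?thesis using norm_triangle_ineq2[of 1 "1 - D"] by (simp add: norm_minus_commute)
qed

lemma norm_mangoldt_mult_le:
  assumes "cmult_bounded chi"
  shows "norm (mangoldt (Suc n) * chi (Suc n)) \<le> ln (real (Suc n)) + 1"
proof -
  have "norm (mangoldt (Suc n) * chi (Suc n)) \<le> mangoldt (Suc n) * 1"
    unfolding norm_mult norm_mangoldt using assms
    by (intro mult_left_mono mangoldt_nonneg) (auto simp: cmult_bounded_def)
  also have "mangoldt (Suc n) \<le> ln (real (Suc n))" by (rule mangoldt_le) simp
  finally show ?thesis by simp
qed

text \<open>The convolution identity \<open>(\<Sum>d | d dvd n. mangoldt d) = ln n\<close> gives \<open>D' = - D P\<close>; hence \<open>D exp Q\<close> is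
  constant for a primitive \<open>Q\<close> of \<open>P\<close>, and \<open>D\<close> has no zero.\<close>
theorem dirichlet_log_derivative:
  assumes chi: "cmult_bounded chi"
  shows "\<exists>D P. D holomorphic_on {s. Re s > 1} \<and> P holomorphic_on {s. Re s > 1} \<and>
    (\<forall>s. Re s > 1 \<longrightarrow> (\<lambda>n. chi (Suc n) / of_nat (Suc n) powr s) sums D s \<and>
      (\<lambda>n. mangoldt (Suc n) * chi (Suc n) / of_nat (Suc n) powr s) sums P s \<and>
      D s \<noteq> 0 \<and> P s = - deriv D s / D s)"
proof -
  have mult: "\<And>m n. chi (m * n) = chi m * chi n" and n1: "\<And>n. norm (chi n) \<le> 1"
    using chi by (auto simp: cmult_bounded_def)
  have b1: "norm (chi (Suc n)) \<le> ln (real (Suc n)) + 1" for n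
  proof -
    have "ln (real (Suc n)) \<ge> 0" by (rule ln_ge_zero) simp
    then show ?thesis using n1[of "Suc n"] by linarith
  qed
  obtain D where D: "D holomorphic_on {s. Re s > 1}"
    "\<And>s. Re s > 1 \<Longrightarrow> (\<lambda>n. chi (Suc n) / of_nat (Suc n) powr s) sums D s"
    "\<And>s. Re s > 1 \<Longrightarrow> (\<lambda>n. - of_real (ln (real (Suc n))) * chi (Suc n) / of_nat (Suc n) powr s) sums deriv D s"
    using dirichlet_series_holomorphic[of "\<lambda>n. chi (Suc n)", OF b1] by blast
  obtain P where P: "P holomorphic_on {s. Re s > 1}"
    "\<And>s. Re s > 1 \<Longrightarrow> (\<lambda>n. mangoldt (Suc n) * chi (Suc n) / of_nat (Suc n) powr s) sums P s"
    using dirichlet_series_holomorphic[of "\<lambda>n. mangoldt (Suc n) * chi (Suc n)", OF norm_mangoldt_mult_le[OF chi]] by blast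
  have prod: "deriv D s = - D s * P s" if s: "Re s > 1" for s
  proof -
    define F where "F = (\<lambda>d e::nat. (mangoldt d * chi d / of_nat d powr s) * (chi e / of_nat e powr s))"
    have a1: "summable (\<lambda>e. norm (chi (Suc e) / of_nat (Suc e) powr s))"
      by (rule dirichlet_series_abs_summable[OF b1 s])
    have a2: "summable (\<lambda>d. norm (mangoldt (Suc d) * chi (Suc d) / of_nat (Suc d) powr s))"
      by (rule dirichlet_series_abs_summable[OF norm_mangoldt_mult_le[OF chi] s])
    have "(\<lambda>n. \<Sum>d | d dvd Suc n. F d (Suc n div d)) sums (P s * D s)"
    proof (rule divisor_regroup)
      show "summable (\<lambda>e. norm (F (Suc d) (Suc e)))" for d
        unfolding F_def norm_mult[of "_ / _" "_ / _"] by (intro summable_mult a1)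
      show "summable (\<lambda>d. \<Sum>e. norm (F (Suc d) (Suc e)))"
        unfolding F_def norm_mult[of "_ / _" "_ / _"] by (subst suminf_mult[OF a1]) (intro summable_mult2 a2)
      show "(\<lambda>e. F (Suc d) (Suc e)) sums (mangoldt (Suc d) * chi (Suc d) / of_nat (Suc d) powr s * D s)" for d
        unfolding F_def by (intro sums_mult D(2) s)
      show "(\<lambda>d. mangoldt (Suc d) * chi (Suc d) / of_nat (Suc d) powr s * D s) sums (P s * D s)"
        by (intro sums_mult2 P(2) s)
    qed
    moreover have "(\<Sum>d | d dvd Suc n. F d (Suc n div d)) = of_real (ln (real (Suc n))) * chi (Suc n) / of_nat (Suc n) powr s" for n
    proof -
      have "(\<Sum>d | d dvd Suc n. F d (Suc n div d)) = (\<Sum>d | d dvd Suc n. mangoldt d * (chi (Suc n) / of_nat (Suc n) powr s))"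
      proof (rule sum.cong[OF refl])
        fix d assume "d \<in> {d. d dvd Suc n}"
        then obtain e where e: "Suc n = d * e" by (auto elim: dvdE)
        then have pos: "d > 0" "e > 0" by (auto intro: Nat.gr0I)
        have "of_nat (d * e) powr s = (of_nat d powr s * of_nat e powr s :: complex)"
          unfolding of_nat_mult using pos by (intro powr_times_real) auto
        then show "F d (Suc n div d) = mangoldt d * (chi (Suc n) / of_nat (Suc n) powr s)"
          using pos unfolding e by (simp add: F_def mult)
      qed
      also have "\<dots> = (\<Sum>d | d dvd Suc n. mangoldt d) * (chi (Suc n) / of_nat (Suc n) powr s)"
        by (simp only: sum_distrib_right)
      finally show ?thesis by (simp add: mangoldt_sum del: of_nat_Suc)
    qed
    ultimately have "(\<lambda>n. of_real (ln (real (Suc n))) * chi (Suc n) / of_nat (Suc n) powr s) sums (P s * D s)" by simp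
    from sums_minus[OF this] have "(\<lambda>n. - of_real (ln (real (Suc n))) * chi (Suc n) / of_nat (Suc n) powr s) sums (- (P s * D s))"
      by simp
    from sums_unique2[OF this D(3)[OF s]] show ?thesis by (simp add: mult.commute)
  qed
  have op: "open {s. Re s > 1}" and cv: "convex {s. Re s > 1}" by (rule open_halfspace_Re_gt convex_halfspace_Re_gt)+
  obtain Q where Q: "\<And>s. s \<in> {s. Re s > 1} \<Longrightarrow> (Q has_field_derivative P s) (at s within {s. Re s > 1})"
    using holomorphic_convex_primitive'[OF cv op P(1)] by blast
  have const: "\<exists>c. \<forall>s\<in>{s. Re s > 1}. D s * exp (Q s) = c"
  proof (rule has_field_derivative_zero_constant[OF cv])
    fix s assume s: "s \<in> {s. Re s > 1}"
    have "(D has_field_derivative deriv D s) (at s within {s. Re s > 1})"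
      using holomorphic_derivI[OF D(1) op s] .
    then have "((\<lambda>s. D s * exp (Q s)) has_field_derivative (deriv D s * exp (Q s) + (exp (Q s) * P s) * D s)) (at s within {s. Re s > 1})"
      by (intro DERIV_mult DERIV_chain2[OF DERIV_exp Q[OF s]])
    then show "((\<lambda>s. D s * exp (Q s)) has_field_derivative 0) (at s within {s. Re s > 1})"
      using prod[of s] s by (simp add: algebra_simps)
  qed
  have nz: "D s \<noteq> 0" if "Re s > 1" for s
  proof
    assume "D s = 0"
    from const obtain c where c: "\<forall>s\<in>{s. Re s > 1}. D s * exp (Q s) = c" by blast
    have "c = 0" using c[rule_format, of s] that \<open>D s = 0\<close> by simp
    then have "D 2 = 0" using c[rule_format, of 2] by simp
    then show False using dirichlet_series_lower_bound[OF chi, of 2 "D 2"] D(2)[of 2] by simp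
  qed
  have "P s = - deriv D s / D s" if "Re s > 1" for s using prod[OF that] nz[OF that] by simp
  with D P nz show ?thesis by blast
qed

section \<open>Orders of vanishing on the line Re s = 1\<close>

text \<open>Factoring f w = g w * (w - z) ^ m with g z \<noteq> 0 shows that the logarithmic
  derivative has residue \<open>m\<close>, the order of the zero. The approach is along a ray to the
  right, the side on which the Dirichlet series converge.\<close>

lemma log_derivative_tendsto:
  assumes "f holomorphic_on S" "open S" "connected S" "z \<in> S" "\<exists>w\<in>S. f w \<noteq> 0"
  obtains m :: nat where "((\<lambda>h::real. of_real h * deriv f (z + of_real h) / f (z + of_real h)) \<longlongrightarrow> of_nat m) (at_right 0)"
    "f z = 0 \<Longrightarrow> m > 0" "f z \<noteq> 0 \<Longrightarrow> m = 0"
proof -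
  define m where "m = nat (zorder f z)"
  define g where "g = zor_poly f z"
  from zorder_exist_zero[OF assms, folded g_def] obtain r where
    m0: "if f z = 0 then zorder f z > 0 else zorder f z = 0" and
    r: "r > 0" "cball z r \<subseteq> S" "g holomorphic_on cball z r"
    and fg: "\<And>w. w \<in> cball z r \<Longrightarrow> f w = g w * (w - z) ^ m \<and> g w \<noteq> 0"
    unfolding m_def by blast
  have gb: "g holomorphic_on ball z r" by (rule holomorphic_on_subset[OF r(3)]) auto
  have dg: "(g has_field_derivative deriv g w) (at w)" if "w \<in> ball z r" for w
    using holomorphic_derivI[OF gb open_ball that] .
  have df: "deriv f w = deriv g w * (w - z) ^ m + g w * (of_nat m * (w - z) ^ (m - 1))" if w: "w \<in> ball z r" for w
  proof (rule DERIV_imp_deriv)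
    have "((\<lambda>w. g w * (w - z) ^ m) has_field_derivative (deriv g w * (w - z) ^ m + g w * (of_nat m * (w - z) ^ (m - 1)))) (at w)"
      by (auto intro!: derivative_eq_intros dg w)
    then show "(f has_field_derivative (deriv g w * (w - z) ^ m + g w * (of_nat m * (w - z) ^ (m - 1)))) (at w)"
      by (rule has_field_derivative_transform_within_open[OF _ open_ball w]) (use fg in auto)
  qed
  have eq: "of_real h * deriv f (z + of_real h) / f (z + of_real h) = of_nat m + of_real h * (deriv g (z + of_real h) / g (z + of_real h))"
    if h: "0 < h" "h < r" for h :: real
  proof -
    define w where "w = z + of_real h"
    have w: "w \<in> ball z r" using h by (simp add: w_def dist_norm)
    then have w': "w \<in> cball z r" by simp
    \<comment> \<open>For \<open>m = 0\<close> truncated subtraction makes \<open>m - 1\<close>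
      equal to 0, but then the factor \<open>of_nat m\<close> vanishes.\<close>
    have "m = 0 \<or> of_real h * of_real h ^ (m - 1) = (of_real h ^ m :: complex)"
      by (cases m) auto
    then have "of_real h * (g w * (of_nat m * of_real h ^ (m - 1))) = g w * of_nat m * (of_real h ^ m :: complex)"
      by (auto simp: algebra_simps)
    then have "of_real h * deriv f w = (of_nat m + of_real h * (deriv g w / g w)) * f w"
      using df[OF w] fg[OF w'] by (simp add: w_def field_simps)
    moreover have "f w \<noteq> 0" using fg[OF w'] h by (simp add: w_def)
    ultimately show ?thesis by (simp add: w_def)
  qed
  have g0: "g z \<noteq> 0" using fg[of z] r(1) by simp
  have "isCont (\<lambda>w. deriv g w / g w) z"
  proof (rule isCont_divide)
    have "deriv g holomorphic_on ball z r" by (rule holomorphic_deriv[OF gb open_ball])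
    then show "isCont (deriv g) z" "isCont g z"
      using gb r(1) by (auto dest!: holomorphic_on_imp_continuous_on simp: continuous_on_eq_continuous_at)
  qed (rule g0)
  moreover have "((\<lambda>h::real. z + of_real h) \<longlongrightarrow> z) (at_right 0)" by (auto intro!: tendsto_eq_intros)
  ultimately have lim: "((\<lambda>h::real. deriv g (z + of_real h) / g (z + of_real h)) \<longlongrightarrow> deriv g z / g z) (at_right 0)"
    by (rule isCont_tendsto_compose)
  have "((\<lambda>h::real. of_nat m + of_real h * (deriv g (z + of_real h) / g (z + of_real h))) \<longlongrightarrow> of_nat m + of_real 0 * (deriv g z / g z)) (at_right 0)"
    by (intro tendsto_add tendsto_const tendsto_mult[OF _ lim] tendsto_of_real tendsto_ident_at)
  moreover have "\<forall>\<^sub>F h in at_right 0. of_real h * deriv f (z + of_real h) / f (z + of_real h) = of_nat m + of_real h * (deriv g (z + of_real h) / g (z + of_real h))"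
    using eventually_at_right_less[of 0] eventually_at_right_real[OF r(1)]
    by eventually_elim (intro eq, auto)
  ultimately have "((\<lambda>h::real. of_real h * deriv f (z + of_real h) / f (z + of_real h)) \<longlongrightarrow> of_nat m) (at_right 0)"
    by (subst tendsto_cong) auto
  then show ?thesis using that m0 by (auto simp: m_def split: if_splits)
qed

text \<open>The difference of powers is (s - 1) times the integral of u powr (-s) over [x, x + 1],
  so a term of the zeta series is compared with an integral. The auxiliary \<open>p\<close> is a
  primitive of (s - 1) * (x powr (-s) - u powr (-s)); two mean value estimates gain one power of
  \<open>x\<close>, enough for convergence when Re s > 0.\<close>

lemma zeta_pole_term:
  assumes "x \<ge> 1" "Re s > 0"
  shows "norm ((s - 1) * of_real x powr (-s) - (of_real x powr (1 - s) - of_real (x + 1) powr (1 - s)))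
     \<le> norm (s - 1) * norm s * x powr (- Re s - 1)"
proof -
  define p where "p = (\<lambda>u::real. of_real u powr (-(s - 1)) + (s - 1) * of_real u * of_real x powr (-s) :: complex)"
  have d0: "norm (of_real x powr (-s) - of_real u powr (-s)) \<le> norm s * x powr (- Re s - 1)" if u: "u \<in> {x..x+1}" for u
  proof -
    have "norm (of_real x powr (-s) - of_real u powr (-s)) \<le> (norm s * x powr (- Re s - 1)) * norm (x - u)"
    proof (rule differentiable_bound[where S="{x..x+1}" and f'="\<lambda>t h. h *\<^sub>R (- s * of_real t powr (- s - 1))"])
      show "((\<lambda>t. of_real t powr (-s)) has_derivative (\<lambda>h. h *\<^sub>R (- s * of_real t powr (- s - 1)))) (at t within {x..x + 1})"
        if "t \<in> {x..x+1}" for t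
        using has_field_derivative_of_real_powr[of t s "{x..x+1}"] that assms by (auto simp: has_vector_derivative_def)
      show "onorm (\<lambda>h. h *\<^sub>R (- s * of_real t powr (- s - 1))) \<le> norm s * x powr (- Re s - 1)"
        if t: "t \<in> {x..x+1}" for t
      proof (rule onorm_bound)
        have "norm (of_real t powr (- s - 1) :: complex) = t powr (- Re s - 1)"
          using t assms norm_powr_real_powr[of "of_real t" "- s - 1"] by simp
        also have "\<dots> \<le> x powr (- Re s - 1)" using t assms by (intro powr_mono2') auto
        finally have "norm s * norm (of_real t powr (- s - 1) :: complex) \<le> norm s * x powr (- Re s - 1)"
          by (intro mult_left_mono) auto
        then show "norm (h *\<^sub>R (- s * of_real t powr (- s - 1))) \<le> norm s * x powr (- Re s - 1) * norm h" for h
          using mult_left_mono[of _ _ "\<bar>h\<bar>"] by (simp add: norm_mult mult.commute[of _ "\<bar>h\<bar>"])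
      qed auto
    qed (use u in auto)
    also have "\<dots> \<le> (norm s * x powr (- Re s - 1)) * 1" using u by (intro mult_left_mono) auto
    finally show ?thesis by simp
  qed
  have "norm (p (x + 1) - p x) \<le> (norm (s - 1) * (norm s * x powr (- Re s - 1))) * norm ((x + 1) - x)"
  proof (rule differentiable_bound[where S="{x..x+1}" and f'="\<lambda>u h. h *\<^sub>R ((s - 1) * (of_real x powr (-s) - of_real u powr (-s)))"])
    fix u assume u: "u \<in> {x..x+1}"
    have "(p has_vector_derivative (- (s - 1) * of_real u powr (- (s - 1) - 1) + (s - 1) * of_real x powr (-s))) (at u within {x..x+1})"
      unfolding p_def
      by (intro has_vector_derivative_add has_field_derivative_of_real_powr)
         (use u assms in \<open>auto intro!: derivative_eq_intros simp: has_vector_derivative_def scaleR_conv_of_real\<close>)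
    moreover have "- (s - 1) * of_real u powr (- (s - 1) - 1) + (s - 1) * of_real x powr (-s) = (s - 1) * (of_real x powr (-s) - of_real u powr (-s))"
      by (simp add: algebra_simps)
    ultimately show "(p has_derivative (\<lambda>h. h *\<^sub>R ((s - 1) * (of_real x powr (-s) - of_real u powr (-s))))) (at u within {x..x + 1})"
      by (simp only: has_vector_derivative_def)
    show "onorm (\<lambda>h. h *\<^sub>R ((s - 1) * (of_real x powr (-s) - of_real u powr (-s)))) \<le> norm (s - 1) * (norm s * x powr (- Re s - 1))"
    proof (rule onorm_bound)
      have "norm (s - 1) * norm (of_real x powr (-s) - of_real u powr (-s)) \<le> norm (s - 1) * (norm s * x powr (- Re s - 1))"
        by (intro mult_left_mono d0 u) auto
      then show "norm (h *\<^sub>R ((s - 1) * (of_real x powr (-s) - of_real u powr (-s)))) \<le> norm (s - 1) * (norm s * x powr (- Re s - 1)) * norm h" for h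
        using mult_left_mono[of _ _ "\<bar>h\<bar>"] by (simp add: norm_mult mult.commute[of _ "\<bar>h\<bar>"])
    qed auto
  qed auto
  moreover have "p (x + 1) - p x = (s - 1) * of_real x powr (-s) - (of_real x powr (1 - s) - of_real (x + 1) powr (1 - s))"
    by (simp add: p_def algebra_simps)
  ultimately show ?thesis by (simp add: mult.assoc)
qed

text \<open>\<open>Z s\<close> is (s - 1) zeta(s). The comparison with the integral splits off a
  telescoping series of sum 1, and every correction term vanishes at s = 1.\<close>

lemma zeta_continuation:
  obtains Z where "Z holomorphic_on {s. Re s > 0}" "Z 1 = 1"
    "\<And>s. Re s > 1 \<Longrightarrow> (\<lambda>n. 1 / of_nat (Suc n) powr s) sums (Z s / (s - 1))"
proof -
  define f where "f = (\<lambda>n s. (s - 1) * of_real (real (Suc n)) powr (-s) - (of_real (real (Suc n)) powr (1 - s) - of_real (real (Suc n) + 1) powr (1 - s)) :: complex)"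
  have fb: "norm (f n s) \<le> norm (s - 1) * norm s * real (Suc n) powr (- Re s - 1)" if "Re s > 0" for n s
    unfolding f_def by (rule zeta_pole_term) (use that in auto)
  have "\<exists>G. G holomorphic_on {s. Re s > 0} \<and> (\<forall>s. Re s > 0 \<longrightarrow> (\<lambda>n. f n s) sums G s)"
  proof (rule holomorphic_series[of "{s. Re s > 0}" f])
    show "open {s. 0 < Re s}" by (rule open_halfspace_Re_gt)
    show "f n holomorphic_on {s. 0 < Re s}" for n unfolding f_def
      by (intro holomorphic_intros) (auto simp flip: of_nat_Suc simp del: of_nat_Suc)
    fix s0 assume s0: "s0 \<in> {s. 0 < Re s}"
    define d where "d = Re s0 / 2"
    have d: "d > 0" using s0 by (simp add: d_def)
    show "\<exists>d h. 0 < d \<and> summable h \<and> (\<forall>n. \<forall>y\<in>ball s0 d \<inter> {s. 0 < Re s}. norm (f n y) \<le> h n)"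
    proof (intro exI conjI allI ballI)
      show "summable (\<lambda>n. ((norm s0 + d + 1) * (norm s0 + d)) * real (Suc n) powr (-(1 + d)))"
        using d by (intro summable_powr_Suc) auto
      fix n y assume y: "y \<in> ball s0 d \<inter> {s. 0 < Re s}"
      then have n: "norm (y - s0) < d" by (simp add: dist_norm norm_minus_commute)
      then have "Re y \<ge> Re s0 - d" using abs_Re_le_cmod[of "y - s0"] by simp
      then have Re: "Re y \<ge> d" by (simp add: d_def)
      have n1: "norm y \<le> norm s0 + d" using n norm_triangle_ineq2[of y s0] by simp
      have n2: "norm (y - 1) \<le> norm s0 + d + 1" using n1 norm_triangle_ineq4[of y 1] by simp
      have "norm (f n y) \<le> norm (y - 1) * norm y * real (Suc n) powr (- Re y - 1)" using y by (intro fb) auto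
      also have "\<dots> \<le> ((norm s0 + d + 1) * (norm s0 + d)) * real (Suc n) powr (-(1 + d))"
        using n1 n2 Re d by (intro mult_mono powr_mono) auto
      finally show "norm (f n y) \<le> ((norm s0 + d + 1) * (norm s0 + d)) * real (Suc n) powr (-(1 + d))" .
    qed (use d in auto)
  qed blast
  then obtain G where G: "G holomorphic_on {s. Re s > 0}" "\<And>s. Re s > 0 \<Longrightarrow> (\<lambda>n. f n s) sums G s" by blast
  define Z where "Z = (\<lambda>s. 1 + G s)"
  have "f n 1 = 0" for n
  proof -
    have "(of_real (real (Suc n)) :: complex) \<noteq> 0" "(of_real (real (Suc n) + 1) :: complex) \<noteq> 0"
      by (simp_all only: of_real_eq_0_iff)
    then show ?thesis by (simp add: f_def del: of_nat_Suc of_real_of_nat_eq of_real_add)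
  qed
  then have "(\<lambda>n. f n 1) sums 0" by simp
  then have "G 1 = 0" using sums_unique2[OF G(2)[of 1]] by simp
  then have "Z 1 = 1" by (simp add: Z_def)
  moreover have "Z holomorphic_on {s. Re s > 0}" unfolding Z_def by (intro holomorphic_intros G)
  moreover have "(\<lambda>n. 1 / of_nat (Suc n) powr s) sums (Z s / (s - 1))" if s: "Re s > 1" for s
  proof -
    have lim: "(\<lambda>n. of_real (real (Suc n)) powr (1 - s) :: complex) \<longlonglongrightarrow> 0"
      using pdiff_tendsto_0[of "s - 1" 0] s by simp
    have "(\<lambda>n. of_real (real (Suc n)) powr (1 - s) - of_real (real (Suc (Suc n))) powr (1 - s) :: complex) sums
        (of_real (real (Suc 0)) powr (1 - s) - 0)"
      by (rule telescope_sums'[OF lim])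
    then have "(\<lambda>n. f n s + (of_real (real (Suc n)) powr (1 - s) - of_real (real (Suc (Suc n))) powr (1 - s))) sums (G s + 1)"
      using s by (intro sums_add G) auto
    then have "(\<lambda>n. (s - 1) * of_real (real (Suc n)) powr (-s)) sums Z s" by (simp add: f_def Z_def add_ac)
    then have "(\<lambda>n. (s - 1) * of_real (real (Suc n)) powr (-s) / (s - 1)) sums (Z s / (s - 1))" by (rule sums_divide)
    moreover have "(s - 1) * of_real (real (Suc n)) powr (-s) / (s - 1) = 1 / of_nat (Suc n) powr s" for n
    proof -
      have "s - 1 \<noteq> 0" using s by auto
      then show ?thesis by (simp add: powr_minus divide_inverse del: of_nat_Suc)
    qed
    ultimately show ?thesis by (simp only:)
  qed
  ultimately show ?thesis using that by blast
qed

text \<open>The limit is minus the order of vanishing at \<open>z\<close>. The domain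
  \<open>S\<close> is kept general so as to cover both entire functions and zeta on a half-plane
  without its pole.\<close>

lemma mangoldt_series_tendsto:
  assumes chi: "cmult_bounded chi" and L: "L holomorphic_on S" "open S" "connected S" "{s. Re s > 1} \<subseteq> S"
    and sums: "\<And>s. Re s > 1 \<Longrightarrow> (\<lambda>n. chi (Suc n) / of_nat (Suc n) powr s) sums L s"
    and z: "z \<in> S" "Re z = 1"
    and P: "\<And>s. Re s > 1 \<Longrightarrow> (\<lambda>n. mangoldt (Suc n) * chi (Suc n) / of_nat (Suc n) powr s) sums P s"
  obtains m :: nat where "((\<lambda>h::real. of_real h * P (z + of_real h)) \<longlongrightarrow> - of_nat m) (at_right 0)"
    "L z = 0 \<Longrightarrow> m > 0"
proof -
  obtain D P' where D: "\<And>s. Re s > 1 \<Longrightarrow> (\<lambda>n. chi (Suc n) / of_nat (Suc n) powr s) sums D s"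
    "\<And>s. Re s > 1 \<Longrightarrow> (\<lambda>n. mangoldt (Suc n) * chi (Suc n) / of_nat (Suc n) powr s) sums P' s"
    "\<And>s. Re s > 1 \<Longrightarrow> D s \<noteq> 0" "\<And>s. Re s > 1 \<Longrightarrow> P' s = - deriv D s / D s"
    using dirichlet_log_derivative[OF chi] by blast
  have LD: "L s = D s" if "Re s > 1" for s using sums_unique2[OF sums[OF that] D(1)[OF that]] .
  have PP: "P s = P' s" if "Re s > 1" for s using sums_unique2[OF P[OF that] D(2)[OF that]] .
  have dLD: "deriv L s = deriv D s" if s: "Re s > 1" for s
    by (intro deriv_cong_ev eventually_nhds_in_open[OF open_halfspace_Re_gt, THEN eventually_mono])
       (use s LD in auto)
  have "L 2 \<noteq> 0" using LD[of 2] D(3)[of 2] by simp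
  then have nz: "\<exists>w\<in>S. L w \<noteq> 0" using L(4) by (intro bexI[of _ 2]) auto
  obtain m :: nat where m: "((\<lambda>h::real. of_real h * deriv L (z + of_real h) / L (z + of_real h)) \<longlongrightarrow> of_nat m) (at_right 0)"
    "L z = 0 \<Longrightarrow> m > 0"
    using log_derivative_tendsto[OF L(1-3) z(1) nz] by metis
  from tendsto_minus[OF m(1)] have "((\<lambda>h::real. of_real h * P (z + of_real h)) \<longlongrightarrow> - of_nat m) (at_right 0)"
  proof (rule Lim_transform_eventually)
    show "\<forall>\<^sub>F h in at_right 0. - (of_real h * deriv L (z + of_real h) / L (z + of_real h)) = of_real h * P (z + of_real h)"
      using eventually_at_right_less[of 0]
    proof eventually_elim
      case (elim h)
      then have "Re (z + of_real h) > 1" using z(2) by simp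
      then show ?case using PP D(4) dLD LD by simp
    qed
  qed
  with m(2) show ?thesis using that by blast
qed

text \<open>Stated on the disc and not only on the circle because a character also takes the value
  0. Besides a square there remains the deficit 1 - |z| ^ 2, which is nonnegative there.\<close>

lemma three_four_one:
  assumes "norm z \<le> 1"
  shows "3 + 4 * Re z + Re (z ^ 2) \<ge> 0"
proof -
  have "Re z ^ 2 + Im z ^ 2 \<le> 1" using assms by (simp add: cmod_def)
  moreover have "3 + 4 * Re z + Re (z ^ 2) = 2 * (1 + Re z) ^ 2 + (1 - Re z ^ 2 - Im z ^ 2)"
    by (simp add: power2_eq_square algebra_simps)
  moreover have "2 * (1 + Re z) ^ 2 \<ge> 0" by simp
  ultimately show ?thesis by linarith
qed

section \<open>Divisor sums of a real character\<close>

lemma sum_divisors_prime_power_mult: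
  fixes f :: "nat \<Rightarrow> real"
  assumes p: "prime p" and m: "\<not> p dvd m" and mult: "\<And>a b. f (a * b) = f a * f b" and f1: "f 1 = 1"
  shows "(\<Sum>d | d dvd p ^ k * m. f d) = (\<Sum>i\<le>k. f p ^ i) * (\<Sum>d | d dvd m. f d)"
proof -
  have m0: "m > 0" using m by (auto intro: Nat.gr0I)
  have fp: "f (p ^ i) = f p ^ i" for i using f1 by (induction i) (auto simp: mult)
  have ndvd: "\<not> p dvd d" if "d dvd m" for d using that m dvd_trans by blast
  have inj: "inj_on (\<lambda>(i, d). p ^ i * d) ({..k} \<times> {d. d dvd m})"
  proof (rule inj_onI, clarify)
    fix i d j e assume *: "d dvd m" "e dvd m" "p ^ i * d = p ^ j * e"
    have "multiplicity p (p ^ i * d) = i" if "d dvd m" for i d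
      using ndvd[OF that] p by (simp add: multiplicity_prime_elem_times_other prime_elem_multiplicity_mult_distrib
         not_dvd_imp_multiplicity_0 m0 dvd_pos_nat[OF m0 that] prime_imp_prime_elem)
    from this[OF *(1), of i] this[OF *(2), of j] have "i = j" using *(3) by simp
    then show "i = j \<and> d = e" using *(3) p by (simp add: prime_gt_0_nat)
  qed
  have img: "{d. d dvd p ^ k * m} = (\<lambda>(i, d). p ^ i * d) ` ({..k} \<times> {d. d dvd m})"
  proof (intro equalityI subsetI)
    fix d assume "d \<in> {d. d dvd p ^ k * m}"
    then obtain b c where bc: "d = b * c" "b dvd p ^ k" "c dvd m" using division_decomp[of d "p ^ k" m] by auto
    then obtain i where "i \<le> k" "b = p ^ i" using divides_primepow_nat[OF p] by blast
    with bc show "d \<in> (\<lambda>(i, d). p ^ i * d) ` ({..k} \<times> {d. d dvd m})" by auto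
  qed (auto intro!: mult_dvd_mono le_imp_power_dvd)
  have "(\<Sum>d | d dvd p ^ k * m. f d) = (\<Sum>(i, d)\<in>{..k} \<times> {d. d dvd m}. f p ^ i * f d)"
    unfolding img by (subst sum.reindex[OF inj]) (auto simp: mult fp intro!: sum.cong)
  also have "\<dots> = (\<Sum>i\<le>k. f p ^ i) * (\<Sum>d | d dvd m. f d)"
    by (simp add: sum.cartesian_product[symmetric] sum_product)
  finally show ?thesis .
qed

lemma sum_powers_sign:
  fixes c :: real
  assumes "c \<in> {-1, 0, 1}"
  shows "(\<Sum>i\<le>k. c ^ i) \<ge> 0" "(\<Sum>i\<le>2 * k. c ^ i) \<ge> 1"
proof -
  have *: "(\<Sum>i\<le>k. c ^ i) \<ge> 0 \<and> (even k \<longrightarrow> (\<Sum>i\<le>k. c ^ i) \<ge> 1)" for k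
  proof (cases "c = -1")
    case True
    have "(\<Sum>i\<le>k. (-1 :: real) ^ i) = (if even k then 1 else 0)" by (induction k) auto
    with True show ?thesis by simp
  next
    case False
    then have c: "c \<ge> 0" using assms by auto
    have "(\<Sum>i\<le>k. c ^ i) \<ge> (\<Sum>i\<in>{0}. c ^ i)" using c by (intro sum_mono2) auto
    then show ?thesis by simp
  qed
  from *[of k] *[of "2 * k"] show "(\<Sum>i\<le>k. c ^ i) \<ge> 0" "(\<Sum>i\<le>2 * k. c ^ i) \<ge> 1" by auto
qed

text \<open>By multiplicativity the sum is a product over primes of geometric sums in
  \<open>f p\<close>, which is -1, 0 or 1. Such a geometric sum is never negative, and with an even
  top exponent, as for a square, it is at least 1.\<close>

lemma sum_divisors_nonneg:
  fixes f :: "nat \<Rightarrow> real"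
  assumes mult: "\<And>a b. f (a * b) = f a * f b" and f1: "f 1 = 1" and val: "\<And>n. f n \<in> {-1, 0, 1}" and n: "n > 0"
  shows "(\<Sum>d | d dvd n. f d) \<ge> 0" "(\<Sum>d | d dvd n ^ 2. f d) \<ge> 1"
proof -
  have "(\<Sum>d | d dvd n. f d) \<ge> 0 \<and> (\<Sum>d | d dvd n ^ 2. f d) \<ge> 1"
    using n
  proof (induction n rule: less_induct)
    case (less n)
    show ?case
    proof (cases "n = 1")
      case True
      then show ?thesis using f1 by simp
    next
      case False
      then obtain p where p: "prime p" "p dvd n" using prime_factor_nat by blast
      obtain m where m: "n = p ^ multiplicity p n * m" "\<not> p dvd m"
        using multiplicity_decompose'[of n p] less.prems prime_gt_1_nat[OF p(1)] by (auto simp: mult.commute)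
      define k where "k = multiplicity p n"
      have k: "k > 0" using p less.prems by (simp add: k_def prime_multiplicity_gt_zero_iff)
      have m0: "m > 0" using m less.prems by (auto intro: Nat.gr0I)
      have "p ^ k > 1" using one_less_power[OF prime_gt_1_nat[OF p(1)] k] .
      then have "m < p ^ k * m" using m0 by simp
      then have "m < n" by (simp only: k_def m(1)[symmetric])
      note IH = less.IH[OF this m0]
      have "n ^ 2 = (p ^ k * m) ^ 2" by (simp only: k_def m(1)[symmetric])
      then have n2: "n ^ 2 = p ^ (2 * k) * m ^ 2" by (simp add: power_mult_distrib mult.commute flip: power_mult)
      have "\<not> p dvd m ^ 2" using m(2) p(1) prime_dvd_power by blast
      from sum_divisors_prime_power_mult[OF p(1) this mult f1, of "2 * k"] n2
      have 2: "(\<Sum>d | d dvd n ^ 2. f d) = (\<Sum>i\<le>2 * k. f p ^ i) * (\<Sum>d | d dvd m ^ 2. f d)" by simp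
      have 1: "(\<Sum>d | d dvd n. f d) = (\<Sum>i\<le>k. f p ^ i) * (\<Sum>d | d dvd m. f d)"
        using sum_divisors_prime_power_mult[OF p(1) m(2) mult f1, of k] m(1) by (simp add: k_def)
      have "1 * 1 \<le> (\<Sum>i\<le>2 * k. f p ^ i) * (\<Sum>d | d dvd m ^ 2. f d)"
        using IH sum_powers_sign[OF val[of p], of k] by (intro mult_mono) auto
      moreover have "0 \<le> (\<Sum>i\<le>k. f p ^ i) * (\<Sum>d | d dvd m. f d)"
        using IH sum_powers_sign[OF val[of p], of k] by (intro mult_nonneg_nonneg) auto
      ultimately show ?thesis unfolding 1 2 by simp
    qed
  qed
  then show "(\<Sum>d | d dvd n. f d) \<ge> 0" "(\<Sum>d | d dvd n ^ 2. f d) \<ge> 1" by auto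
qed

lemma dc_null_periodic:
  assumes "dirichlet_character q chi" "chi \<noteq> principal_character q"
  shows "null_periodic q (\<lambda>n. chi (Suc n))"
proof -
  have per: "chi (n + q) = chi n" for n using assms(1) unfolding dirichlet_character_def by blast
  have "(\<Sum>n<Suc q. chi n) = chi 0 + (\<Sum>n<q. chi (Suc n))" by (rule sum.lessThan_Suc_shift)
  then have "(\<Sum>n<q. chi (Suc n)) = 0" using dc_sum_period[OF assms] per[of 0] by simp
  then show ?thesis using dc_pos[OF assms(1)] per[of "Suc _"] by (simp add: null_periodic_def)
qed

lemma dc_partial_sum_le:
  assumes "dirichlet_character q chi" "chi \<noteq> principal_character q"
  shows "norm (\<Sum>i<n. chi (Suc i)) \<le> real q"
proof -
  define S where "S = (\<lambda>n. \<Sum>i<n. chi (Suc i))"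
  have np: "\<And>n. chi (Suc (n + q)) = chi (Suc n)" "(\<Sum>n<q. chi (Suc n)) = 0" "q > 0"
    using dc_null_periodic[OF assms] by (auto simp: null_periodic_def)
  have "S (n + q) = S n" for n
  proof (induction n)
    case (Suc n)
    then show ?case using np(1)[of n] by (simp add: S_def)
  qed (use np in \<open>simp add: S_def\<close>)
  then have "S n = S (n mod q)" by (rule periodic_mod[symmetric])
  also have "norm \<dots> \<le> (\<Sum>i<n mod q. norm (chi (Suc i)))" unfolding S_def by (rule norm_sum)
  also have "\<dots> \<le> (\<Sum>i<n mod q. 1)" by (intro sum_mono dc_norm_le_1[OF assms(1)])
  also have "\<dots> \<le> real q" using np(3) by (simp add: less_imp_le)
  finally show ?thesis by (simp add: S_def)
qed

text \<open>One summation by parts, with partial sums bounded by \<open>q\<close>. The growth bound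
  is crude in \<open>q\<close> and \<open>s\<close>, but only its logarithm enters the estimate of
  the logarithmic derivative.\<close>

lemma dirichlet_L_halfplane:
  assumes chi: "dirichlet_character q chi" "chi \<noteq> principal_character q"
    and L: "L holomorphic_on UNIV" "\<And>s. Re s > 1 \<Longrightarrow> (\<lambda>n. chi (Suc n) / of_nat (Suc n) powr s) sums L s"
    and s: "Re s > 0"
  shows "(\<lambda>n. chi (Suc n) / of_nat (Suc n) powr s) sums L s"
    and "norm (L s) \<le> real q * norm s * (\<Sum>n. real (Suc n) powr (- Re s - 1))"
proof -
  define g where "g = (\<lambda>n. (\<Sum>i\<le>n. chi (Suc i)) + 0)"
  have q1: "real q \<ge> 1" using dc_pos[OF chi(1)] by simp
  have gb: "norm (g n) \<le> real q" for n
    using dc_partial_sum_le[OF chi, of "Suc n"] by (simp add: g_def lessThan_Suc_atMost)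
  have cb: "norm (chi (Suc n)) \<le> real q" for n using dc_norm_le_1[OF chi(1), of "Suc n"] q1 by linarith
  have "\<exists>G. G holomorphic_on {s. Re s > 1 - real 1} \<and>
    (\<forall>s. Re s > 1 - real 1 \<longrightarrow> (\<lambda>n. g n * pdiff 1 s (real (Suc n))) sums G s)"
    using pdiff_series[of g "real q" 1, OF gb] by metis
  then obtain G where G: "G holomorphic_on {s. Re s > 0}"
    "\<And>s. Re s > 0 \<Longrightarrow> (\<lambda>n. g n * pdiff 1 s (real (Suc n))) sums G s" by auto
  have sums: "(\<lambda>n. chi (Suc n) / of_nat (Suc n) powr s) sums G s" if "Re s > 0" for s
  proof -
    have "(\<lambda>n. g n * pdiff (Suc 0) s (real (Suc n))) sums G s" using G(2)[OF that] by simp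
    from pdiff_sums_step[OF cb gb[unfolded g_def] that this[unfolded g_def]]
    show ?thesis by (simp add: powr_minus divide_inverse)
  qed
  have "L s = G s"
  proof (rule analytic_continuation_open[of "{s. Re s > 1}" "{s. Re s > 0}" L G])
    have "2 \<in> {s. Re s > 1}" by simp
    then show "{s. Re s > 1} \<noteq> {}" by blast
    show "connected {s. 0 < Re s}" by (intro convex_connected convex_halfspace_Re_gt)
    show "L z = G z" if "z \<in> {s. 1 < Re s}" for z
      using sums_unique2[OF L(2)[of z] sums[of z]] that by simp
  qed (use s G(1) L(1) in \<open>auto intro: open_halfspace_Re_gt holomorphic_on_subset\<close>)
  then show "(\<lambda>n. chi (Suc n) / of_nat (Suc n) powr s) sums L s" using sums[OF s] by simp
  have su: "summable (\<lambda>n. real q * norm s * real (Suc n) powr (- Re s - 1))"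
  proof -
    have "- (Re s + 1) = - Re s - 1" by simp
    then show ?thesis using summable_powr_Suc[of "Re s + 1" "real q * norm s"] s by simp
  qed
  have le: "norm (g n * pdiff 1 s (real (Suc n))) \<le> real q * norm s * real (Suc n) powr (- Re s - 1)" for n
  proof -
    have "norm (pdiff 1 s (real (Suc n))) \<le> (\<Prod>i<1. norm (s + of_nat i)) * real (Suc n) powr (- Re s - real 1)"
      using s by (intro norm_pdiff_le) auto
    then have "norm (g n) * norm (pdiff 1 s (real (Suc n))) \<le> real q * (norm s * real (Suc n) powr (- Re s - 1))"
      using gb[of n] by (intro mult_mono) auto
    then show ?thesis by (simp only: norm_mult mult.assoc)
  qed
  have sn: "summable (\<lambda>n. norm (g n * pdiff 1 s (real (Suc n))))"
    by (rule summable_comparison_test'[OF su, of 0]) (use le in auto)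
  have "norm (L s) = norm (\<Sum>n. g n * pdiff 1 s (real (Suc n)))"
    using sums_unique[OF G(2)[OF s]] \<open>L s = G s\<close> by simp
  also have "\<dots> \<le> (\<Sum>n. norm (g n * pdiff 1 s (real (Suc n))))" by (rule summable_norm[OF sn])
  also have "\<dots> \<le> (\<Sum>n. real q * norm s * real (Suc n) powr (- Re s - 1))" by (rule suminf_le[OF le sn su])
  also have "\<dots> = real q * norm s * (\<Sum>n. real (Suc n) powr (- Re s - 1))"
  proof -
    have "- (Re s + 1) = - Re s - 1" by simp
    then have "summable (\<lambda>n. real (Suc n) powr (- Re s - 1))" using summable_powr_Suc[of "Re s + 1" 1] s by simp
    then show ?thesis by (rule suminf_mult)
  qed
  finally show "norm (L s) \<le> real q * norm s * (\<Sum>n. real (Suc n) powr (- Re s - 1))" .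
qed

text \<open>The terms \<open>i\<close> and \<open>n - 1 - i\<close> are paired, and the
  arithmetic-geometric mean inequality is applied to each pair. Writing the base as a square avoids
  half-integral exponents.\<close>

lemma sum_powers_lower:
  fixes u :: real assumes "0 \<le> u"
  shows "real n * u ^ (n - 1) \<le> (\<Sum>i<n. u ^ (2 * i))"
proof -
  have "(\<Sum>i<n. 2 * u ^ (n - 1)) \<le> (\<Sum>i<n. u ^ (2 * i) + u ^ (2 * (n - 1 - i)))"
  proof (rule sum_mono)
    fix i assume "i \<in> {..<n}"
    then have "u ^ i * u ^ (n - 1 - i) = u ^ (n - 1)" by (simp flip: power_add)
    then show "2 * u ^ (n - 1) \<le> u ^ (2 * i) + u ^ (2 * (n - 1 - i))"
      using sum_squares_bound[of "u ^ i" "u ^ (n - 1 - i)"] by (simp add: power_mult power2_eq_square power_mult_distrib mult.commute[of 2] power_even_eq)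
  qed
  also have "\<dots> = (\<Sum>i<n. u ^ (2 * i)) + (\<Sum>i<n. u ^ (2 * (n - 1 - i)))" by (rule sum.distrib)
  also have "(\<Sum>i<n. u ^ (2 * (n - 1 - i))) = (\<Sum>i<n. u ^ (2 * i))"
    using sum.nat_diff_reindex[of "\<lambda>i. u ^ (2 * i)" n] by simp
  finally show ?thesis by simp
qed

text \<open>With \<open>A n\<close> the geometric sum of length \<open>n\<close>, the claim reduces
  to n * (n + 1) * x ^ n \<le> A n * A (n + 1), which follows from \<open>sum_powers_lower\<close>
  for the square root of \<open>x\<close>. This monotonicity is what permits summation by parts
  against the bounded partial sums of a character.\<close>

lemma lambert_decreasing:
  fixes x :: real assumes x: "0 < x" "x < 1" and n: "n > 0"
  shows "1 / (real (Suc n) * (1 - x)) - x ^ Suc n / (1 - x ^ Suc n) \<le> 1 / (real n * (1 - x)) - x ^ n / (1 - x ^ n)"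
proof -
  define u where "u = sqrt x"
  have u: "u ^ 2 = x" "0 < u" "u < 1" using x by (auto simp: u_def)
  define A where "A = (\<lambda>n. \<Sum>i<n. x ^ i)"
  have A: "1 - x ^ m = (1 - x) * A m" for m using x by (simp add: A_def one_diff_power_eq)
  have Apos: "A m > 0" if "m > 0" for m using that x by (auto simp: A_def intro!: sum_pos)
  have Age: "A m \<ge> real m * u ^ (m - 1)" for m
    using sum_powers_lower[of u m] u by (simp add: A_def power_mult)
  have "real n * real (Suc n) * x ^ n \<le> real n * real (Suc n) * u ^ (n - 1 + n)"
  proof (rule mult_left_mono)
    have "x ^ n = u ^ (2 * n)" using u(1) by (simp add: power_mult)
    also have "\<dots> \<le> u ^ (n - 1 + n)" using u by (intro power_decreasing) auto
    finally show "x ^ n \<le> u ^ (n - 1 + n)" .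
  qed auto
  also have "\<dots> = (real n * u ^ (n - 1)) * (real (Suc n) * u ^ (Suc n - 1))" by (simp add: power_add)
  also have "\<dots> \<le> A n * A (Suc n)" using Age[of n] Age[of "Suc n"] u Apos[of n] n by (intro mult_mono) auto
  finally have key: "real n * real (Suc n) * x ^ n \<le> A n * A (Suc n)" .
  have "x ^ n / (1 - x ^ n) - x ^ Suc n / (1 - x ^ Suc n) = x ^ n / ((1 - x) * (A n * A (Suc n)))"
  proof -
    have nz: "1 - x ^ n \<noteq> 0" "1 - x ^ Suc n \<noteq> 0" using A[of n] A[of "Suc n"] Apos[of n] Apos[of "Suc n"] n x by auto
    have "x ^ n / (1 - x ^ n) - x ^ Suc n / (1 - x ^ Suc n) = x ^ n * (1 - x) / ((1 - x ^ n) * (1 - x ^ Suc n))"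
      using nz by (simp add: diff_frac_eq) (simp add: algebra_simps)
    also have "\<dots> = x ^ n / ((1 - x) * (A n * A (Suc n)))" 
    proof -
      have "((1 - x) * A n) * ((1 - x) * A (Suc n)) = (1 - x) * ((1 - x) * (A n * A (Suc n)))" by (simp only: mult_ac)
      then show ?thesis unfolding A
        using x mult_divide_mult_cancel_left[of "1 - x" "x ^ n" "(1 - x) * (A n * A (Suc n))"] by (simp only: mult.commute[of "x ^ n"])
    qed
    finally show ?thesis .
  qed
  also have "\<dots> \<le> 1 / ((1 - x) * (real n * real (Suc n)))"
  proof -
    have "x ^ n * (real n * real (Suc n)) \<le> A n * A (Suc n)" using key by (simp add: mult_ac)
    then have "x ^ n \<le> A n * A (Suc n) / (real n * real (Suc n))"
      using n by (subst pos_le_divide_eq) auto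
    then have "x ^ n / (A n * A (Suc n)) \<le> A n * A (Suc n) / (real n * real (Suc n)) / (A n * A (Suc n))"
      using n Apos[of n] Apos[of "Suc n"] by (intro divide_right_mono) auto
    then have "x ^ n / (A n * A (Suc n)) \<le> 1 / (real n * real (Suc n))"
      using n Apos[of n] Apos[of "Suc n"] by simp
    then have "x ^ n / (A n * A (Suc n)) / (1 - x) \<le> 1 / (real n * real (Suc n)) / (1 - x)"
      using x by (intro divide_right_mono) auto
    then show ?thesis by (simp add: mult_ac)
  qed
  also have "\<dots> = 1 / (real n * (1 - x)) - 1 / (real (Suc n) * (1 - x))"
  proof -
    have "1 / (y * (a * (1 + a))) = 1 / (a * y) - 1 / ((1 + a) * y)" if "y > 0" "a > 0" for y a :: real
    proof -
      have "1 + a \<noteq> 0" using that by simp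
      with that show ?thesis by (simp add: divide_simps)
    qed
    from this[of "1 - x" "real n"] show ?thesis using n x by simp
  qed
  finally show ?thesis by linarith
qed

section \<open>Non-vanishing on the line Re s = 1\<close>

text \<open>Monsky's argument: if \<open>L 1 = 0\<close>, summation by parts bounds \<open>\<Sum>n. \<chi>(n) x ^ n / (1 - x ^ n)\<close> by \<open>q\<close> for all
  \<open>x < 1\<close>; but the coefficients \<open>\<Sum>d | d dvd n. \<chi>(d)\<close> of this power series are nonnegative, and at least 1 at squares.\<close>
lemma L_nonzero_at_1_real:
  assumes chi: "dirichlet_character q chi" "chi \<noteq> principal_character q"
    and sq: "\<And>n. (chi n) ^ 2 \<in> {0, 1}"
    and L: "L holomorphic_on UNIV" "\<And>s. Re s > 1 \<Longrightarrow> (\<lambda>n. chi (Suc n) / of_nat (Suc n) powr s) sums L s"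
  shows "L 1 \<noteq> 0"
proof
  assume L1: "L 1 = 0"
  define rho where "rho = (\<lambda>n. Re (chi n))"
  have val: "chi n = -1 \<or> chi n = 0 \<or> chi n = 1" for n using sq[of n] by (auto simp: power2_eq_1_iff)
  have rho: "chi n = of_real (rho n)" "rho n \<in> {-1, 0, 1}" for n
    using val[of n] by (auto simp: rho_def)
  have rho_mult: "rho (a * b) = rho a * rho b" for a b
    using dc_mult[OF chi(1), of a b] rho by (metis of_real_eq_iff of_real_mult)
  have rho1: "rho 1 = 1" using dc_1[OF chi(1)] by (simp add: rho_def)
  have n1: "norm (chi n) \<le> 1" for n by (rule dc_norm_le_1[OF chi(1)])
  have "(\<lambda>n. chi (Suc n) / of_nat (Suc n)) sums 0"
    using dirichlet_L_halfplane(1)[OF chi L, of 1] L1 by (simp del: of_nat_Suc)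
  from sums_Re[OF this] have sum0: "(\<lambda>n. rho (Suc n) / real (Suc n)) sums 0"
    by (simp add: rho_def del: of_nat_Suc)
  have partial: "\<bar>\<Sum>i<n. rho (Suc i)\<bar> \<le> real q" for n
    using dc_partial_sum_le[OF chi, of n] abs_Re_le_cmod[of "\<Sum>i<n. chi (Suc i)"] by (simp add: rho_def)
  have bound: "(\<Sum>n\<in>{1..M}. x ^ (n ^ 2)) \<le> real q" if x: "0 < x" "x < 1" for x :: real and M
  proof -
    \<comment> \<open>The subtracted part 1 / (n (1 - x)) contributes nothing to the character sum,
      because the sum of \<open>rho n / n\<close> is 0, and it removes the blow-up as
      \<open>x\<close> tends to 1: for every \<open>x\<close> the sequence \<open>b\<close>
      decreases from \<open>b 0 = 1\<close> to 0. Its index is shifted by one.\<close>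
    define b where "b = (\<lambda>n. 1 / (real (Suc n) * (1 - x)) - x ^ Suc n / (1 - x ^ Suc n))"
    have xn: "x ^ n < 1" if "n > 0" for n using that x by (simp add: power_less_one_iff)
    have dec: "b (Suc n) \<le> b n" for n unfolding b_def by (rule lambert_decreasing[OF x]) simp
    have "(\<lambda>n. x ^ n) \<longlonglongrightarrow> 0" using x by (intro LIMSEQ_power_zero) auto
    then have "(\<lambda>n. x ^ n / (1 - x ^ n)) \<longlonglongrightarrow> 0 / (1 - 0)"
      by (intro tendsto_divide tendsto_diff tendsto_const) auto
    moreover have "(\<lambda>n. (1 / (1 - x)) * (1 / real n)) \<longlonglongrightarrow> (1 / (1 - x)) * 0" by (intro tendsto_intros lim_1_over_n)
    ultimately have "(\<lambda>n. (1 / (1 - x)) * (1 / real n) - x ^ n / (1 - x ^ n)) \<longlonglongrightarrow> 0"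
      using tendsto_diff by fastforce
    from LIMSEQ_Suc[OF this] have b0: "b \<longlonglongrightarrow> 0" by (simp add: b_def mult.commute del: power_Suc of_nat_Suc)
    have bpos: "b n \<ge> 0" for n
      using decseq_ge[OF decseq_SucI b0] dec by blast
    have b00: "b 0 = 1" using x by (simp add: b_def diff_divide_distrib[symmetric])
    have abel: "\<bar>\<Sum>n<N. rho (Suc n) * b n\<bar> \<le> real q" for N
    proof -
      define g where "g = (\<lambda>n. (\<Sum>i\<le>n. chi (Suc i)) + 0)"
      have g: "norm (g n) \<le> real q" for n
        using dc_partial_sum_le[OF chi, of "Suc n"] by (simp add: g_def lessThan_Suc_atMost)
      have g': "norm (g N - chi (Suc N)) \<le> real q"
        using dc_partial_sum_le[OF chi, of N] by (simp add: g_def lessThan_Suc_atMost[symmetric])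
      have "(\<Sum>n<N. chi (Suc n) * of_real (b n)) = (\<Sum>n<N. g n * (of_real (b n) - of_real (b (Suc n)))) - 0 * of_real (b 0) + (g N - chi (Suc N)) * of_real (b N)"
        unfolding g_def by (rule abel_summation)
      also have "norm \<dots> \<le> (\<Sum>n<N. real q * (b n - b (Suc n))) + real q * b N"
      proof (intro norm_triangle_mono)
        have "norm ((\<Sum>n<N. g n * (of_real (b n) - of_real (b (Suc n)))) - 0 * of_real (b 0)) \<le> (\<Sum>n<N. norm (g n * (of_real (b n) - of_real (b (Suc n)))))"
          by (simp add: norm_sum)
        also have "\<dots> \<le> (\<Sum>n<N. real q * (b n - b (Suc n)))"
        proof (rule sum_mono)
          fix n
          have "norm (of_real (b n) - of_real (b (Suc n)) :: complex) = b n - b (Suc n)"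
            using dec[of n] by (simp flip: of_real_diff)
          then show "norm (g n * (of_real (b n) - of_real (b (Suc n)))) \<le> real q * (b n - b (Suc n))"
            using g[of n] dec[of n] by (simp add: norm_mult mult_right_mono)
        qed
        finally show "norm ((\<Sum>n<N. g n * (of_real (b n) - of_real (b (Suc n)))) - 0 * of_real (b 0)) \<le> (\<Sum>n<N. real q * (b n - b (Suc n)))" .
        show "norm ((g N - chi (Suc N)) * of_real (b N)) \<le> real q * b N"
          using g' bpos[of N] by (simp add: norm_mult mult_right_mono)
      qed
      also have "(\<Sum>n<N. real q * (b n - b (Suc n))) = real q * (b 0 - b N)"
        unfolding sum_distrib_left[symmetric] by (simp add: sum_lessThan_telescope')
      also have "real q * (b 0 - b N) + real q * b N = real q" using b00 by (simp add: algebra_simps)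
      finally have "norm (\<Sum>n<N. chi (Suc n) * of_real (b n)) \<le> real q" .
      moreover have "(\<Sum>n<N. chi (Suc n) * of_real (b n)) = of_real (\<Sum>n<N. rho (Suc n) * b n)" by (simp add: rho(1))
      ultimately show ?thesis by (simp only: norm_of_real)
    qed
    define F where "F = (\<lambda>d e::nat. chi d * of_real (x ^ (d * e)))"
    have gs: "(\<lambda>e. x ^ (Suc d * Suc e)) sums (x ^ Suc d / (1 - x ^ Suc d))" for d
    proof -
      have "(\<lambda>e. x ^ Suc d * (x ^ Suc d) ^ e) sums (x ^ Suc d * (1 / (1 - x ^ Suc d)))"
        using xn[of "Suc d"] x by (intro sums_mult geometric_sums) auto
      moreover have "x ^ Suc d * (x ^ Suc d) ^ e = x ^ (Suc d * Suc e)" for e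
        by (metis power_Suc power_mult)
      ultimately have "(\<lambda>e. x ^ (Suc d * Suc e)) sums (x ^ Suc d / (1 - x ^ Suc d))"
        by (simp only: times_divide_eq_right mult_1_right)
      then show ?thesis .
    qed
    have geo: "(\<lambda>e. of_real (x ^ (Suc d * Suc e))) sums (of_real (x ^ Suc d / (1 - x ^ Suc d)) :: complex)" for d
      by (rule sums_of_real[OF gs])
    have Fn: "norm (F (Suc d) (Suc e)) \<le> x ^ (Suc d * Suc e)" for d e
      unfolding F_def norm_mult norm_of_real
      using mult_right_mono[OF n1[of "Suc d"], of "\<bar>x ^ (Suc d * Suc e)\<bar>"] x
      by (simp del: power_Suc mult_Suc mult_Suc_right)
    have rows: "summable (\<lambda>e. norm (F (Suc d) (Suc e)))" for d
      by (rule summable_comparison_test'[OF sums_summable[OF gs[of d]], of 0]) (use Fn in auto)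
    have tot: "summable (\<lambda>d. x ^ Suc d / (1 - x))"
      using x by (intro summable_divide) (simp add: summable_Suc_iff summable_geometric)
    have rb: "(\<Sum>e. norm (F (Suc d) (Suc e))) \<le> x ^ Suc d / (1 - x)" for d
    proof -
      have "(\<Sum>e. norm (F (Suc d) (Suc e))) \<le> (\<Sum>e. x ^ (Suc d * Suc e))"
        by (rule suminf_le[OF Fn rows sums_summable[OF gs]])
      also have "\<dots> = x ^ Suc d / (1 - x ^ Suc d)" using gs[of d] by (simp add: sums_iff)
      also have "\<dots> \<le> x ^ Suc d / (1 - x)"
      proof (rule divide_left_mono)
        have "x ^ Suc d \<le> x ^ 1" using x by (intro power_decreasing) auto
        then show "1 - x \<le> 1 - x ^ Suc d" by simp
      qed (use x xn[of "Suc d"] in auto)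
      finally show ?thesis .
    qed
    have total: "summable (\<lambda>d. \<Sum>e. norm (F (Suc d) (Suc e)))"
      by (rule summable_comparison_test'[OF tot, of 0]) (use rb suminf_nonneg[OF rows] in auto)
    have Fg: "(\<lambda>e. F (Suc d) (Suc e)) sums (chi (Suc d) * of_real (x ^ Suc d / (1 - x ^ Suc d)))" for d
      unfolding F_def by (intro sums_mult geo)
    have gbnd: "norm (chi (Suc d) * of_real (x ^ Suc d / (1 - x ^ Suc d))) \<le> (\<Sum>e. norm (F (Suc d) (Suc e)))" for d
      using summable_norm[OF rows[of d]] Fg[of d] by (simp add: sums_iff)
    have "summable (\<lambda>d. chi (Suc d) * of_real (x ^ Suc d / (1 - x ^ Suc d)))"
      by (rule summable_comparison_test'[OF total, of 0]) (use gbnd in auto)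
    then obtain S where S: "(\<lambda>d. chi (Suc d) * of_real (x ^ Suc d / (1 - x ^ Suc d))) sums S" by (auto simp: summable_def)
    have reg: "(\<lambda>n. \<Sum>d | d dvd Suc n. F d (Suc n div d)) sums S"
      by (rule divisor_regroup[OF rows total Fg S])
    have "(\<Sum>d | d dvd Suc n. F d (Suc n div d)) = of_real ((\<Sum>d | d dvd Suc n. rho d) * x ^ Suc n)" for n
      unfolding sum_distrib_right of_real_sum
      by (rule sum.cong) (auto simp: F_def rho(1) simp del: power_Suc)
    then have "(\<lambda>n. of_real ((\<Sum>d | d dvd Suc n. rho d) * x ^ Suc n)) sums S" using reg by (simp only:)
    from sums_Re[OF this] have reg': "(\<lambda>n. (\<Sum>d | d dvd Suc n. rho d) * x ^ Suc n) sums Re S" by simp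
    have "(\<lambda>N. (\<Sum>n<N. rho (Suc n) * (x ^ Suc n / (1 - x ^ Suc n)))) \<longlonglongrightarrow> Re S"
      using sums_Re[OF S] by (simp add: sums_def rho(1) del: power_Suc)
    moreover have "(\<Sum>n<N. rho (Suc n) * (x ^ Suc n / (1 - x ^ Suc n))) = (1 / (1 - x)) * (\<Sum>n<N. rho (Suc n) / real (Suc n)) - (\<Sum>n<N. rho (Suc n) * b n)" for N
      unfolding sum_distrib_left sum_subtractf[symmetric] b_def
      by (intro sum.cong refl) (simp add: algebra_simps del: power_Suc of_nat_Suc)
    ultimately have "(\<lambda>N. (1 / (1 - x)) * (\<Sum>n<N. rho (Suc n) / real (Suc n)) - (\<Sum>n<N. rho (Suc n) * b n)) \<longlonglongrightarrow> Re S" by simp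
    moreover have "(\<lambda>N. (1 / (1 - x)) * (\<Sum>n<N. rho (Suc n) / real (Suc n))) \<longlonglongrightarrow> (1 / (1 - x)) * 0"
      using sum0 unfolding sums_def by (intro tendsto_intros)
    ultimately have "(\<lambda>N. (1 / (1 - x)) * (\<Sum>n<N. rho (Suc n) / real (Suc n)) - ((1 / (1 - x)) * (\<Sum>n<N. rho (Suc n) / real (Suc n)) - (\<Sum>n<N. rho (Suc n) * b n))) \<longlonglongrightarrow> (1 / (1 - x)) * 0 - Re S"
      by (intro tendsto_diff)
    then have "(\<lambda>N. (\<Sum>n<N. rho (Suc n) * b n)) \<longlonglongrightarrow> - Re S" by simp
    from tendsto_rabs[OF this] have "\<bar>- Re S\<bar> \<le> real q"
      by (rule Lim_bounded[where M=0]) (use abel in auto)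
    then have up: "Re S \<le> real q" by simp
    define r where "r = (\<lambda>n. \<Sum>d | d dvd n. rho d)"
    have r: "r n \<ge> 0" "r (n ^ 2) \<ge> 1" if "n > 0" for n
      unfolding r_def using sum_divisors_nonneg[OF rho_mult rho1 rho(2) that] by blast+
    define T where "T = (\<lambda>n. n ^ 2 - 1) ` {1..M}"
    have Suc_sq: "Suc (n ^ 2 - 1) = n ^ 2" if "n \<ge> 1" for n :: nat using that by simp
    have inj: "inj_on (\<lambda>n::nat. n ^ 2 - 1) {1..M}"
    proof (rule inj_onI)
      fix m n assume "m \<in> {1..M}" "n \<in> {1..M}" "m ^ 2 - 1 = n ^ 2 - 1"
      then have "m \<ge> 1" "n \<ge> 1" "Suc (m ^ 2 - 1) = Suc (n ^ 2 - 1)" by auto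
      then have "m ^ 2 = n ^ 2" by (simp only: Suc_sq)
      then show "m = n" by (simp add: power2_eq_iff_nonneg)
    qed
    have "(\<Sum>n\<in>{1..M}. x ^ (n ^ 2)) \<le> (\<Sum>n\<in>{1..M}. r (n ^ 2) * x ^ (n ^ 2))"
      using r(2) x by (intro sum_mono) (auto intro: mult_right_mono[of 1, simplified])
    also have "\<dots> = (\<Sum>n\<in>T. r (Suc n) * x ^ Suc n)"
      unfolding T_def by (subst sum.reindex[OF inj]) (auto intro!: sum.cong simp: Suc_sq simp del: power_Suc)
    also have "\<dots> \<le> (\<Sum>n. r (Suc n) * x ^ Suc n)"
      using reg' r(1) x by (intro sum_le_suminf) (auto simp: T_def r_def sums_iff)
    also have "\<dots> = Re S" using reg' by (simp add: r_def sums_iff)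
    finally show ?thesis using up by simp
  qed
  \<comment> \<open>As \<open>x\<close> tends to 1, each of these q + 1 terms tends to 1, while
    their sum stays at most q.\<close>
  have "((\<lambda>x::real. \<Sum>n\<in>{1..Suc q}. x ^ (n ^ 2)) \<longlongrightarrow> (\<Sum>n\<in>{1..Suc q}. 1 ^ (n ^ 2))) (at_left 1)"
    by (intro tendsto_intros)
  then have "(\<Sum>n\<in>{1..Suc q}. 1 ^ (n ^ 2)) \<le> real q"
  proof (rule tendsto_upperbound)
    show "\<forall>\<^sub>F x in at_left 1. (\<Sum>n\<in>{1..Suc q}. x ^ (n ^ 2)) \<le> real q"
    proof (rule eventually_mono[OF eventually_at_left_real[of 0 "1::real"]])
      show "(\<Sum>n\<in>{1..Suc q}. x ^ (n ^ 2)) \<le> real q" if "x \<in> {0<..<1}" for x :: real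
        by (rule bound) (use that in auto)
    qed simp
  qed auto
  then show False by simp
qed


text \<open>Minus the logarithmic derivative of zeta is 1 / (s - 1) - Z' / Z. The simple pole gives
  the limit 1, and \<open>Z 1 = 1\<close> excludes a further contribution.\<close>

lemma zeta_mangoldt_tendsto:
  assumes P: "\<And>s. Re s > 1 \<Longrightarrow> (\<lambda>n. mangoldt (Suc n) / of_nat (Suc n) powr s) sums P s"
  shows "((\<lambda>h::real. of_real h * P (1 + of_real h)) \<longlongrightarrow> 1) (at_right 0)"
proof -
  obtain Z where Z: "Z holomorphic_on {s. Re s > 0}" "Z 1 = 1"
    "\<And>s. Re s > 1 \<Longrightarrow> (\<lambda>n. 1 / of_nat (Suc n) powr s) sums (Z s / (s - 1))"
    using zeta_continuation by metis
  obtain D P' where D: "\<And>s. Re s > 1 \<Longrightarrow> (\<lambda>n. 1 / of_nat (Suc n) powr s) sums D s"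
    "\<And>s. Re s > 1 \<Longrightarrow> (\<lambda>n. mangoldt (Suc n) * 1 / of_nat (Suc n) powr s) sums P' s"
    "\<And>s. Re s > 1 \<Longrightarrow> D s \<noteq> 0" "\<And>s. Re s > 1 \<Longrightarrow> P' s = - deriv D s / D s"
    using dirichlet_log_derivative[OF cmult_bounded_one] by blast
  have op: "open {s. Re s > 0}" by (rule open_halfspace_Re_gt)
  have cn: "connected {s. Re s > 0}" by (intro convex_connected convex_halfspace_Re_gt)
  have nz: "\<exists>w\<in>{s. Re s > 0}. Z w \<noteq> 0" using Z(2) by (intro bexI[of _ 1]) auto
  obtain m :: nat where m: "((\<lambda>h::real. of_real h * deriv Z (1 + of_real h) / Z (1 + of_real h)) \<longlongrightarrow> of_nat m) (at_right 0)"
    "Z 1 \<noteq> 0 \<Longrightarrow> m = 0"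
    by (rule log_derivative_tendsto[OF Z(1) op cn _ nz, of 1]) auto
  have lim: "((\<lambda>h::real. 1 - of_real h * deriv Z (1 + of_real h) / Z (1 + of_real h)) \<longlongrightarrow> 1 - of_nat m) (at_right 0)"
    by (intro tendsto_diff tendsto_const m(1))
  have "P s = 1 / (s - 1) - deriv Z s / Z s" if s: "Re s > 1" for s
  proof -
    have "P s = P' s" using sums_unique2[OF P[OF s]] D(2)[OF s] by simp
    also have "\<dots> = - deriv D s / D s" by (rule D(4)[OF s])
    also have "D s = Z s / (s - 1)" by (rule sums_unique2[OF D(1)[OF s] Z(3)[OF s]])
    finally have 1: "P s = - deriv D s / (Z s / (s - 1))" .
    have Z0: "Z s \<noteq> 0" "s - 1 \<noteq> 0" using D(3)[OF s] sums_unique2[OF D(1)[OF s] Z(3)[OF s]] s by auto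
    have "deriv D s = (deriv Z s * (s - 1) - Z s) / ((s - 1) * (s - 1))"
    proof (rule DERIV_imp_deriv)
      have "((\<lambda>s. Z s / (s - 1)) has_field_derivative (deriv Z s * (s - 1) - Z s * 1) / ((s - 1) * (s - 1))) (at s)"
        using Z0 s by (intro DERIV_divide holomorphic_derivI[OF Z(1) op]) (auto intro!: derivative_eq_intros)
      then have "((\<lambda>s. Z s / (s - 1)) has_field_derivative (deriv Z s * (s - 1) - Z s) / ((s - 1) * (s - 1))) (at s)" by simp
      then show "(D has_field_derivative (deriv Z s * (s - 1) - Z s) / ((s - 1) * (s - 1))) (at s)"
      proof (rule has_field_derivative_transform_within_open[OF _ open_halfspace_Re_gt[of 1]])
        show "Z w / (w - 1) = D w" if "w \<in> {s. 1 < Re s}" for w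
          using sums_unique2[OF Z(3) D(1), of w] that by simp
      qed (use s in auto)
    qed
    then show ?thesis unfolding 1 using Z0 by (simp add: divide_simps)
  qed
  then have "\<forall>\<^sub>F h in at_right 0. 1 - of_real h * deriv Z (1 + of_real h) / Z (1 + of_real h) = of_real h * P (1 + of_real h)"
    using eventually_at_right_less[of "0::real"] by (auto elim!: eventually_mono simp: right_diff_distrib)
  from Lim_transform_eventually[OF lim this] show ?thesis using m(2) Z(2) by simp
qed

text \<open>The inequality \<open>3 + 4 cos \<theta> + cos 2\<theta> \<ge> 0\<close>, which does not exclude a simple zero at 1 for real characters.\<close>
theorem L_nonzero_line_1:
  assumes chi: "dirichlet_character q chi" "chi \<noteq> principal_character q"
    and L: "L holomorphic_on UNIV" "\<And>s. Re s > 1 \<Longrightarrow> (\<lambda>n. chi (Suc n) / of_nat (Suc n) powr s) sums L s"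
    and z: "Re z = 1"
  shows "L z \<noteq> 0"
proof (cases "(\<lambda>n. chi n ^ 2) = principal_character q \<and> Im z = 0")
  case True
  then have "chi n ^ 2 \<in> {0, 1}" for n by (auto simp: fun_eq_iff principal_character_def)
  moreover have "z = 1" using z True by (simp add: complex_eq_iff)
  ultimately show ?thesis using L_nonzero_at_1_real[OF chi _ L] by simp
next
  case False
  define t where "t = Im z"
  have z_eq: "z = 1 + \<i> * of_real t" using z by (simp add: complex_eq_iff t_def)
  have sq: "dirichlet_character q (\<lambda>n. chi n ^ 2)" using dc_times[OF chi(1,1)] by (simp add: power2_eq_square)
  define z2 where "z2 = 1 + \<i> * of_real (2 * t)"
  have cm: "cmult_bounded chi" by (rule dc_cmult_bounded[OF chi(1)])
  \<comment> \<open>\<open>psi\<close> is chi ^ 2, or the constant 1 if chi ^ 2 is principal, so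
    that zeta stands in for the series of the principal character. At \<open>n\<close> with
    \<open>chi n = 0\<close> the inequality survives this exchange, because 3 outweighs the last
    summand.\<close>
  have "\<exists>psi L2 S. cmult_bounded psi \<and> L2 holomorphic_on S \<and> open S \<and> connected S \<and> {s. Re s > 1} \<subseteq> S \<and>
     (\<forall>s. Re s > 1 \<longrightarrow> (\<lambda>n. psi (Suc n) / of_nat (Suc n) powr s) sums L2 s) \<and> z2 \<in> S \<and>
     (\<forall>n w. norm w \<le> 1 \<longrightarrow> 3 + 4 * Re (chi n * w) + Re (psi n * w ^ 2) \<ge> 0)"
  proof (cases "(\<lambda>n. chi n ^ 2) = principal_character q")
    case True
    then have t0: "t \<noteq> 0" using False by (simp add: t_def)
    obtain Z where Z: "Z holomorphic_on {s. Re s > 0}"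
      "\<And>s. Re s > 1 \<Longrightarrow> (\<lambda>n. 1 / of_nat (Suc n) powr s) sums (Z s / (s - 1))"
      using zeta_continuation by metis
    define S where "S = {s. Re s > 0} - {1::complex}"
    have "connected S" unfolding S_def
      by (rule connected_open_delete) (auto intro: open_halfspace_Re_gt convex_connected convex_halfspace_Re_gt)
    moreover have "open S" unfolding S_def by (intro open_Diff open_halfspace_Re_gt) auto
    moreover have "(\<lambda>s. Z s / (s - 1)) holomorphic_on S" unfolding S_def
      by (intro holomorphic_intros holomorphic_on_subset[OF Z(1)]) auto
    moreover have "z2 \<in> S" using t0 by (auto simp: S_def z2_def complex_eq_iff)
    moreover have "3 + 4 * Re (chi n * w) + Re (1 * w ^ 2) \<ge> 0" if w: "norm w \<le> 1" for n w
    proof (cases "chi n = 0")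
      case True
      have "\<bar>Re (w ^ 2)\<bar> \<le> norm (w ^ 2)" by (rule abs_Re_le_cmod)
      also have "\<dots> \<le> 1" using w by (simp add: norm_power power_le_one)
      finally show ?thesis using True by simp
    next
      case cn: False
      have "chi n ^ 2 = 1" using True cn by (auto simp: fun_eq_iff principal_character_def dest!: spec[of _ n] split: if_splits)
      then have "(chi n * w) ^ 2 = 1 * w ^ 2" by (simp add: power_mult_distrib)
      moreover have "norm (chi n * w) \<le> 1" using w dc_norm_le_1[OF chi(1), of n] by (simp add: norm_mult mult_le_one)
      ultimately show ?thesis using three_four_one[of "chi n * w"] by (simp only:)
    qed
    ultimately show ?thesis using Z(2) cmult_bounded_one
      by (intro exI[of _ "\<lambda>_. 1"] exI[of _ "\<lambda>s. Z s / (s - 1)"] exI[of _ S]) (auto simp: S_def)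
  next
    case False
    obtain L2 where L2: "L2 holomorphic_on UNIV"
      "\<And>s. Re s > 1 \<Longrightarrow> (\<lambda>n. chi (Suc n) ^ 2 * of_nat (Suc n) powr (-s)) sums L2 s"
      using null_periodic_entire[OF dc_null_periodic[OF sq False]] by metis
    have "3 + 4 * Re (chi n * w) + Re (chi n ^ 2 * w ^ 2) \<ge> 0" if w: "norm w \<le> 1" for n w
      using three_four_one[of "chi n * w"] w dc_norm_le_1[OF chi(1), of n]
      by (simp add: norm_mult mult_le_one power_mult_distrib)
    then show ?thesis using L2 dc_cmult_bounded[OF sq]
      by (intro exI[of _ "\<lambda>n. chi n ^ 2"] exI[of _ L2] exI[of _ UNIV]) (auto simp: powr_minus divide_inverse simp del: of_nat_Suc)
  qed
  then obtain psi L2 S where psi: "cmult_bounded psi" and L2: "L2 holomorphic_on S" "open S" "connected S" "{s. Re s > 1} \<subseteq> S"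
    "\<And>s. Re s > 1 \<Longrightarrow> (\<lambda>n. psi (Suc n) / of_nat (Suc n) powr s) sums L2 s" "z2 \<in> S"
    and pos: "\<And>n w. norm w \<le> 1 \<Longrightarrow> 3 + 4 * Re (chi n * w) + Re (psi n * w ^ 2) \<ge> 0" by blast
  have ex: "\<exists>P. \<forall>s. Re s > 1 \<longrightarrow> (\<lambda>n. mangoldt (Suc n) * chi (Suc n) / of_nat (Suc n) powr s) sums P s"
    if "cmult_bounded chi" for chi
    using dirichlet_log_derivative[OF that] by blast
  obtain P0 where P0: "\<And>s. Re s > 1 \<Longrightarrow> (\<lambda>n. mangoldt (Suc n) / of_nat (Suc n) powr s) sums P0 s"
    using ex[OF cmult_bounded_one] by auto
  obtain P1 where P1: "\<And>s. Re s > 1 \<Longrightarrow> (\<lambda>n. mangoldt (Suc n) * chi (Suc n) / of_nat (Suc n) powr s) sums P1 s"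
    using ex[OF cm] by blast
  obtain P2 where P2: "\<And>s. Re s > 1 \<Longrightarrow> (\<lambda>n. mangoldt (Suc n) * psi (Suc n) / of_nat (Suc n) powr s) sums P2 s"
    using ex[OF psi] by blast
  obtain m1 :: nat where m1: "((\<lambda>h::real. of_real h * P1 (z + of_real h)) \<longlongrightarrow> - of_nat m1) (at_right 0)"
    "L z = 0 \<Longrightarrow> m1 > 0"
    by (rule mangoldt_series_tendsto[OF cm L(1) open_UNIV connected_UNIV _ L(2) _ z P1]) auto
  obtain m2 :: nat where m2: "((\<lambda>h::real. of_real h * P2 (z2 + of_real h)) \<longlongrightarrow> - of_nat m2) (at_right 0)"
    by (rule mangoldt_series_tendsto[OF psi L2(1-5) L2(6) _ P2]) (auto simp: z2_def)
  note m0 = zeta_mangoldt_tendsto[OF P0]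
  have "((\<lambda>h::real. Re (3 * (of_real h * P0 (1 + of_real h)) + 4 * (of_real h * P1 (z + of_real h)) + of_real h * P2 (z2 + of_real h)))
      \<longlongrightarrow> Re (3 * 1 + 4 * (- of_nat m1) + (- of_nat m2))) (at_right 0)"
    by (intro tendsto_Re tendsto_add tendsto_mult tendsto_const m0 m1(1) m2)
  then have "Re (3 * 1 + 4 * (- of_nat m1) + (- of_nat m2)) \<ge> 0"
  proof (rule tendsto_lowerbound)
    show "\<forall>\<^sub>F h in at_right 0. 0 \<le> Re (3 * (of_real h * P0 (1 + of_real h)) + 4 * (of_real h * P1 (z + of_real h)) + of_real h * P2 (z2 + of_real h))"
      using eventually_at_right_less[of "0::real"]
    proof eventually_elim
      case (elim h)
      define T where "T = (\<lambda>n. 3 * (mangoldt (Suc n) / of_nat (Suc n) powr (1 + of_real h)) +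
         4 * (mangoldt (Suc n) * chi (Suc n) / of_nat (Suc n) powr (z + of_real h)) +
         mangoldt (Suc n) * psi (Suc n) / of_nat (Suc n) powr (z2 + of_real h) :: complex)"
      have "T sums (3 * P0 (1 + of_real h) + 4 * P1 (z + of_real h) + P2 (z2 + of_real h))"
        unfolding T_def by (intro sums_add sums_mult P0 P1 P2) (use elim z in \<open>auto simp: z2_def\<close>)
      from sums_Re[OF this] have TS: "(\<lambda>n. Re (T n)) sums Re (3 * P0 (1 + of_real h) + 4 * P1 (z + of_real h) + P2 (z2 + of_real h))" .
      have "Re (T n) \<ge> 0" for n
      proof -
        define N where "N = (of_nat (Suc n) :: complex)"
        \<comment> \<open>The oscillating part of the summand at \<open>z\<close>; at
          \<open>z2\<close> it appears squared, which brings in the trigonometric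
          inequality.\<close>
        define w where "w = N powr (- (\<i> * of_real t))"
        have N0: "N \<noteq> 0" by (simp add: N_def del: of_nat_Suc)
        have nw: "norm w \<le> 1" using norm_powr_real_powr[of N "- (\<i> * of_real t)"] by (simp add: w_def N_def)
        define r where "r = real (Suc n) powr (- (1 + h)) * mangoldt (Suc n)"
        have r: "r \<ge> 0" by (simp add: r_def mangoldt_nonneg)
        have Nr: "N powr (- (1 + of_real h)) = of_real (real (Suc n) powr (- (1 + h)))"
          using powr_of_real[of "real (Suc n)" "- (1 + h)"] by (simp add: N_def)
        have e0: "mangoldt (Suc n) / N powr (1 + of_real h) = (of_real r :: complex)"
        proof -
          have "mangoldt (Suc n) / N powr (1 + of_real h) = mangoldt (Suc n) * N powr (- (1 + of_real h))"
            by (simp only: powr_minus divide_inverse)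
          then show ?thesis unfolding Nr by (simp add: r_def mult.commute)
        qed
        have e1: "1 / N powr (z + of_real h) = N powr (- (1 + of_real h)) * w"
          unfolding w_def powr_add[symmetric] by (simp add: z_eq algebra_simps divide_inverse flip: powr_minus)
        have e2: "1 / N powr (z2 + of_real h) = N powr (- (1 + of_real h)) * w ^ 2"
          unfolding w_def power2_eq_square powr_add[symmetric] by (simp add: z2_def algebra_simps divide_inverse flip: powr_minus)
        have "T n = of_real r * (3 + 4 * (chi (Suc n) * w) + psi (Suc n) * w ^ 2)"
        proof -
          have "mangoldt (Suc n) * chi (Suc n) / N powr (z + of_real h) = mangoldt (Suc n) * chi (Suc n) * (1 / N powr (z + of_real h))"
            "mangoldt (Suc n) * psi (Suc n) / N powr (z2 + of_real h) = mangoldt (Suc n) * psi (Suc n) * (1 / N powr (z2 + of_real h))"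
            by simp_all
          then show ?thesis unfolding T_def N_def[symmetric] e0 e1 e2 Nr
            by (simp add: r_def algebra_simps)
        qed
        then have "Re (T n) = r * (3 + 4 * Re (chi (Suc n) * w) + Re (psi (Suc n) * w ^ 2))" by simp
        then show ?thesis using r pos[OF nw, of "Suc n"] by simp
      qed
      then have "Re (3 * P0 (1 + of_real h) + 4 * P1 (z + of_real h) + P2 (z2 + of_real h)) \<ge> 0"
        using TS by (intro sums_le[OF _ sums_zero TS]) auto
      then have "h * Re (3 * P0 (1 + of_real h) + 4 * P1 (z + of_real h) + P2 (z2 + of_real h)) \<ge> 0"
        using elim by (intro mult_nonneg_nonneg) auto
      then show ?case by (simp add: algebra_simps)
    qed
  qed auto
  \<comment> \<open>The limit of the nonnegative combination is 3 - 4 m1 - m2, and a positive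
    integer \<open>m1\<close> would make it negative.\<close>
  then have "4 * real m1 \<le> 3" by simp
  then have "m1 = 0" by linarith
  then show ?thesis using m1(2) by auto
qed

section \<open>The logarithmic derivative under GRH\<close>

text \<open>Borel-Caratheodory for the logarithm of \<open>f\<close>, followed by Cauchy's estimate for its derivative.\<close>
lemma log_derivative_bound:
  assumes f: "f holomorphic_on ball z0 R" "\<And>z. z \<in> ball z0 R \<Longrightarrow> f z \<noteq> 0"
    and M: "M > 0" "\<And>z. z \<in> ball z0 R \<Longrightarrow> norm (f z) < exp M * norm (f z0)"
    and z: "norm (z - z0) + \<rho> < R" "\<rho> > 0"
  shows "norm (deriv f z / f z) \<le> 2 * M * R / ((R - norm (z - z0) - \<rho>) * \<rho>)"
proof -
  have R: "R > 0" using z norm_ge_zero[of "z - z0"] by linarith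
  obtain g where g: "g holomorphic_on ball z0 R" "\<And>z. z \<in> ball z0 R \<Longrightarrow> exp (g z) = f z"
    using holomorphic_logarithm_exists[OF convex_ball open_ball f, of z0] R by auto
  define G where "G = (\<lambda>w. g (z0 + of_real R * w) - g z0)"
  have in_ball: "z0 + of_real R * w \<in> ball z0 R" if "norm w < 1" for w
    using that R by (simp add: dist_norm norm_mult)
  have "(g \<circ> (\<lambda>w. z0 + of_real R * w)) holomorphic_on ball 0 1"
    by (rule holomorphic_on_compose_gen[OF _ g(1)]) (use in_ball in \<open>auto intro!: holomorphic_intros\<close>)
  then have holG: "G holomorphic_on ball 0 1" unfolding G_def o_def by (intro holomorphic_intros)
  have ReG: "Re (G w) < M" if w: "norm w < 1" for w
  proof -
    have "norm (f (z0 + of_real R * w)) = exp (Re (G w)) * norm (f z0)"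
    proof -
      have "exp (G w) * exp (g z0) = exp (g (z0 + of_real R * w))" by (simp add: G_def flip: exp_add)
      then have "exp (G w) * f z0 = f (z0 + of_real R * w)" using g(2)[OF in_ball[OF w]] g(2)[of z0] R by simp
      from this[symmetric] show ?thesis by (simp add: norm_mult norm_exp_eq_Re)
    qed
    moreover have "norm (f z0) > 0" using f(2)[of z0] R by simp
    ultimately show ?thesis using M(2)[OF in_ball[OF w]] by simp
  qed
  \<comment> \<open>The Moebius map w / (2 M - w) takes the half-plane Re w < M into the unit disc
    and fixes 0, so that Schwarz' lemma applies to \<open>p\<close>.\<close>
  define p where "p = (\<lambda>w. G w / (2 * of_real M - G w))"
  have nz: "2 * of_real M - G w \<noteq> 0" if "norm w < 1" for w
  proof
    assume "2 * of_real M - G w = 0"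
    then have "Re (G w) = 2 * M" by (simp add: complex_eq_iff)
    then show False using ReG[OF that] M(1) by simp
  qed
  have np: "norm (p w) \<le> norm w" if w: "norm w < 1" for w
  proof (rule Schwarz_Lemma(1)[OF _ _ _ w])
    show "p holomorphic_on ball 0 1" unfolding p_def by (intro holomorphic_intros holG) (use nz in auto)
    show "p 0 = 0" by (simp add: p_def G_def)
    show "norm (p w) < 1" if "norm w < 1" for w
    proof -
      have "norm (2 * of_real M - G w) ^ 2 - norm (G w) ^ 2 = 4 * (M * (M - Re (G w)))"
        unfolding cmod_power2 by (simp add: power2_eq_square algebra_simps)
      moreover have "M * (M - Re (G w)) > 0" using ReG[OF that] M(1) by simp
      ultimately have "norm (G w) ^ 2 < norm (2 * of_real M - G w) ^ 2" by linarith
      then have "norm (G w) < norm (2 * of_real M - G w)" by (rule power2_less_imp_less) simp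
      then show ?thesis using nz[OF that] by (simp add: p_def norm_divide)
    qed
  qed
  have nG: "norm (G w) \<le> 2 * M / (1 - norm w)" if w: "norm w < 1" for w
  proof -
    have "G w * (1 + p w) = 2 * of_real M * p w" using nz[OF w] by (simp add: p_def field_simps)
    then have "norm (G w) * norm (1 + p w) = 2 * M * norm (p w)"
      using M(1) by (metis abs_of_pos norm_mult norm_numeral norm_of_real)
    also have "\<dots> \<le> 2 * M * 1" using np[OF w] w M(1) by (intro mult_left_mono) auto
    finally have 1: "norm (G w) * norm (1 + p w) \<le> 2 * M" by simp
    have "1 - norm w \<le> norm (1 + p w)" using np[OF w] norm_triangle_ineq2[of 1 "- p w"] by simp
    then have "norm (G w) * (1 - norm w) \<le> norm (G w) * norm (1 + p w)" by (intro mult_left_mono) auto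
    with 1 have "norm (G w) * (1 - norm w) \<le> 2 * M" by linarith
    then show ?thesis using w by (simp add: pos_le_divide_eq)
  qed
  define h where "h = (\<lambda>z. g z - g z0)"
  define r where "r = norm (z - z0) + \<rho>"
  have r: "r < R" "r > 0" using z norm_ge_zero[of "z - z0"] unfolding r_def by linarith+
  have nh: "norm (h u) \<le> 2 * M * R / (R - r)" if u: "norm (u - z0) \<le> r" for u
  proof -
    define w where "w = (u - z0) / of_real R"
    have nw: "norm w = norm (u - z0) / R" using R by (simp add: w_def norm_divide)
    have w1: "norm w < 1" using nw u r R by simp
    have "h u = G w" using R by (simp add: h_def G_def w_def)
    then have "norm (h u) \<le> 2 * M / (1 - norm w)" using nG[OF w1] by simp
    also have "\<dots> \<le> 2 * M / (1 - r / R)"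
      using M(1) u r R by (intro divide_left_mono mult_pos_pos) (auto simp: nw divide_right_mono)
    also have "\<dots> = 2 * M * R / (R - r)" using r R by (simp add: field_simps)
    finally show ?thesis .
  qed
  have sub: "cball z \<rho> \<subseteq> ball z0 R"
  proof
    fix u assume "u \<in> cball z \<rho>"
    then have "dist z0 u \<le> norm (z - z0) + \<rho>"
      using dist_triangle[of z0 u z] by (simp add: dist_norm norm_minus_commute)
    then show "u \<in> ball z0 R" using z by simp
  qed
  have holh: "h holomorphic_on ball z0 R" unfolding h_def by (intro holomorphic_intros g)
  have "norm ((deriv ^^ 1) h z) \<le> fact 1 * (2 * M * R / (R - r)) / \<rho> ^ 1"
  proof (rule Cauchy_inequality)
    show "h holomorphic_on ball z \<rho>" by (rule holomorphic_on_subset[OF holh]) (use sub ball_subset_cball in blast)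
    show "continuous_on (cball z \<rho>) h"
      by (rule holomorphic_on_imp_continuous_on[OF holomorphic_on_subset[OF holh sub]])
    show "norm (h x) \<le> 2 * M * R / (R - r)" if "norm (z - x) = \<rho>" for x
    proof (rule nh)
      have "x - z0 = (z - z0) - (z - x)" by simp
      then show "norm (x - z0) \<le> r" using norm_triangle_ineq4[of "z - z0" "z - x"] that by (simp add: r_def)
    qed
  qed (use z in auto)
  then have 1: "norm (deriv h z) \<le> 2 * M * R / (R - r) / \<rho>" by simp
  have "z \<in> cball z \<rho>" using z(2) by simp
  then have zb: "z \<in> ball z0 R" using sub by blast
  have dg: "(g has_field_derivative deriv g z) (at z)" by (rule holomorphic_derivI[OF g(1) open_ball zb])
  then have "((\<lambda>u. exp (g u)) has_field_derivative exp (g z) * deriv g z) (at z)" by (rule DERIV_chain2[OF DERIV_exp])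
  then have "(f has_field_derivative exp (g z) * deriv g z) (at z)"
    by (rule has_field_derivative_transform_within_open[OF _ open_ball zb]) (rule g(2))
  then have "deriv f z = f z * deriv g z" using g(2)[OF zb] by (simp add: DERIV_imp_deriv)
  moreover have "deriv h z = deriv g z" unfolding h_def using dg by (intro DERIV_imp_deriv) (auto intro!: derivative_eq_intros)
  ultimately have "deriv f z / f z = deriv h z" using f(2)[OF zb] by simp
  then show ?thesis using 1 by (simp add: r_def algebra_simps)
qed

lemma ln_le_2_sqrt: "x > 0 \<Longrightarrow> ln x \<le> 2 * sqrt x"
  using ln_le_minus_one[of "sqrt x"] by (simp add: ln_sqrt)

text \<open>The only place where the hypothesis GRH enters.\<close>
theorem GRH_log_derivative_bound:
  assumes "GRH"
  shows "\<exists>C\<ge>0. \<forall>q chi. dirichlet_character q chi \<longrightarrow> chi \<noteq> principal_character q \<longrightarrow>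
    (\<exists>F. F holomorphic_on {s. Re s > 1/2} \<and>
      (\<forall>s. Re s > 1 \<longrightarrow> (\<lambda>n. mangoldt (Suc n) * chi (Suc n) / of_nat (Suc n) powr s) sums F s) \<and>
      (\<forall>s. 52/100 \<le> Re s \<longrightarrow> Re s \<le> 2 \<longrightarrow> norm (F s) \<le> C * ln (2 * real q) * sqrt (1 + \<bar>Im s\<bar>)))"
proof -
  \<comment> \<open>The value zeta(3/2); it bounds the series in
    \<open>dirichlet_L_halfplane\<close> throughout Re s > 1/2.\<close>
  define K where "K = (\<Sum>n. real (Suc n) powr (- (1/2) - 1))"
  have sK: "summable (\<lambda>n. real (Suc n) powr (- (1/2) - 1))" using summable_powr_Suc[of "3/2" 1] by simp
  have K1: "K \<ge> 1"
    using sum_le_suminf[OF sK, of "{0}"] by (simp add: K_def)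
  \<comment> \<open>30000 = 2 * (3/2) / (1/100) ^ 2 comes from the geometry of the disc around
    \<open>z0\<close>; the bracket collects the bounds for the three logarithms that make up
    \<open>M\<close>.\<close>
  define C where "C = 30000 * (2 * ln (4 * K) + 9)"
  have C0: "C \<ge> 0" using K1 by (simp add: C_def)
  have "\<exists>F. F holomorphic_on {s. Re s > 1/2} \<and>
      (\<forall>s. Re s > 1 \<longrightarrow> (\<lambda>n. mangoldt (Suc n) * chi (Suc n) / of_nat (Suc n) powr s) sums F s) \<and>
      (\<forall>s. 52/100 \<le> Re s \<longrightarrow> Re s \<le> 2 \<longrightarrow> norm (F s) \<le> C * ln (2 * real q) * sqrt (1 + \<bar>Im s\<bar>))"
    if chi: "dirichlet_character q chi" "chi \<noteq> principal_character q" for q chi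
  proof -
    have q1: "real q \<ge> 1" using dc_pos[OF chi(1)] by simp
    obtain L where L: "L holomorphic_on UNIV"
      "\<And>s. Re s > 1 \<Longrightarrow> (\<lambda>n. chi (Suc n) * of_nat (Suc n) powr (-s)) sums L s"
      using null_periodic_entire[OF dc_null_periodic[OF chi]] by metis
    have Ls: "(\<lambda>n. chi (Suc n) / of_nat (Suc n) powr s) sums L s" if "Re s > 1" for s
      using L(2)[OF that] by (simp add: powr_minus divide_inverse del: of_nat_Suc)
    have isL: "is_dirichlet_L q chi L"
      using L(1) Ls chi(2) by (simp add: is_dirichlet_L_def)
    have cm: "cmult_bounded chi" by (rule dc_cmult_bounded[OF chi(1)])
    obtain D P where D: "\<And>s. Re s > 1 \<Longrightarrow> (\<lambda>n. chi (Suc n) / of_nat (Suc n) powr s) sums D s"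
      "\<And>s. Re s > 1 \<Longrightarrow> (\<lambda>n. mangoldt (Suc n) * chi (Suc n) / of_nat (Suc n) powr s) sums P s"
      "\<And>s. Re s > 1 \<Longrightarrow> D s \<noteq> 0" "\<And>s. Re s > 1 \<Longrightarrow> P s = - deriv D s / D s"
      using dirichlet_log_derivative[OF cm] by blast
    have LD: "L s = D s" if "Re s > 1" for s using sums_unique2[OF Ls[OF that] D(1)[OF that]] .
    have dLD: "deriv L s = deriv D s" if s: "Re s > 1" for s
      by (intro deriv_cong_ev eventually_nhds_in_open[OF open_halfspace_Re_gt, THEN eventually_mono])
         (use s LD in auto)
    have nz: "L s \<noteq> 0" if s: "Re s > 1/2" for s
    proof (cases "Re s" "1::real" rule: linorder_cases)
      case less
      show ?thesis
      proof
        assume "L s = 0"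
        then have "Re s = 1 / 2"
          using assms[unfolded GRH_def, rule_format, of q chi L s] chi(1) isL s less by simp
        then show False using s by simp
      qed
    next
      case equal
      show ?thesis by (rule L_nonzero_line_1[OF chi L(1) _ equal]) (rule Ls)
    next
      case greater
      then show ?thesis using D(3) LD by simp
    qed
    define F where "F = (\<lambda>s. - deriv L s / L s)"
    have "F holomorphic_on {s. Re s > 1/2}"
      unfolding F_def by (intro holomorphic_intros holomorphic_on_subset[OF L(1)] open_halfspace_Re_gt) (use nz in auto)
    moreover have "(\<lambda>n. mangoldt (Suc n) * chi (Suc n) / of_nat (Suc n) powr s) sums F s" if "Re s > 1" for s
      using D(2,4)[OF that] LD[OF that] dLD[OF that] by (simp add: F_def)
    moreover have "norm (F s) \<le> C * ln (2 * real q) * sqrt (1 + \<bar>Im s\<bar>)" if s: "52/100 \<le> Re s" "Re s \<le> 2" for s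
    proof -
      define t where "t = \<bar>Im s\<bar>"
      \<comment> \<open>The disc of radius 3/2 around this centre touches the line Re s = 1/2, so it
        is free of zeros. For Re s \<ge> 52/100 the point \<open>s\<close> has distance at most
        148/100 from the centre, which leaves 1/100 for the circle in Cauchy's estimate and another
        1/100 up to the boundary.\<close>
      define z0 where "z0 = Complex 2 (Im s)"
      \<comment> \<open>The logarithm of the ratio between K q (t + 4), which bounds
        \<open>L\<close> on the disc, and 1/4, the lower bound at the centre.\<close>
      define M where "M = ln (4 * K * real q * (t + 4))"
      have t0: "t \<ge> 0" by (simp add: t_def)
      have arg: "4 * K * real q * (t + 4) > 1"
      proof -
        have "1 * 1 < (4 * K) * (t + 4)" using K1 t0 by (intro mult_strict_mono) auto
        also have "\<dots> \<le> (4 * K) * (t + 4) * real q" using q1 K1 t0 mult_left_mono[OF q1, of "(4 * K) * (t + 4)"] by simp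
        finally show ?thesis by (simp add: mult_ac)
      qed
      then have M0: "M > 0" and eM: "exp M = 4 * K * real q * (t + 4)" by (auto simp: M_def)
      have z0s: "norm (s - z0) \<le> 148/100"
      proof -
        have "s - z0 = of_real (Re s - 2)" by (simp add: z0_def complex_eq_iff)
        then have "norm (s - z0) = \<bar>Re s - 2\<bar>" by (simp only: norm_of_real)
        then show ?thesis using s by simp
      qed
      have ballRe: "Re z > 1/2" if "z \<in> ball z0 (3/2)" for z
        using that abs_Re_le_cmod[of "z0 - z"] by (simp add: dist_norm z0_def)
      have L0: "norm (L z0) \<ge> 1/4"
        by (rule dirichlet_series_lower_bound[OF cm _ Ls]) (auto simp: z0_def)
      have "norm (deriv L s / L s) \<le> 2 * M * (3/2) / ((3/2 - norm (s - z0) - 1/100) * (1/100))"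
      proof (rule log_derivative_bound)
        show "L holomorphic_on ball z0 (3/2)" by (rule holomorphic_on_subset[OF L(1)]) simp
        show "L z \<noteq> 0" if "z \<in> ball z0 (3/2)" for z using nz ballRe[OF that] by blast
        show "norm (L z) < exp M * norm (L z0)" if z: "z \<in> ball z0 (3/2)" for z
        proof -
          have Re: "Re z > 1/2" by (rule ballRe[OF z])
          have "norm z0 \<le> 2 + t" using cmod_le[of z0] by (simp add: z0_def t_def)
          moreover have "norm z \<le> norm z0 + norm (z0 - z)" using norm_triangle_ineq4[of z0 "z0 - z"] by simp
          ultimately have nz4: "norm z < t + 4" using z by (simp add: dist_norm)
          have "norm (L z) \<le> real q * norm z * (\<Sum>n. real (Suc n) powr (- Re z - 1))"
            by (rule dirichlet_L_halfplane(2)[OF chi L(1) Ls]) (use Re in auto)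
          also have "(\<Sum>n. real (Suc n) powr (- Re z - 1)) \<le> K"
            unfolding K_def
          proof (rule suminf_le[OF _ _ sK])
            show "real (Suc n) powr (- Re z - 1) \<le> real (Suc n) powr (- (1/2) - 1)" for n
              using Re by (intro powr_mono) auto
            show "summable (\<lambda>n. real (Suc n) powr (- Re z - 1))"
            proof -
              have "- (Re z + 1) = - Re z - 1" by simp
              then show ?thesis using summable_powr_Suc[of "Re z + 1" 1] Re by simp
            qed
          qed
          finally have "norm (L z) \<le> real q * norm z * K" by (simp add: mult_left_mono)
          also have "\<dots> < real q * (t + 4) * K" using nz4 q1 K1 by simp
          also have "\<dots> = (4 * K * real q * (t + 4)) * (1/4)" by simp
          also have "\<dots> \<le> exp M * norm (L z0)" unfolding eM[symmetric] by (intro mult_left_mono L0) auto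
          finally show ?thesis .
        qed
      qed (use M0 z0s in auto)
      also have "\<dots> \<le> 2 * M * (3/2) / ((1/100) * (1/100))"
        using z0s M0 by (intro divide_left_mono mult_right_mono mult_pos_pos) auto
      also have "\<dots> = 30000 * M" by simp
      finally have 1: "norm (F s) \<le> 30000 * M" by (simp add: F_def norm_divide)
      define l where "l = ln (2 * real q)"
      define w where "w = sqrt (1 + t)"
      have "ln 2 \<le> ln (2 * real q)" using q1 by simp
      \<comment> \<open>The factor 2 in \<open>ln (2 * real q)\<close> keeps this logarithm away
        from 0, so that constants can be absorbed into it.\<close>
      then have l: "l \<ge> 1/2" using ln2_ge_two_thirds by (simp add: l_def)
      have w: "w \<ge> 1" using t0 by (simp add: w_def)
      have lw: "l \<le> l * w" "1 \<le> 2 * l * w" "w \<le> 2 * l * w"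
        using l w mult_mono[of "1/2" l 1 w] by (auto simp: mult_le_cancel_left1 mult_le_cancel_right1)
      have "M = ln (4 * K) + ln (real q) + ln (t + 4)"
        using K1 q1 t0 by (simp add: M_def ln_mult)
      also have "ln (4 * K) \<le> ln (4 * K) * (2 * l * w)" using lw K1 by (intro mult_le_cancel_left1[THEN iffD2]) auto
      also have "ln (real q) \<le> l * w" 
      proof -
        have "ln (real q) \<le> l" unfolding l_def using q1 by simp
        with lw(1) show ?thesis by linarith
      qed
      also have "ln (t + 4) \<le> 8 * (l * w)"
      proof -
        have "ln (t + 4) \<le> 2 * sqrt (t + 4)" using t0 by (intro ln_le_2_sqrt) auto
        also have "sqrt (t + 4) \<le> sqrt (4 * (1 + t))" using t0 by (intro real_sqrt_le_mono) auto
        also have "sqrt (4 * (1 + t)) = 2 * w" unfolding real_sqrt_mult by (simp add: w_def)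
        finally show ?thesis using lw by simp
      qed
      finally have "M \<le> (2 * ln (4 * K) + 9) * (l * w)" by (simp add: algebra_simps)
      then have "30000 * M \<le> 30000 * ((2 * ln (4 * K) + 9) * (l * w))" by (intro mult_left_mono) auto
      then have "30000 * M \<le> C * (l * w)" by (simp only: C_def mult.assoc)
      with 1 show ?thesis by (simp add: l_def w_def t_def mult.assoc)
    qed
    ultimately show ?thesis by blast
  qed
  with C0 show ?thesis by blast
qed

corollary GRH_riesz_mean_bound:
  assumes "GRH"
  shows "\<exists>C\<ge>0. \<forall>q chi x. dirichlet_character q chi \<longrightarrow> chi \<noteq> principal_character q \<longrightarrow> x \<ge> 1 \<longrightarrow>
    norm (\<Sum>n | 0 < n \<and> real n \<le> x. mangoldt n * chi n * of_real (1 - real n / x)) \<le> C * ln (2 * real q) * x powr (52/100)"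
proof -
  obtain C where C: "C \<ge> 0" "\<And>q chi. dirichlet_character q chi \<Longrightarrow> chi \<noteq> principal_character q \<Longrightarrow>
    \<exists>F. F holomorphic_on {s. Re s > 1/2} \<and>
      (\<forall>s. Re s > 1 \<longrightarrow> (\<lambda>n. mangoldt (Suc n) * chi (Suc n) / of_nat (Suc n) powr s) sums F s) \<and>
      (\<forall>s. 52/100 \<le> Re s \<longrightarrow> Re s \<le> 2 \<longrightarrow> norm (F s) \<le> C * ln (2 * real q) * sqrt (1 + \<bar>Im s\<bar>))"
    using GRH_log_derivative_bound[OF assms] by blast
  have bnd: "norm (\<Sum>n | 0 < n \<and> real n \<le> x. mangoldt n * chi n * of_real (1 - real n / x)) \<le> (4 * C) * ln (2 * real q) * x powr (52/100)"
    if chi: "dirichlet_character q chi" "chi \<noteq> principal_character q" and x: "x \<ge> 1" for q chi x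
  proof -
    obtain F where F: "F holomorphic_on {s. Re s > 1/2}"
      "\<And>s. Re s > 1 \<Longrightarrow> (\<lambda>n. mangoldt (Suc n) * chi (Suc n) / of_nat (Suc n) powr s) sums F s"
      "\<And>s. 52/100 \<le> Re s \<Longrightarrow> Re s \<le> 2 \<Longrightarrow> norm (F s) \<le> C * ln (2 * real q) * sqrt (1 + \<bar>Im s\<bar>)"
      using C(2)[OF chi] by blast
    have "summable (\<lambda>n. norm (mangoldt (Suc n) * chi (Suc n) / of_nat (Suc n) powr 2))"
      by (rule dirichlet_series_abs_summable[OF norm_mangoldt_mult_le[OF dc_cmult_bounded[OF chi(1)]]]) simp
    then have summ: "summable (\<lambda>n. norm (mangoldt (Suc n) * chi (Suc n)) / real (Suc n) ^ 2)"
      unfolding norm_dirichlet_term by (simp add: powr_minus divide_inverse del: of_nat_Suc)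
    have "ln (2 * real q) \<ge> 0" using dc_pos[OF chi(1)] by (intro ln_ge_zero) auto
    then have "norm (\<Sum>n | 0 < n \<and> real n \<le> x. mangoldt n * chi n * of_real (1 - real n / x)) \<le> 4 * (C * ln (2 * real q)) * x powr (52/100)"
      using C(1) by (intro riesz_mean_bound[OF F(1) _ summ _ _ _ F(3) x] F(2)) auto
    then show ?thesis by (simp add: mult.assoc)
  qed
  show ?thesis by (intro exI[of _ "4 * C"] conjI allI impI bnd) (use C(1) in auto)
qed

section \<open>Primes in residue classes\<close>

text \<open>Comparing two reduced classes, rather than one class with the mean over all of them, makes the
  principal character drop out.\<close>
lemma mangoldt_residue_difference:
  fixes R :: real
  assumes q: "q > 0" and R: "R \<ge> 0"
    and riesz: "\<And>chi x. dirichlet_character q chi \<Longrightarrow> chi \<noteq> principal_character q \<Longrightarrow> 1 \<le> x \<Longrightarrow> x \<le> 2 * X \<Longrightarrow>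
      norm (\<Sum>n | 0 < n \<and> real n \<le> x. mangoldt n * chi n * of_real (1 - real n / x)) \<le> R"
    and b: "coprime b q" "coprime b' q"
    and h: "h > 0" "real h \<le> X" and m: "real m \<le> X"
  defines "f \<equiv> \<lambda>n. of_bool [n = b] (mod q) - of_bool [n = b'] (mod q) :: real"
  shows "\<bar>\<Sum>n\<in>{1..m}. mangoldt n * f n\<bar> \<le> 8 * X * R / real h + 2 * (real h / real q + 1) * ln (2 * X)"
proof -
  have X1: "X \<ge> 1" using h by linarith
  obtain c where c: "[b * c = 1] (mod q)" using cong_solve_coprime_nat[OF b(1)] by auto
  obtain c' where c': "[b' * c' = 1] (mod q)" using cong_solve_coprime_nat[OF b(2)] by auto
  have cop: "coprime c q" "coprime c' q"
    using c c' by (metis cong_imp_coprime cong_sym coprime_1_left coprime_mult_left_iff)+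
  define N where "N = card (dcharacters q)"
  have N0: "N > 0" unfolding N_def card_gt_0_iff
    using finite_dcharacters[OF q] dc_principal[OF q] by (auto simp: dcharacters_def)
  have flip: "[n * c = 1] (mod q) \<longleftrightarrow> [n = b] (mod q)" if "[b * c = 1] (mod q)" for n b c
  proof
    assume "[n * c = 1] (mod q)"
    then have "[n * c * b = 1 * b] (mod q)" by (intro cong_mult) auto
    moreover have "[n * (b * c) = n * 1] (mod q)" using that by (intro cong_mult) auto
    ultimately show "[n = b] (mod q)" by (simp add: mult_ac) (metis cong_sym cong_trans)
  next
    assume "[n = b] (mod q)"
    then have "[n * c = b * c] (mod q)" by (intro cong_mult) auto
    then show "[n * c = 1] (mod q)" using that by (metis cong_trans)
  qed
  have ind: "of_nat N * of_bool [n = b] (mod q) = (\<Sum>chi\<in>dcharacters q. chi (n * c))" if "[b * c = 1] (mod q)" for n b c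
    unfolding sum_dcharacters[OF q] flip[OF that] by (simp add: N_def)
  \<comment> \<open>\<open>c\<close> and \<open>c'\<close> invert \<open>b\<close> and
    \<open>b'\<close>, so orthogonality detects the two classes. The principal character takes the
    value 1 at both inverses and drops out.\<close>
  have f_eq: "of_nat N * of_real (f n) = (\<Sum>chi\<in>dcharacters q - {principal_character q}. (chi c - chi c') * chi n)" for n
  proof -
    have "of_nat N * of_real (f n) = (\<Sum>chi\<in>dcharacters q. chi (n * c) - chi (n * c'))"
      unfolding sum_subtractf ind[OF c, symmetric] ind[OF c', symmetric] by (simp add: f_def right_diff_distrib)
    also have "\<dots> = (\<Sum>chi\<in>dcharacters q. (chi c - chi c') * chi n)"
      by (intro sum.cong refl) (simp add: dcharacters_def dc_mult algebra_simps)
    also have "\<dots> = (\<Sum>chi\<in>dcharacters q - {principal_character q}. (chi c - chi c') * chi n)"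
      using finite_dcharacters[OF q] cop by (intro sum.mono_neutral_right) (auto simp: principal_character_def)
    finally show ?thesis .
  qed
  \<comment> \<open>This is \<open>x\<close> times the Riesz mean. Its increment from
    \<open>m\<close> to \<open>m + h\<close> is \<open>h\<close> times the unweighted sum up to
    \<open>m\<close>, apart from the terms between \<open>m\<close> and \<open>m + h\<close>, which
    are estimated trivially.\<close>
  define W where "W = (\<lambda>x. \<Sum>n\<in>{1..x}. mangoldt n * f n * (real x - real n))"
  have W: "\<bar>W x\<bar> \<le> real x * (2 * R)" if x: "real x \<le> 2 * X" for x :: nat
  proof (cases "x = 0")
    case True
    then show ?thesis by (simp add: W_def)
  next
    case False
    have set: "{n. 0 < n \<and> real n \<le> real x} = {1..x}" by auto
    have "of_nat N * of_real (W x) = (\<Sum>n\<in>{1..x}. \<Sum>chi\<in>dcharacters q - {principal_character q}. mangoldt n * ((chi c - chi c') * chi n) * of_real (real x - real n))"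
      unfolding W_def of_real_sum sum_distrib_left
    proof (rule sum.cong[OF refl])
      fix n
      have "of_nat N * of_real (mangoldt n * f n * (real x - real n)) = (mangoldt n * (of_nat N * of_real (f n)) * of_real (real x - real n) :: complex)"
        by (simp add: mult_ac)
      also have "\<dots> = (\<Sum>chi\<in>dcharacters q - {principal_character q}. mangoldt n * ((chi c - chi c') * chi n) * of_real (real x - real n))"
        unfolding f_eq sum_distrib_left sum_distrib_right ..
      finally show "of_nat N * of_real (mangoldt n * f n * (real x - real n)) = (\<Sum>chi\<in>dcharacters q - {principal_character q}. mangoldt n * ((chi c - chi c') * chi n) * of_real (real x - real n))" .
    qed
    also have "\<dots> = (\<Sum>chi\<in>dcharacters q - {principal_character q}. (chi c - chi c') * of_nat x * (\<Sum>n\<in>{1..x}. mangoldt n * chi n * of_real (1 - real n / real x)))"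
      unfolding sum_distrib_left
    proof (subst sum.swap, intro sum.cong refl)
      fix chi :: "nat \<Rightarrow> complex" and n
      have "of_real (real x - real n) = of_nat x * (of_real (1 - real n / real x) :: complex)"
        using False by (simp add: field_simps)
      then show "mangoldt n * ((chi c - chi c') * chi n) * of_real (real x - real n) =
          (chi c - chi c') * of_nat x * (mangoldt n * chi n * of_real (1 - real n / real x))" by (simp add: mult_ac)
    qed
    also have "norm \<dots> \<le> (\<Sum>chi\<in>dcharacters q - {principal_character q}. 2 * real x * R)"
    proof (rule sum_norm_le)
      fix chi assume "chi \<in> dcharacters q - {principal_character q}"
      then have chi: "dirichlet_character q chi" "chi \<noteq> principal_character q" by (auto simp: dcharacters_def)
      have "norm (chi c - chi c') \<le> 2"
        using norm_triangle_ineq4[of "chi c" "chi c'"] dc_norm_le_1[OF chi(1), of c] dc_norm_le_1[OF chi(1), of c'] by linarith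
      moreover have "norm (\<Sum>n\<in>{1..x}. mangoldt n * chi n * of_real (1 - real n / real x)) \<le> R"
        using riesz[OF chi, of "real x"] x False unfolding set by simp
      ultimately show "norm ((chi c - chi c') * of_nat x * (\<Sum>n\<in>{1..x}. mangoldt n * chi n * of_real (1 - real n / real x))) \<le> 2 * real x * R"
        unfolding norm_mult norm_of_nat by (intro mult_mono) auto
    qed
    also have "\<dots> = real (card (dcharacters q - {principal_character q})) * (2 * real x * R)" by simp
    also have "\<dots> \<le> real N * (2 * real x * R)"
      unfolding N_def using R finite_dcharacters[OF q]
      by (intro mult_right_mono) (auto intro!: card_mono)
    finally have "real N * \<bar>W x\<bar> \<le> real N * (2 * real x * R)" by (simp add: norm_mult)
    then show ?thesis using N0 by simp
  qed
  have m2: "real (m + h) \<le> 2 * X" using m h by simp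
  have split: "{1..m + h} = {1..m} \<union> {m<..m + h}" "{1..m} \<inter> {m<..m + h} = {}" by auto
  have diff: "W (m + h) - W m = real h * (\<Sum>n\<in>{1..m}. mangoldt n * f n) + (\<Sum>n\<in>{m<..m + h}. mangoldt n * f n * (real (m + h) - real n))"
  proof -
    have "W (m + h) = (\<Sum>n\<in>{1..m}. mangoldt n * f n * (real (m + h) - real n)) + (\<Sum>n\<in>{m<..m + h}. mangoldt n * f n * (real (m + h) - real n))"
      unfolding W_def split(1) by (rule sum.union_disjoint) (use split(2) in auto)
    moreover have "(\<Sum>n\<in>{1..m}. mangoldt n * f n * (real (m + h) - real n)) - W m = real h * (\<Sum>n\<in>{1..m}. mangoldt n * f n)"
      unfolding W_def sum_subtractf[symmetric] sum_distrib_left by (intro sum.cong refl) (simp add: algebra_simps)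
    ultimately show ?thesis by linarith
  qed
  have count: "real (card {n\<in>{m<..m + h}. [n = b] (mod q)}) \<le> real h / real q + 1" for b
  proof -
    define A where "A = {n\<in>{m<..m + h}. [n = b] (mod q)}"
    have inj: "inj_on (\<lambda>n. (n - m - 1) div q) A"
    proof (rule inj_onI)
      fix u v assume uv: "u \<in> A" "v \<in> A" "(u - m - 1) div q = (v - m - 1) div q"
      then have "[u = v] (mod q)" by (auto simp: A_def intro: cong_trans cong_sym)
      moreover have "u = (u - m - 1) + (m + 1)" "v = (v - m - 1) + (m + 1)" using uv by (auto simp: A_def)
      ultimately have "[u - m - 1 = v - m - 1] (mod q)" by (metis cong_add_rcancel_nat)
      then have "u - m - 1 = v - m - 1" using uv(3) unfolding cong_def by (metis div_mult_mod_eq)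
      then show "u = v" using uv by (auto simp: A_def)
    qed
    have "(\<lambda>n. (n - m - 1) div q) ` A \<subseteq> {..h div q}" by (auto simp: A_def intro!: div_le_mono)
    then have "card A \<le> card {..h div q}" by (intro card_inj_on_le[OF inj]) auto
    then have "real (card A) \<le> real (h div q) + 1" by simp
    also have "real (h div q) \<le> real h / real q" by (rule of_nat_div_le_of_nat)
    finally show ?thesis by (simp add: A_def)
  qed
  define E where "E = (\<Sum>n\<in>{m<..m + h}. mangoldt n * f n * (real (m + h) - real n))"
  have "\<bar>E\<bar> \<le> (\<Sum>n\<in>{m<..m + h}. ln (2 * X) * (of_bool [n = b] (mod q) + of_bool [n = b'] (mod q)) * real h)"
    unfolding E_def
  proof (rule order_trans[OF sum_abs], rule sum_mono)
    fix n assume n: "n \<in> {m<..m + h}"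
    have "mangoldt n \<le> ln (real n)" using n by (intro mangoldt_le) auto
    also have "\<dots> \<le> ln (2 * X)" using n m2 by (intro ln_mono) auto
    finally have 1: "mangoldt n \<le> ln (2 * X)" .
    have 2: "\<bar>f n\<bar> \<le> of_bool [n = b] (mod q) + of_bool [n = b'] (mod q)" by (simp add: f_def)
    have 3: "\<bar>real (m + h) - real n\<bar> \<le> real h" using n by auto
    have "\<bar>mangoldt n * f n * (real (m + h) - real n)\<bar> = mangoldt n * \<bar>f n\<bar> * \<bar>real (m + h) - real n\<bar>"
      by (simp add: abs_mult)
    also have "\<dots> \<le> ln (2 * X) * (of_bool [n = b] (mod q) + of_bool [n = b'] (mod q)) * real h"
      using 1 2 3 mangoldt_nonneg[of n] by (intro mult_mono mult_nonneg_nonneg) (auto intro: order_trans[OF mangoldt_nonneg])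
    finally show "\<bar>mangoldt n * f n * (real (m + h) - real n)\<bar> \<le> ln (2 * X) * (of_bool [n = b] (mod q) + of_bool [n = b'] (mod q)) * real h" .
  qed
  also have "\<dots> = real h * ln (2 * X) * (real (card {n\<in>{m<..m + h}. [n = b] (mod q)}) + real (card {n\<in>{m<..m + h}. [n = b'] (mod q)}))"
  proof -
    have s: "(\<Sum>n\<in>{m<..m + h}. of_bool [n = b] (mod q)) = real (card {n\<in>{m<..m + h}. [n = b] (mod q)})" for b
      by (simp add: of_bool_def sum.If_cases Int_def)
    show ?thesis unfolding s[symmetric] sum.distrib[symmetric] sum_distrib_left by (intro sum.cong refl) (simp add: mult_ac)
  qed
  also have "\<dots> \<le> real h * ln (2 * X) * ((real h / real q + 1) + (real h / real q + 1))"
    using X1 by (intro mult_left_mono add_mono count) auto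
  finally have E: "\<bar>E\<bar> \<le> real h * (2 * (real h / real q + 1) * ln (2 * X))" by (simp add: algebra_simps)
  have "real h * \<bar>\<Sum>n\<in>{1..m}. mangoldt n * f n\<bar> = \<bar>W (m + h) - W m - E\<bar>" using diff by (simp add: E_def abs_mult)
  also have "\<dots> \<le> \<bar>W (m + h)\<bar> + \<bar>W m\<bar> + \<bar>E\<bar>" by linarith
  also have "\<dots> \<le> 8 * X * R + real h * (2 * (real h / real q + 1) * ln (2 * X))"
  proof -
    have "\<bar>W (m + h)\<bar> \<le> (2 * X) * (2 * R)" using W[OF m2] m2 R by (meson mult_right_mono order_trans mult_nonneg_nonneg zero_le_numeral)
    moreover have "\<bar>W m\<bar> \<le> (2 * X) * (2 * R)"
    proof -
      have "real m \<le> 2 * X" using m X1 by linarith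
      then show ?thesis using W[of m] R by (meson mult_right_mono order_trans mult_nonneg_nonneg zero_le_numeral)
    qed
    ultimately show ?thesis using E by linarith
  qed
  finally have "real h * \<bar>\<Sum>n\<in>{1..m}. mangoldt n * f n\<bar> \<le> 8 * X * R + real h * (2 * (real h / real q + 1) * ln (2 * X))" .
  then have "\<bar>\<Sum>n\<in>{1..m}. mangoldt n * f n\<bar> \<le> (8 * X * R + real h * (2 * (real h / real q + 1) * ln (2 * X))) / real h"
    using h(1) by (simp add: pos_le_divide_eq mult.commute)
  also have "\<dots> = 8 * X * R / real h + 2 * (real h / real q + 1) * ln (2 * X)"
    using h(1) by (simp add: add_divide_distrib)
  finally show ?thesis .
qed

text \<open>What remains are the proper prime powers: at most sqrt m bases and log 2 m exponents,
  each \<open>+ 1\<close> allowing for the index 0, and each power weighted by at most ln m.\<close>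

lemma sum_mangoldt_nonprime:
  assumes "\<And>n. \<bar>f n\<bar> \<le> (1::real)" "m \<ge> 1"
  shows "\<bar>(\<Sum>n\<in>{1..m}. mangoldt n * f n) - (\<Sum>p | prime p \<and> p \<le> m. ln (real p) * f p)\<bar>
    \<le> (sqrt (real m) + 1) * (log 2 (real m) + 1) * ln (real m)"
proof -
  define A where "A = {n\<in>{1..m}. primepow n \<and> \<not> prime n}"
  have lm: "ln (real m) \<ge> 0" using assms(2) by simp
  have "(\<Sum>n\<in>{1..m}. mangoldt n * f n) = (\<Sum>n\<in>A \<union> {p. prime p \<and> p \<le> m}. mangoldt n * f n)"
    by (rule sum.mono_neutral_right) (auto simp: A_def mangoldt_def prime_gt_0_nat Suc_le_eq)
  also have "\<dots> = (\<Sum>n\<in>A. mangoldt n * f n) + (\<Sum>p | prime p \<and> p \<le> m. mangoldt p * f p)"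
    by (rule sum.union_disjoint) (auto simp: A_def)
  also have "(\<Sum>p | prime p \<and> p \<le> m. mangoldt p * f p) = (\<Sum>p | prime p \<and> p \<le> m. ln (real p) * f p)"
    by (intro sum.cong) auto
  finally have "\<bar>(\<Sum>n\<in>{1..m}. mangoldt n * f n) - (\<Sum>p | prime p \<and> p \<le> m. ln (real p) * f p)\<bar> = \<bar>\<Sum>n\<in>A. mangoldt n * f n\<bar>" by simp
  also have "\<dots> \<le> (\<Sum>n\<in>A. ln (real m))"
  proof (rule order_trans[OF sum_abs], rule sum_mono)
    fix n assume n: "n \<in> A"
    have "mangoldt n \<le> ln (real n)" using n by (intro mangoldt_le) (auto simp: A_def)
    also have "\<dots> \<le> ln (real m)" using n by (intro ln_mono) (auto simp: A_def)
    finally have "mangoldt n * \<bar>f n\<bar> \<le> ln (real m) * 1" using assms(1)[of n] lm by (intro mult_mono) auto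
    then show "\<bar>mangoldt n * f n\<bar> \<le> ln (real m)" by (simp add: abs_mult)
  qed
  also have "\<dots> = real (card A) * ln (real m)" by simp
  also have "\<dots> \<le> (sqrt (real m) + 1) * (log 2 (real m) + 1) * ln (real m)"
  proof (rule mult_right_mono[OF _ lm])
    have "A \<subseteq> (\<lambda>(p, k). p ^ k) ` ({..nat \<lfloor>sqrt (real m)\<rfloor>} \<times> {..nat \<lfloor>log 2 (real m)\<rfloor>})"
    proof
      fix n assume n: "n \<in> A"
      then obtain p k where pk: "prime p" "k > 0" "n = p ^ k" by (auto simp: A_def primepow_def)
      then have "k \<noteq> 1" using n by (auto simp: A_def)
      then have k2: "k \<ge> 2" using pk by linarith
      have p2: "p \<ge> 2" using pk(1) by (rule prime_ge_2_nat)
      have nm: "p ^ k \<le> m" using n pk by (simp add: A_def)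
      have "p ^ 2 \<le> p ^ k" using k2 p2 by (intro power_increasing) auto
      then have "real (p ^ 2) \<le> real m" using nm by (intro of_nat_mono) linarith
      then have "real p \<le> sqrt (real m)" by (intro real_le_rsqrt) simp
      then have 1: "p \<le> nat \<lfloor>sqrt (real m)\<rfloor>" by (simp add: le_nat_floor)
      have "2 ^ k \<le> p ^ k" using p2 by (intro power_mono) auto
      then have "real (2 ^ k) \<le> real m" using nm by (intro of_nat_mono) linarith
      then have "real k \<le> log 2 (real m)" using assms(2) by (simp add: le_log_iff powr_realpow)
      then have 2: "k \<le> nat \<lfloor>log 2 (real m)\<rfloor>" by (simp add: le_nat_floor)
      show "n \<in> (\<lambda>(p, k). p ^ k) ` ({..nat \<lfloor>sqrt (real m)\<rfloor>} \<times> {..nat \<lfloor>log 2 (real m)\<rfloor>})"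
        using 1 2 pk(3) by force
    qed
    then have "card A \<le> card ((\<lambda>(p, k). p ^ k) ` ({..nat \<lfloor>sqrt (real m)\<rfloor>} \<times> {..nat \<lfloor>log 2 (real m)\<rfloor>}))"
      by (intro card_mono) auto
    also have "\<dots> \<le> card ({..nat \<lfloor>sqrt (real m)\<rfloor>} \<times> {..nat \<lfloor>log 2 (real m)\<rfloor>})" by (intro card_image_le) auto
    also have "\<dots> = (nat \<lfloor>sqrt (real m)\<rfloor> + 1) * (nat \<lfloor>log 2 (real m)\<rfloor> + 1)" by simp
    finally have "real (card A) \<le> real ((nat \<lfloor>sqrt (real m)\<rfloor> + 1) * (nat \<lfloor>log 2 (real m)\<rfloor> + 1))"
      by (rule of_nat_mono)
    then have "real (card A) \<le> (real (nat \<lfloor>sqrt (real m)\<rfloor>) + 1) * (real (nat \<lfloor>log 2 (real m)\<rfloor>) + 1)"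
      by (simp add: algebra_simps)
    also have "\<dots> \<le> (sqrt (real m) + 1) * (log 2 (real m) + 1)"
      using assms(2) by (intro mult_mono add_mono) (auto simp: of_nat_nat)
    finally show "real (card A) \<le> (sqrt (real m) + 1) * (log 2 (real m) + 1)" .
  qed
  finally show ?thesis .
qed

text \<open>Partial summation against the decreasing weight 1 / ln n. Its total variation telescopes
  and the contributions at \<open>M\<close> cancel, so that only the value at \<open>z\<close>
  survives.\<close>

lemma prime_sum_abel:
  fixes f :: "nat \<Rightarrow> real"
  assumes B: "\<And>m. m \<le> M \<Longrightarrow> \<bar>\<Sum>p | prime p \<and> p \<le> m. ln (real p) * f p\<bar> \<le> B" and z: "z \<ge> 2"
  shows "\<bar>\<Sum>p | prime p \<and> z \<le> p \<and> p \<le> M. f p\<bar> \<le> 2 * B / ln (real z)"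
proof (cases "z \<le> M")
  case False
  then have "{p. prime p \<and> z \<le> p \<and> p \<le> M} = {}" by auto
  then have "(\<Sum>p | prime p \<and> z \<le> p \<and> p \<le> M. f p) = 0" by (simp only: sum.empty)
  moreover have "B \<ge> 0" using order_trans[OF abs_ge_zero B[of 0]] by simp
  ultimately show ?thesis using z by simp
next
  case True
  define S where "S = (\<lambda>m. \<Sum>p | prime p \<and> p \<le> m. ln (real p) * f p)"
  define g where "g = (\<lambda>n. if prime n then ln (real n) * f n else 0)"
  have lz: "ln (real z) > 0" using z by simp
  have S: "S m = (\<Sum>n\<in>{..m}. g n)" for m
    unfolding S_def g_def by (simp add: sum.If_cases Int_def conj_commute)
  have B0: "B \<ge> 0" using order_trans[OF abs_ge_zero B[of 0]] by simp
  have eq: "(\<Sum>p | prime p \<and> z \<le> p \<and> p \<le> z + d. f p) =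
      S (z + d) / ln (real (z + d)) - S (z - 1) / ln (real z) + (\<Sum>i<d. S (z + i) * (1 / ln (real (z + i)) - 1 / ln (real (z + Suc i))))" for d
  proof (induction d)
    case 0
    have "S z = S (z - 1) + g z" unfolding S using z by (cases z) auto
    then have "S z / ln (real z) - S (z - 1) / ln (real z) = g z / ln (real z)" by (simp add: add_divide_distrib)
    moreover have "{p. prime p \<and> z \<le> p \<and> p \<le> z} = (if prime z then {z} else {})" by auto
    ultimately show ?case using lz by (simp add: g_def)
  next
    case (Suc d)
    have l: "ln (real (z + Suc d)) > 0" using z by simp
    have set: "{p. prime p \<and> z \<le> p \<and> p \<le> z + Suc d} = {p. prime p \<and> z \<le> p \<and> p \<le> z + d} \<union> (if prime (z + Suc d) then {z + Suc d} else {})"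
      by (auto simp: le_Suc_eq)
    have "(\<Sum>p | prime p \<and> z \<le> p \<and> p \<le> z + Suc d. f p) = (\<Sum>p | prime p \<and> z \<le> p \<and> p \<le> z + d. f p) + (if prime (z + Suc d) then f (z + Suc d) else 0)"
      unfolding set by (subst sum.union_disjoint) auto
    also have "(if prime (z + Suc d) then f (z + Suc d) else 0) = g (z + Suc d) / ln (real (z + Suc d))"
      using l by (simp add: g_def)
    also have "g (z + Suc d) = S (z + Suc d) - S (z + d)" by (simp add: S)
    finally show ?case unfolding Suc.IH sum.lessThan_Suc by (simp only: right_diff_distrib diff_divide_distrib) simp
  qed
  define D where "D = M - z"
  have M: "M = z + D" using True by (simp add: D_def)
  have SB: "\<bar>S m\<bar> \<le> B" if "m \<le> M" for m using B[OF that] by (simp add: S_def)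
  have anti: "1 / ln (real (z + Suc i)) \<le> 1 / ln (real (z + i))" for i
    using z by (intro divide_left_mono) auto
  have "\<bar>\<Sum>i<D. S (z + i) * (1 / ln (real (z + i)) - 1 / ln (real (z + Suc i)))\<bar> \<le> (\<Sum>i<D. B * (1 / ln (real (z + i)) - 1 / ln (real (z + Suc i))))"
  proof (rule order_trans[OF sum_abs], rule sum_mono)
    fix i assume "i \<in> {..<D}"
    then have "\<bar>S (z + i)\<bar> \<le> B" by (intro SB) (auto simp: M)
    then show "\<bar>S (z + i) * (1 / ln (real (z + i)) - 1 / ln (real (z + Suc i)))\<bar> \<le> B * (1 / ln (real (z + i)) - 1 / ln (real (z + Suc i)))"
      unfolding abs_mult using anti[of i] by (intro mult_mono) auto
  qed
  also have "\<dots> = B * (1 / ln (real (z + 0)) - 1 / ln (real (z + D)))"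
    unfolding sum_distrib_left[symmetric] by (subst sum_lessThan_telescope') simp
  finally have 1: "\<bar>\<Sum>i<D. S (z + i) * (1 / ln (real (z + i)) - 1 / ln (real (z + Suc i)))\<bar> \<le> B / ln (real z) - B / ln (real M)"
    by (simp add: M right_diff_distrib)
  have lM: "ln (real M) > 0" using z True by simp
  have 2: "\<bar>S M / ln (real M)\<bar> \<le> B / ln (real M)" using SB[of M] lM by (simp add: abs_divide divide_right_mono)
  have 3: "\<bar>S (z - 1) / ln (real z)\<bar> \<le> B / ln (real z)" using SB[of "z - 1"] lz True by (simp add: abs_divide divide_right_mono)
  have "(\<Sum>p | prime p \<and> z \<le> p \<and> p \<le> M. f p) =
      S M / ln (real M) - S (z - 1) / ln (real z) + (\<Sum>i<D. S (z + i) * (1 / ln (real (z + i)) - 1 / ln (real (z + Suc i))))"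
    using eq[of D] by (simp only: M)
  then have "\<bar>\<Sum>p | prime p \<and> z \<le> p \<and> p \<le> M. f p\<bar> \<le> B / ln (real M) + B / ln (real z) + (B / ln (real z) - B / ln (real M))"
    using 1 2 3 by linarith
  then show ?thesis by simp
qed

section \<open>Chebyshev's lower bound\<close>

lemma ln_fact_eq_sum_mangoldt: "ln (fact N) = (\<Sum>n\<in>{1..N}. mangoldt n * real (N div n))"
proof -
  have "ln (fact N :: real) = (\<Sum>k\<in>{1..N}. ln (real k))"
    by (induction N) (auto simp: ln_mult)
  also have "\<dots> = (\<Sum>k\<in>{1..N}. \<Sum>d\<in>{1..N}. if d dvd k then mangoldt d else 0)"
  proof (rule sum.cong[OF refl])
    fix k assume k: "k \<in> {1..N}"
    have "ln (real k) = (\<Sum>d | d dvd k. mangoldt d)" using k mangoldt_sum[of k, where ?'a=real] by simp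
    also have "{d. d dvd k} = {d\<in>{1..N}. d dvd k}" using k by (auto intro: dvd_pos_nat order_trans[OF dvd_imp_le] simp: Suc_le_eq)
    also have "(\<Sum>d\<in>{d\<in>{1..N}. d dvd k}. mangoldt d) = (\<Sum>d\<in>{1..N}. if d dvd k then mangoldt d else (0::real))"
      by (rule sum.inter_filter) simp
    finally show "ln (real k) = (\<Sum>d\<in>{1..N}. if d dvd k then mangoldt d else 0)" .
  qed
  also have "\<dots> = (\<Sum>d\<in>{1..N}. \<Sum>k\<in>{1..N}. if d dvd k then mangoldt d else 0)" by (rule sum.swap)
  also have "\<dots> = (\<Sum>d\<in>{1..N}. mangoldt d * real (N div d))"
  proof (rule sum.cong[OF refl])
    fix d assume d: "d \<in> {1..N}"
    have inj: "inj_on ((*) d) {1..N div d}" using d by (auto intro: inj_onI)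
    have "{k\<in>{1..N}. d dvd k} = (*) d ` {1..N div d}"
    proof (intro equalityI subsetI)
      fix k assume "k \<in> {k\<in>{1..N}. d dvd k}"
      then obtain j where j: "k = d * j" "1 \<le> k" "k \<le> N" by (auto elim: dvdE)
      then have "j \<le> N div d" "1 \<le> j" using d by (auto simp: less_eq_div_iff_mult_less_eq mult.commute intro: Nat.gr0I simp: Suc_le_eq)
      then show "k \<in> (*) d ` {1..N div d}" using j(1) by auto
    next
      fix k assume "k \<in> (*) d ` {1..N div d}"
      then obtain j where j: "k = d * j" "j \<in> {1..N div d}" by blast
      then have j: "k = d * j" "1 \<le> j" "j \<le> N div d" by simp_all
      then have "k \<le> N" using d by (simp add: less_eq_div_iff_mult_less_eq mult.commute)
      moreover have "k \<ge> 1" using j d by (simp add: Suc_le_eq)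
      ultimately show "k \<in> {k\<in>{1..N}. d dvd k}" using j(1) by simp
    qed
    then have card: "card {k\<in>{1..N}. d dvd k} = N div d" using card_image[OF inj] by simp
    have "(\<Sum>k\<in>{1..N}. if d dvd k then mangoldt d else (0::real)) = (\<Sum>k\<in>{k\<in>{1..N}. d dvd k}. mangoldt d)"
      by (rule sum.inter_filter[symmetric]) simp
    then show "(\<Sum>k\<in>{1..N}. if d dvd k then mangoldt d else 0) = mangoldt d * real (N div d)"
      using card by (simp add: mult.commute)
  qed
  finally show ?thesis .
qed

lemma ln_fact_bounds:
  assumes "N \<ge> 1"
  shows "ln (fact N) \<ge> real N * ln (real N) - real N" "ln (fact N) \<le> real N * ln (real N) - real N + ln (real N) + 1"
proof -
  have "ln (fact N) \<ge> real N * ln (real N) - real N \<and> ln (fact N) \<le> real N * ln (real N) - real N + ln (real N) + 1"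
    using assms
  proof (induction N rule: dec_induct)
    case base
    then show ?case by simp
  next
    case (step N)
    define u where "u = real N"
    have u: "u \<ge> 1" using step by (simp add: u_def)
    define l where "l = ln (u + 1) - ln u"
    have f: "ln (fact (Suc N) :: real) = ln (u + 1) + ln (fact N)" by (simp add: u_def ln_mult add.commute)
    have l1: "l = ln (1 + 1 / u)" using u by (simp add: l_def field_simps flip: ln_divide_pos)
    have "ln (1 + 1 / u) \<le> 1 / u" using u by (intro ln_add_one_self_le_self) auto
    then have 1: "u * l \<le> 1" using u by (simp add: l1 field_simps)
    have "ln (u / (u + 1)) \<le> u / (u + 1) - 1" using u by (intro ln_le_minus_one) auto
    moreover have "ln (u / (u + 1)) = - l" using u by (simp add: l_def ln_divide_pos)
    moreover have "u / (u + 1) - 1 = - (1 / (u + 1))" using u by (simp add: field_simps)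
    ultimately have "1 / (u + 1) \<le> l" by linarith
    then have 2: "(u + 1) * l \<ge> 1" using u by (simp add: field_simps)
    have "real (Suc N) = u + 1" by (simp add: u_def)
    then show ?case using step.IH 1 2 unfolding f l_def u_def[symmetric] by (simp add: algebra_simps)
  qed
  then show "ln (fact N) \<ge> real N * ln (real N) - real N" "ln (fact N) \<le> real N * ln (real N) - real N + ln (real N) + 1" by auto
qed

text \<open>Because 1 + 1/30 = 1/2 + 1/3 + 1/5, both sides increase by 31 when \<open>K\<close>
  grows by 30, and only the 30 residues have to be inspected.\<close>

lemma chebyshev_floor: "(K::nat) + K div 30 \<le> 1 + K div 2 + K div 3 + K div 5"
proof -
  define t k where "t = K div 30" and "k = K mod 30"
  have K: "K = 30 * t + k" and k: "k < 30" by (simp_all add: t_def k_def)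
  have "\<forall>k\<in>set [0..<30]. k \<le> 1 + k div 2 + k div 3 + k div (5::nat)" by code_simp
  then have "k \<le> 1 + k div 2 + k div 3 + k div 5" using k by simp
  moreover have "K div 2 = 15 * t + k div 2" "K div 3 = 10 * t + k div 3" "K div 5 = 6 * t + k div 5"
    unfolding K by simp_all
  ultimately show ?thesis using K t_def by linarith
qed

text \<open>The left side is 30 times Chebyshev's constant, about 27.6; rounding down to 27 leaves
  the density 9/10. Exponentiated, the claim compares exp 27 with 2 ^ 14 * 3 ^ 9 * 5 ^ 5, for which
  exp 1 \<le> 2.78 suffices; that comes from the quadratic bound for exp at 1/32.\<close>

lemma chebyshev_constant: "14 * ln 2 + 9 * ln 3 + 5 * ln (5::real) \<ge> 27"
proof -
  have "exp (1/32 :: real) \<le> 1 + 1/32 + (1/32)\<^sup>2" by (rule exp_bound) auto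
  then have "exp (1/32 :: real) ^ 32 \<le> (1057/1024) ^ 32" by (intro power_mono) (auto simp: power2_eq_square)
  moreover have "exp (1/32 :: real) ^ 32 = exp 1" by (simp flip: exp_of_nat_mult)
  moreover have "(1057/1024 :: real) ^ 32 \<le> 278/100" by (simp add: power_divide)
  ultimately have "exp 1 \<le> (278/100 :: real)" by linarith
  then have "exp (1::real) ^ 27 \<le> (278/100) ^ 27" by (intro power_mono) auto
  also have "(278/100 :: real) ^ 27 \<le> 2 ^ 14 * 3 ^ 9 * 5 ^ 5" by (simp add: power_divide)
  finally have "exp (27::real) \<le> 2 ^ 14 * 3 ^ 9 * 5 ^ 5" by (simp flip: exp_of_nat_mult)
  then have "27 \<le> ln (2 ^ 14 * 3 ^ 9 * 5 ^ 5 :: real)" by (subst ln_ge_iff) auto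
  also have "\<dots> = ln (2 ^ 14) + ln (3 ^ 9) + ln (5 ^ 5 :: real)" by (simp only: ln_mult_pos zero_less_power zero_less_numeral mult_pos_pos)
  also have "\<dots> = 14 * ln 2 + 9 * ln 3 + 5 * ln 5" unfolding ln_realpow by simp
  finally show ?thesis .
qed

text \<open>A multiple of 30 makes all five arguments of Chebyshev's combination of factorials
  integral. By \<open>chebyshev_floor\<close> no \<open>mangoldt n\<close> enters the combination
  with a coefficient above 1, which is what a lower bound needs. The error comes from the three
  factorials that are bounded from above.\<close>

lemma chebyshev_psi_lower:
  assumes M: "M \<ge> 1"
  shows "(\<Sum>n\<in>{1..30 * M}. mangoldt n) \<ge> 27 * real M - 3 * (ln (real (30 * M)) + 1)"
proof -
  define T where "T = (\<lambda>N. ln (fact N :: real))"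
  have T: "T N = (\<Sum>n\<in>{1..30 * M}. mangoldt n * real (N div n))" if "N \<le> 30 * M" for N
    unfolding T_def ln_fact_eq_sum_mangoldt by (rule sum.mono_neutral_left) (use that in auto)
  have "T (30 * M) + T M \<le> (\<Sum>n\<in>{1..30 * M}. mangoldt n) + T (15 * M) + T (10 * M) + T (6 * M)"
  proof -
    have "T (30 * M) + T M = (\<Sum>n\<in>{1..30 * M}. mangoldt n * (real (30 * M div n) + real (M div n)))"
    proof -
      have "T (30 * M) = (\<Sum>n\<in>{1..30 * M}. mangoldt n * real (30 * M div n))"
        "T M = (\<Sum>n\<in>{1..30 * M}. mangoldt n * real (M div n))" by (rule T, simp)+
      then show ?thesis by (simp only: sum.distrib distrib_left)
    qed
    also have "\<dots> \<le> (\<Sum>n\<in>{1..30 * M}. mangoldt n * (1 + real (15 * M div n) + real (10 * M div n) + real (6 * M div n)))"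
    proof (intro sum_mono mult_left_mono mangoldt_nonneg)
      fix n assume "n \<in> {1..30 * M}"
      define K where "K = 30 * M div n"
      have "K div 30 = M div n" "K div 2 = 15 * M div n" "K div 3 = 10 * M div n" "K div 5 = 6 * M div n"
        unfolding K_def div_mult2_eq[symmetric]
        using div_mult_mult1[of 30 M n] div_mult_mult1[of 2 "15 * M" n] div_mult_mult1[of 3 "10 * M" n] div_mult_mult1[of 5 "6 * M" n]
        by (simp_all add: mult.commute)
      then have "30 * M div n + M div n \<le> 1 + 15 * M div n + 10 * M div n + 6 * M div n"
        using chebyshev_floor[of K] by (simp add: K_def)
      then show "real (30 * M div n) + real (M div n) \<le> 1 + real (15 * M div n) + real (10 * M div n) + real (6 * M div n)" by linarith
    qed
    also have "\<dots> = (\<Sum>n\<in>{1..30 * M}. mangoldt n) + T (15 * M) + T (10 * M) + T (6 * M)"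
      by (simp add: T sum.distrib distrib_left)
    finally show ?thesis .
  qed
  moreover have "T (30 * M) \<ge> real (30 * M) * ln (real (30 * M)) - real (30 * M)" "T M \<ge> real M * ln (real M) - real M"
    unfolding T_def by (intro ln_fact_bounds(1); use M in simp)+
  moreover have "T (15 * M) \<le> real (15 * M) * ln (real (15 * M)) - real (15 * M) + ln (real (15 * M)) + 1"
    "T (10 * M) \<le> real (10 * M) * ln (real (10 * M)) - real (10 * M) + ln (real (10 * M)) + 1"
    "T (6 * M) \<le> real (6 * M) * ln (real (6 * M)) - real (6 * M) + ln (real (6 * M)) + 1"
    unfolding T_def by (intro ln_fact_bounds(2); use M in simp)+
  moreover have "ln (real (15 * M)) \<le> ln (real (30 * M))" "ln (real (10 * M)) \<le> ln (real (30 * M))" "ln (real (6 * M)) \<le> ln (real (30 * M))"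
    using M by simp_all
  moreover have "real (30 * M) * ln (real (30 * M)) + real M * ln (real M) - real (15 * M) * ln (real (15 * M))
      - real (10 * M) * ln (real (10 * M)) - real (6 * M) * ln (real (6 * M)) = real M * (14 * ln 2 + 9 * ln 3 + 5 * ln 5)"
  proof -
    have "ln (real (30 * M)) = ln 2 + ln 3 + ln 5 + ln (real M)" "ln (real (15 * M)) = ln 3 + ln 5 + ln (real M)"
      "ln (real (10 * M)) = ln 2 + ln 5 + ln (real M)" "ln (real (6 * M)) = ln 2 + ln 3 + ln (real M)"
      using M ln_mult_pos[of 2 3] ln_mult_pos[of 6 5] ln_mult_pos[of 3 5] ln_mult_pos[of 2 5]
      by (simp_all add: ln_mult_pos)
    then show ?thesis by (simp add: algebra_simps)
  qed
  moreover have "real M * (14 * ln 2 + 9 * ln 3 + 5 * ln 5) \<ge> real M * 27"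
    by (intro mult_left_mono chebyshev_constant) auto
  ultimately show ?thesis by simp
qed

text \<open>The density 0.9 of \<open>chebyshev_psi_lower\<close> is lowered to 0.89 to pay for
  rounding \<open>x\<close> down to a multiple of 30 and for the proper prime powers. The passage to
  the number of primes only uses ln p \<le> ln x.\<close>

lemma chebyshev_pi_lower:
  "\<forall>\<^sub>F x in at_top. real (card {p. prime p \<and> real p \<le> x}) \<ge> 89/100 * x / ln x"
proof -
  have "\<forall>\<^sub>F x::real in at_top. 9/10 * (x - 30) - 3 * (ln x + 1) - (sqrt x + 1) * (log 2 x + 1) * ln x \<ge> 89/100 * x"
    by real_asymp
  then show ?thesis
    using eventually_ge_at_top[of "60::real"]
  proof eventually_elim
    case (elim x)
    define M where "M = nat \<lfloor>x / 30\<rfloor>"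
    have M: "real M \<le> x / 30" "real M > x / 30 - 1" "M \<ge> 1" using elim unfolding M_def by linarith+
    define m where "m = 30 * M"
    have m: "real m \<le> x" "real m \<ge> x - 30" "m \<ge> 1" using M by (auto simp: m_def)
    have lx: "ln x > 0" using elim by simp
    have fin: "finite {p. prime p \<and> real p \<le> x}"
      by (rule finite_subset[of _ "{..nat \<lfloor>x\<rfloor>}"]) (auto simp: le_nat_floor)
    have lm: "ln (real m) \<le> ln x" using m by simp
    have "(\<Sum>p | prime p \<and> p \<le> m. ln (real p) * 1) \<le> (\<Sum>p | prime p \<and> p \<le> m. ln x)"
      using m by (intro sum_mono) (auto simp: prime_gt_0_nat)
    also have "\<dots> \<le> real (card {p. prime p \<and> real p \<le> x}) * ln x"
      using lx m fin by (auto intro!: mult_right_mono card_mono)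
    finally have 1: "(\<Sum>p | prime p \<and> p \<le> m. ln (real p) * 1) \<le> real (card {p. prime p \<and> real p \<le> x}) * ln x" .
    have 2: "\<bar>(\<Sum>n\<in>{1..m}. mangoldt n * 1) - (\<Sum>p | prime p \<and> p \<le> m. ln (real p) * 1)\<bar>
      \<le> (sqrt (real m) + 1) * (log 2 (real m) + 1) * ln (real m)"
      by (rule sum_mangoldt_nonprime) (use m in auto)
    have 3: "(sqrt (real m) + 1) * (log 2 (real m) + 1) * ln (real m) \<le> (sqrt x + 1) * (log 2 x + 1) * ln x"
      using m elim lm by (intro mult_mono add_mono) auto
    have 4: "(\<Sum>n\<in>{1..m}. mangoldt n) \<ge> 27 * real M - 3 * (ln (real m) + 1)"
      unfolding m_def by (rule chebyshev_psi_lower[OF M(3)])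
    have "27 * real M \<ge> 9/10 * (x - 30)" using m(2) by (simp add: m_def)
    then have "real (card {p. prime p \<and> real p \<le> x}) * ln x \<ge> 89/100 * x"
    proof -
      define u v e e' where "u = (\<Sum>n\<in>{1..m}. mangoldt n :: real)" and "v = (\<Sum>p | prime p \<and> p \<le> m. ln (real p))"
        and "e = (sqrt (real m) + 1) * (log 2 (real m) + 1) * ln (real m)"
        and "e' = (sqrt x + 1) * (log 2 x + 1) * ln x"
      note 1 = 1[unfolded mult_1_right, folded v_def]
      note 2 = 2[unfolded mult_1_right, folded u_def v_def e_def]
      note 3 = 3[folded e_def e'_def]
      note 4 = 4[folded u_def]
      note 5 = elim(1)[folded e'_def]
      have "u - e \<le> v" using 2 by linarith
      with 1 3 4 5 lm \<open>27 * real M \<ge> 9/10 * (x - 30)\<close> show ?thesis by argo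
    qed
    then show ?case using lx by (simp add: pos_divide_le_eq)
  qed
qed

section \<open>Rough numbers\<close>

lemma sqrt_eq_powr_half: "x powr (1/2) = sqrt x" if "x \<ge> 0" for x :: real
  using powr_half_sqrt[OF that] by simp

lemma Pminus_ge_iff: "ereal z \<le> Pminus u \<longleftrightarrow> (\<forall>p. prime p \<longrightarrow> p dvd u \<longrightarrow> z \<le> real p)"
  by (auto simp: Pminus_def le_INF_iff)

definition rough_set :: "real \<Rightarrow> nat set" where
  "rough_set x = {u. 2 \<le> u \<and> real u \<le> x \<and> ereal (sqrt x) \<le> Pminus u}"

lemma finite_rough_set: "finite (rough_set x)"
  by (rule finite_subset[of _ "{..nat \<lfloor>x\<rfloor>}"]) (auto simp: rough_set_def le_nat_floor)

lemma prime_in_rough_set: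
  assumes "prime p" "sqrt x \<le> real p" "real p \<le> x"
  shows "p \<in> rough_set x"
  using assms prime_ge_2_nat[OF assms(1)] primes_dvd_imp_eq[of _ p]
  by (auto simp: rough_set_def Pminus_ge_iff)

text \<open>Two prime factors, each at least sqrt x, force a product of at least x. So a composite
  member can only be \<open>x\<close> itself, and the exception costs at most one element.\<close>

lemma rough_set_cases:
  assumes "u \<in> rough_set x" "x \<ge> 0"
  shows "(prime u \<and> sqrt x \<le> real u \<and> real u \<le> x) \<or> real u = x"
proof (cases "prime u")
  case True
  then show ?thesis using assms by (auto simp: rough_set_def Pminus_ge_iff)
next
  case False
  have u: "u \<ge> 2" "real u \<le> x" and ge: "\<And>p. prime p \<Longrightarrow> p dvd u \<Longrightarrow> sqrt x \<le> real p"
    using assms by (auto simp: rough_set_def Pminus_ge_iff)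
  obtain p where p: "prime p" "p dvd u" using u prime_factor_nat[of u] by auto
  then obtain m where m: "u = p * m" by (auto elim: dvdE)
  have "m \<noteq> 1" using False p(1) m by auto
  then obtain r where r: "prime r" "r dvd m" using prime_factor_nat by blast
  have "m > 0" using m u by (auto intro: Nat.gr0I)
  then have "r \<le> m" using r(2) by (rule dvd_imp_le[rotated])
  have "x = sqrt x * sqrt x" using assms(2) by simp
  also have "\<dots> \<le> real p * real r" using ge[OF p] ge[OF r(1)] r(2) m assms(2) by (intro mult_mono) auto
  also have "\<dots> \<le> real p * real m" using \<open>r \<le> m\<close> by (intro mult_left_mono) auto
  also have "\<dots> = real u" by (simp add: m)
  finally show ?thesis using u(2) by simp
qed

text \<open>The extra element is 1, whose \<open>Pminus\<close> is infinite: it counts as rough,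
  whereas the pairs require \<open>u\<close> to be at least 2.\<close>

lemma rough_count_eq:
  assumes "x \<ge> 1"
  shows "rough_count x (x powr (1/2)) = Suc (card (rough_set x))"
proof -
  have "{n. 1 \<le> n \<and> real n \<le> x \<and> ereal (sqrt x) \<le> Pminus n} = insert 1 (rough_set x)"
    using assms by (auto simp: rough_set_def Pminus_ge_iff)
  then show ?thesis using assms finite_rough_set[of x]
    by (simp add: rough_count_def sqrt_eq_powr_half rough_set_def)
qed

definition rough_class :: "real \<Rightarrow> nat \<Rightarrow> nat \<Rightarrow> nat" where
  "rough_class x k b = card {u\<in>rough_set x. [u = b] (mod k)}"

definition large_primes :: "real \<Rightarrow> nat set" where
  "large_primes x = {p. prime p \<and> sqrt x \<le> real p \<and> real p \<le> x}"

lemma finite_large_primes: "finite (large_primes x)"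
  by (rule finite_subset[of _ "{..nat \<lfloor>x\<rfloor>}"]) (auto simp: large_primes_def le_nat_floor)

lemma rough_class_large_primes:
  assumes "x \<ge> 0"
  shows "\<bar>real (rough_class x k b) - real (card {p\<in>large_primes x. [p = b] (mod k)})\<bar> \<le> 1"
proof -
  define A where "A = {p\<in>large_primes x. [p = b] (mod k)}"
  define U where "U = {u\<in>rough_set x. [u = b] (mod k)}"
  have "A \<subseteq> U" using prime_in_rough_set by (auto simp: A_def U_def large_primes_def)
  moreover have "U - A \<subseteq> {nat \<lfloor>x\<rfloor>}"
    using rough_set_cases[OF _ assms] by (force simp: A_def U_def large_primes_def)
  then have "card (U - A) \<le> 1" using card_mono[of "{nat \<lfloor>x\<rfloor>}"] by simp
  moreover have "finite U" using finite_rough_set[of x] by (simp add: U_def)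
  ultimately have "card A \<le> card U" "card U \<le> card A + 1"
    by (auto simp: card_Diff_subset finite_subset card_mono)
  then show ?thesis unfolding rough_class_def A_def[symmetric] U_def[symmetric] by linarith
qed

text \<open>Since \<open>a\<close> is a unit modulo \<open>k\<close>, the congruence already forces
  \<open>v\<close> to be coprime to \<open>k\<close>. Then \<open>c v\<close> represents the
  quotient a / v, and the count fibres over \<open>v\<close>.\<close>

lemma count_pairs_eq:
  assumes k: "k > 0" and a: "coprime a (int k)" and x: "x \<ge> 0"
    and c: "\<And>v. coprime v k \<Longrightarrow> [int (v * c v) = a] (mod int k)"
  shows "count_pairs k a x y (x powr (1/2)) = (\<Sum>v\<in>primes_coprime_upto k y. rough_class x k (c v))"
proof -
  define P where "P = primes_coprime_upto k y"
  have finP: "finite P" unfolding P_def primes_coprime_upto_def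
    by (rule finite_subset[of _ "{..nat \<lfloor>y\<rfloor>}"]) (auto simp: le_nat_floor)
  have cop: "coprime v k" if "[int (u * v) = a] (mod int k)" for u v
  proof -
    have "coprime (int (u * v)) (int k)" using cong_imp_coprime[OF cong_sym[OF that] a] .
    then show ?thesis by (simp add: coprime_mult_left_iff flip: coprime_int_iff)
  qed
  have iff: "[int (u * v) = a] (mod int k) \<longleftrightarrow> [u = c v] (mod k)" if v: "coprime v k" for u v
  proof -
    have "[int (u * v) = a] (mod int k) \<longleftrightarrow> [int (v * u) = int (v * c v)] (mod int k)"
      using c[OF v] by (metis cong_sym cong_trans mult.commute)
    also have "\<dots> \<longleftrightarrow> [v * u = v * c v] (mod k)" by (rule cong_int_iff)
    also have "\<dots> \<longleftrightarrow> [u = c v] (mod k)" using v by (rule cong_mult_lcancel_nat)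
    finally show ?thesis .
  qed
  have "{(u, v). 2 \<le> u \<and> real u \<le> x \<and> prime v \<and> real v \<le> y \<and> [int (u * v) = a] (mod int k) \<and> ereal (sqrt x) \<le> Pminus u}
      = (\<lambda>(v, u). (u, v)) ` (SIGMA v:P. {u\<in>rough_set x. [u = c v] (mod k)})"
  proof (intro equalityI subsetI)
    fix p assume "p \<in> {(u, v). 2 \<le> u \<and> real u \<le> x \<and> prime v \<and> real v \<le> y \<and> [int (u * v) = a] (mod int k) \<and> ereal (sqrt x) \<le> Pminus u}"
    then obtain u v where p: "p = (u, v)" "2 \<le> u" "real u \<le> x" "prime v" "real v \<le> y" "[int (u * v) = a] (mod int k)" "ereal (sqrt x) \<le> Pminus u" by blast
    have "(v, u) \<in> (SIGMA v:P. {u\<in>rough_set x. [u = c v] (mod k)})"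
      using p cop[OF p(6)] iff[OF cop[OF p(6)], of u] by (simp add: P_def primes_coprime_upto_def rough_set_def)
    then show "p \<in> (\<lambda>(v, u). (u, v)) ` (SIGMA v:P. {u\<in>rough_set x. [u = c v] (mod k)})" using p(1) by force
  next
    fix p assume "p \<in> (\<lambda>(v, u). (u, v)) ` (SIGMA v:P. {u\<in>rough_set x. [u = c v] (mod k)})"
    then obtain u v where p: "p = (u, v)" "v \<in> P" "u \<in> rough_set x" "[u = c v] (mod k)" by auto
    then have "coprime v k" by (simp add: P_def primes_coprime_upto_def)
    with p iff show "p \<in> {(u, v). 2 \<le> u \<and> real u \<le> x \<and> prime v \<and> real v \<le> y \<and> [int (u * v) = a] (mod int k) \<and> ereal (sqrt x) \<le> Pminus u}"
      by (simp add: P_def primes_coprime_upto_def rough_set_def)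
  qed
  moreover have "inj_on (\<lambda>(v, u). (u, v)) (SIGMA v:P. {u\<in>rough_set x. [u = c v] (mod k)})" by (auto intro!: inj_onI)
  ultimately have "count_pairs k a x y (x powr (1/2)) = card (SIGMA v:P. {u\<in>rough_set x. [u = c v] (mod k)})"
    using x by (simp add: count_pairs_def sqrt_eq_powr_half card_image)
  also have "\<dots> = (\<Sum>v\<in>P. card {u\<in>rough_set x. [u = c v] (mod k)})"
    using finP finite_rough_set[of x] by (intro card_SigmaI) auto
  finally show ?thesis by (simp add: rough_class_def P_def)
qed

text \<open>A common prime factor of a rough number and \<open>k\<close> would be at least sqrt x
  and at most \<open>k\<close>. So for k < sqrt x every rough number lies in a reduced
  class.\<close>

lemma card_rough_set_eq_sum_classes:
  assumes k: "k > 0" "real k < sqrt x"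
  shows "card (rough_set x) = (\<Sum>b\<in>{b\<in>{..<k}. coprime b k}. rough_class x k b)"
proof -
  have cop: "coprime u k" if u: "u \<in> rough_set x" for u
  proof (rule ccontr)
    assume "\<not> coprime u k"
    then have "gcd u k \<noteq> 1" by (metis coprime_iff_gcd_eq_1)
    then obtain p where p: "prime p" "p dvd gcd u k" using prime_factor_nat by blast
    then have "sqrt x \<le> real p" using u by (auto simp: rough_set_def Pminus_ge_iff)
    moreover have "p \<le> k" using p k(1) by (auto intro: dvd_imp_le)
    ultimately show False using k(2) by linarith
  qed
  have "rough_set x = (\<Union>b\<in>{b\<in>{..<k}. coprime b k}. {u\<in>rough_set x. [u = b] (mod k)})"
    using cop k(1) by (auto simp: cong_def intro!: exI[of _ "_ mod k"])
  then have "card (rough_set x) = card (\<Union>b\<in>{b\<in>{..<k}. coprime b k}. {u\<in>rough_set x. [u = b] (mod k)})" by simp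
  also have "\<dots> = (\<Sum>b\<in>{b\<in>{..<k}. coprime b k}. card {u\<in>rough_set x. [u = b] (mod k)})"
    using finite_rough_set[of x] by (intro card_UN_disjoint) (auto simp: cong_def)
  finally show ?thesis by (simp add: rough_class_def)
qed

lemma card_reduced_residues:
  assumes "k > (1::nat)"
  shows "card {b\<in>{..<k}. coprime b k} = totient k"
proof -
  have "{b\<in>{..<k}. coprime b k} = totatives k"
    using assms by (auto simp: totatives_def intro: Nat.gr0I le_neq_trans)
  then show ?thesis by (simp add: totient_def)
qed

text \<open>With \<open>h\<close> about x powr (49/50), three errors are compared with x powr
  (985/1000) after multiplication by \<open>k\<close>. Up to logarithms the Riesz means contribute
  the exponent 1 + 52/100 - 49/50 + 2/5 = 94/100, the short interval 98/100, and the proper prime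
  powers 1/2 + 2/5 = 9/10.\<close>

theorem GRH_large_primes_equidistributed:
  assumes "GRH" and C0: "C0 > 0"
  shows "\<forall>\<^sub>F x in at_top. \<forall>k b b'. 0 < k \<longrightarrow> real k \<le> C0 * x powr (2/5) \<longrightarrow> coprime b k \<longrightarrow> coprime b' k \<longrightarrow>
    \<bar>real (card {p\<in>large_primes x. [p = b] (mod k)}) - real (card {p\<in>large_primes x. [p = b'] (mod k)})\<bar> \<le> x powr (985/1000) / real k"
proof -
  obtain C' where C': "C' \<ge> 0" "\<And>q chi x. dirichlet_character q chi \<Longrightarrow> chi \<noteq> principal_character q \<Longrightarrow> x \<ge> 1 \<Longrightarrow>
    norm (\<Sum>n | 0 < n \<and> real n \<le> x. mangoldt n * chi n * of_real (1 - real n / x)) \<le> C' * ln (2 * real q) * x powr (52/100)"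
    using GRH_riesz_mean_bound[OF assms(1)] by blast
  define C where "C = C' + 1"
  have C: "C > 0" using C'(1) by (simp add: C_def)
  have "\<forall>\<^sub>F x::real in at_top. x powr (49/50) / 2 \<ge> 1" by real_asymp
  moreover have "\<forall>\<^sub>F x::real in at_top. 2 * C0 * x powr (2/5) \<le> x" by real_asymp
  moreover have "\<forall>\<^sub>F x::real in at_top. x powr (49/50) \<le> x" by real_asymp
  moreover have "\<forall>\<^sub>F x::real in at_top. 4 * (16 * x * (C * ln x * (2 * x) powr (52/100)) / x powr (49/50)) * (C0 * x powr (2/5)) \<le> x powr (985/1000) / 3"
    using C C0 by real_asymp
  moreover have "\<forall>\<^sub>F x::real in at_top. 4 * (2 * (x powr (49/50) + C0 * x powr (2/5)) * ln (2 * x)) \<le> x powr (985/1000) / 3"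
    using C0 by real_asymp
  moreover have "\<forall>\<^sub>F x::real in at_top. 4 * ((sqrt x + 1) * (log 2 x + 1) * ln x) * (C0 * x powr (2/5)) \<le> x powr (985/1000) / 3"
    using C0 by real_asymp
  ultimately show ?thesis using eventually_ge_at_top[of "4::real"]
  proof eventually_elim
    case (elim x)
    have x4: "x \<ge> 4" by (rule elim(7))
    have lx: "ln x > 0" using x4 by simp
    define h where "h = nat \<lfloor>x powr (49/50)\<rfloor>"
    have h: "real h \<le> x powr (49/50)" "real h \<ge> x powr (49/50) / 2" "h > 0"
      using elim(1) unfolding h_def by linarith+
    define z where "z = nat \<lceil>sqrt x\<rceil>"
    have "sqrt x \<ge> 2" using x4 by (intro real_le_rsqrt) simp
    then have z2: "z \<ge> 2" unfolding z_def by linarith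
    define M where "M = nat \<lfloor>x\<rfloor>"
    have lp: "large_primes x = {p. prime p \<and> z \<le> p \<and> p \<le> M}"
    proof -
      have "p \<le> M \<longleftrightarrow> real p \<le> x" "z \<le> p \<longleftrightarrow> sqrt x \<le> real p" for p
        using x4 by (simp_all add: M_def z_def le_nat_iff le_floor_iff nat_ceiling_le_eq)
      then show ?thesis by (simp add: large_primes_def)
    qed
    show ?case
    proof (intro allI impI)
      fix k b b' :: nat
      assume k: "0 < k" "real k \<le> C0 * x powr (2/5)" and b: "coprime b k" "coprime b' k"
      have kx: "2 * real k \<le> x" using k(2) elim(2) by linarith
      define f where "f = (\<lambda>n. of_bool [n = b] (mod k) - of_bool [n = b'] (mod k) :: real)"
      define R where "R = C * ln x * (2 * x) powr (52/100)"
      have R0: "R \<ge> 0" using C lx by (simp add: R_def)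
      have riesz: "norm (\<Sum>n | 0 < n \<and> real n \<le> t. mangoldt n * chi n * of_real (1 - real n / t)) \<le> R"
        if "dirichlet_character k chi" "chi \<noteq> principal_character k" "1 \<le> t" "t \<le> 2 * x" for chi t
      proof -
        have "C' * ln (2 * real k) * t powr (52/100) \<le> C * ln x * (2 * x) powr (52/100)"
          using C'(1) that(3,4) kx k(1) lx by (intro mult_mono powr_mono2) (auto simp: C_def intro!: ln_mono)
        then show ?thesis using C'(2)[OF that(1-3)] by (simp add: R_def)
      qed
      define B1 where "B1 = 8 * x * R / real h + 2 * (real h / real k + 1) * ln (2 * x)"
      define B2 where "B2 = (sqrt x + 1) * (log 2 x + 1) * ln x"
      have B1: "\<bar>\<Sum>n\<in>{1..m}. mangoldt n * f n\<bar> \<le> B1" if "real m \<le> x" for m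
        unfolding B1_def f_def
        by (rule mangoldt_residue_difference[OF k(1) R0 riesz b h(3) _ that]) (use h(1) elim(3) in auto)
      have theta: "\<bar>\<Sum>p | prime p \<and> p \<le> m. ln (real p) * f p\<bar> \<le> B1 + B2" if "m \<le> M" for m
      proof (cases "m \<ge> 1")
        case False
        then have "{p. prime p \<and> p \<le> m} = {}" by (auto dest: prime_gt_0_nat)
        then have "(\<Sum>p | prime p \<and> p \<le> m. ln (real p) * f p) = 0" by (simp only: sum.empty)
        moreover have "B1 \<ge> 0" using B1[of 0] x4 by simp
        moreover have "B2 \<ge> 0" using x4 lx by (simp add: B2_def)
        ultimately show ?thesis by simp
      next
        case True
        have mx: "real m \<le> x" using that x4 unfolding M_def by linarith
        have "\<bar>(\<Sum>n\<in>{1..m}. mangoldt n * f n) - (\<Sum>p | prime p \<and> p \<le> m. ln (real p) * f p)\<bar>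
           \<le> (sqrt (real m) + 1) * (log 2 (real m) + 1) * ln (real m)"
          by (rule sum_mangoldt_nonprime) (use True in \<open>auto simp: f_def\<close>)
        also have "\<dots> \<le> B2" unfolding B2_def using mx True x4 by (intro mult_mono add_mono) auto
        finally show ?thesis using B1[OF mx] by linarith
      qed
      have B0: "B1 + B2 \<ge> 0" using order_trans[OF abs_ge_zero theta[of 0]] by simp
      have "ln 2 \<le> ln (real z)" using z2 by simp
      then have lz: "ln (real z) \<ge> 1/2" using ln2_ge_two_thirds by linarith
      have "\<bar>\<Sum>p | prime p \<and> z \<le> p \<and> p \<le> M. f p\<bar> \<le> 2 * (B1 + B2) / ln (real z)"
        by (rule prime_sum_abel[OF theta z2])
      also have "\<dots> \<le> 2 * (B1 + B2) / (1/2)" using lz B0 by (intro divide_left_mono) auto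
      finally have "\<bar>\<Sum>p\<in>large_primes x. f p\<bar> \<le> 4 * B1 + 4 * B2" by (simp add: lp)
      moreover have "(\<Sum>p\<in>large_primes x. f p) = real (card {p\<in>large_primes x. [p = b] (mod k)}) - real (card {p\<in>large_primes x. [p = b'] (mod k)})"
        using finite_large_primes[of x] by (simp add: f_def sum_subtractf of_bool_def sum.If_cases Int_def)
      moreover have "4 * B1 + 4 * B2 \<le> x powr (985/1000) / real k"
      proof -
        have "8 * x * R / real h \<le> 8 * x * R / (x powr (49/50) / 2)"
          using h x4 R0 by (intro divide_left_mono) auto
        then have "4 * (8 * x * R / real h) \<le> 4 * (16 * x * R / x powr (49/50))" by simp
        then have "4 * (8 * x * R / real h) * real k \<le> 4 * (16 * x * R / x powr (49/50)) * (C0 * x powr (2/5))"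
          using k(2) R0 x4 by (intro mult_mono) auto
        then have 1: "4 * (8 * x * R / real h) * real k \<le> x powr (985/1000) / 3" using elim(4) unfolding R_def by linarith
        have "4 * (2 * (real h / real k + 1) * ln (2 * x)) * real k = 4 * (2 * (real h + real k) * ln (2 * x))"
          using k(1) by (simp add: field_simps)
        also have "\<dots> \<le> 4 * (2 * (x powr (49/50) + C0 * x powr (2/5)) * ln (2 * x))"
          using h(1) k(2) x4 by (intro mult_left_mono mult_right_mono add_mono) auto
        finally have 2: "4 * (2 * (real h / real k + 1) * ln (2 * x)) * real k \<le> x powr (985/1000) / 3" using elim(5) by linarith
        have "4 * B2 * real k \<le> 4 * B2 * (C0 * x powr (2/5))"
          using k(2) x4 lx by (intro mult_left_mono) (auto simp: B2_def)
        then have 3: "4 * B2 * real k \<le> x powr (985/1000) / 3" using elim(6) unfolding B2_def by linarith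
        have "(4 * B1 + 4 * B2) * real k = 4 * (8 * x * R / real h) * real k + 4 * (2 * (real h / real k + 1) * ln (2 * x)) * real k + 4 * B2 * real k"
          by (simp add: B1_def distrib_left distrib_right)
        then have "(4 * B1 + 4 * B2) * real k \<le> x powr (985/1000)" using 1 2 3 by linarith
        then show ?thesis using k(1) by (simp add: pos_le_divide_eq)
      qed
      ultimately show "\<bar>real (card {p\<in>large_primes x. [p = b] (mod k)}) - real (card {p\<in>large_primes x. [p = b'] (mod k)})\<bar> \<le> x powr (985/1000) / real k"
        by linarith
    qed
  qed
qed

section \<open>The counting function\<close>

theorem GRH_count_pairs:
  assumes "GRH" and C0: "C0 > 0"
  shows "\<forall>\<^sub>F x in at_top. \<forall>k a y. 2 < k \<longrightarrow> real k \<le> C0 * x powr (2/5) \<longrightarrow> coprime a (int k) \<longrightarrow> 0 \<le> y \<longrightarrow>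
    \<bar>real (count_pairs k a x y (x powr (1/2))) - real (card (primes_coprime_upto k y)) / real (totient k) * real (rough_count x (x powr (1/2)))\<bar>
      \<le> 4 * (x powr (985/1000) * y / real k)"
proof -
  have "\<forall>\<^sub>F x::real in at_top. C0 * x powr (2/5) < sqrt x" using C0 by real_asymp
  moreover have "\<forall>\<^sub>F x::real in at_top. C0 * x powr (2/5) \<le> x powr (985/1000)" using C0 by real_asymp
  ultimately show ?thesis using GRH_large_primes_equidistributed[OF assms] eventually_ge_at_top[of "1::real"]
  proof eventually_elim
    case (elim x)
    show ?case
    proof (intro allI impI)
      fix k :: nat and a :: int and y :: real
      assume k: "2 < k" "real k \<le> C0 * x powr (2/5)" and a: "coprime a (int k)" and y: "0 \<le> y"
      have x1: "x \<ge> 1" by (rule elim(4))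
      have k0: "0 < k" using k by simp
      define E where "E = x powr (985/1000) / real k"
      define phi where "phi = totient k"
      have phi: "phi > 0" using k0 by (simp add: phi_def)
      \<comment> \<open>This absorbs the additive constants into 4 * E: 2 from exchanging rough
        numbers for primes in two classes, and 1 from the element 1 in
        \<open>rough_count\<close>.\<close>
      have E1: "E \<ge> 1" using k0 elim(2) k(2) by (simp add: E_def pos_le_divide_eq)
      define U where "U = rough_class x k"
      have UU: "\<bar>real (U b) - real (U b')\<bar> \<le> E + 2" if "coprime b k" "coprime b' k" for b b'
      proof -
        have "\<bar>real (card {p\<in>large_primes x. [p = b] (mod k)}) - real (card {p\<in>large_primes x. [p = b'] (mod k)})\<bar> \<le> E"
          unfolding E_def using elim(3) k0 k(2) that by blast
        moreover have "\<bar>real (U b) - real (card {p\<in>large_primes x. [p = b] (mod k)})\<bar> \<le> 1"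
          "\<bar>real (U b') - real (card {p\<in>large_primes x. [p = b'] (mod k)})\<bar> \<le> 1"
          unfolding U_def using x1 by (intro rough_class_large_primes; simp)+
        ultimately show ?thesis by linarith
      qed
      define Q where "Q = card (rough_set x)"
      have Ub: "\<bar>real (U b) - real Q / real phi\<bar> \<le> E + 2" if b: "coprime b k" for b
      proof -
        define B where "B = {b\<in>{..<k}. coprime b k}"
        have cB: "card B = phi" using card_reduced_residues[of k] k by (simp add: B_def phi_def)
        have "real Q = (\<Sum>b\<in>B. real (U b))"
          unfolding Q_def U_def B_def using card_rough_set_eq_sum_classes[of k x] k0 k(2) elim(1) by simp
        then have "real phi * real (U b) - real Q = (\<Sum>b'\<in>B. real (U b) - real (U b'))"
          by (simp add: sum_subtractf cB)
        then have "\<bar>real phi * real (U b) - real Q\<bar> \<le> (\<Sum>b'\<in>B. E + 2)"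
          using b by (simp only:) (intro order_trans[OF sum_abs] sum_mono UU, auto simp: B_def)
        also have "\<dots> = real phi * (E + 2)" by (simp add: cB)
        finally have "\<bar>real phi * (real (U b) - real Q / real phi)\<bar> \<le> real phi * (E + 2)"
          using phi by (simp add: right_diff_distrib)
        then show ?thesis using phi by (simp add: abs_mult)
      qed
      have "\<exists>c. coprime v k \<longrightarrow> [int (v * c) = a] (mod int k)" for v
      proof (cases "coprime v k")
        case True
        then obtain w where w: "[v * w = 1] (mod k)" using cong_solve_coprime_nat[OF True] by auto
        define c where "c = w * nat (a mod int k)"
        have "int (v * c) = int (v * w) * (a mod int k)" using k0 by (simp add: c_def)
        also have "[int (v * w) * (a mod int k) = 1 * a] (mod int k)"
          using w by (intro cong_mult) (auto simp flip: cong_int_iff)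
        finally show ?thesis by auto
      qed auto
      then obtain c where c: "\<And>v. coprime v k \<Longrightarrow> [int (v * c v) = a] (mod int k)" by metis
      have cc: "coprime (c v) k" if "coprime v k" for v
      proof -
        have "coprime (int (v * c v)) (int k)" using cong_imp_coprime[OF cong_sym[OF c[OF that]] a] .
        then show ?thesis by (simp add: coprime_mult_left_iff flip: coprime_int_iff)
      qed
      define P where "P = primes_coprime_upto k y"
      have Psub: "P \<subseteq> {1..nat \<lfloor>y\<rfloor>}"
        by (auto simp: P_def primes_coprime_upto_def le_nat_floor dest: prime_gt_0_nat)
      have "card P \<le> card {1..nat \<lfloor>y\<rfloor>}" by (intro card_mono Psub) simp
      then have Py: "real (card P) \<le> y" using y by simp linarith
      have N: "count_pairs k a x y (x powr (1/2)) = (\<Sum>v\<in>P. U (c v))"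
        unfolding P_def U_def using x1 by (intro count_pairs_eq[OF k0 a _ c]) auto
      have "\<bar>real (count_pairs k a x y (x powr (1/2))) - real (card P) * (real Q / real phi)\<bar> = \<bar>\<Sum>v\<in>P. real (U (c v)) - real Q / real phi\<bar>"
        by (simp add: N sum_subtractf)
      also have "\<dots> \<le> (\<Sum>v\<in>P. E + 2)"
        by (intro order_trans[OF sum_abs] sum_mono Ub cc) (auto simp: P_def primes_coprime_upto_def)
      also have "\<dots> = real (card P) * (E + 2)" by simp
      finally have 1: "\<bar>real (count_pairs k a x y (x powr (1/2))) - real (card P) * (real Q / real phi)\<bar> \<le> real (card P) * (E + 2)" .
      have "real (card P) / real phi * real (rough_count x (x powr (1/2))) = real (card P) * (real Q / real phi) + real (card P) / real phi"
        unfolding rough_count_eq[OF x1] Q_def by (simp add: distrib_left add_divide_distrib)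
      moreover have "real (card P) / real phi \<le> real (card P) / 1" using phi by (intro divide_left_mono) auto
      moreover have "0 \<le> real (card P) / real phi" by simp
      ultimately have "\<bar>real (count_pairs k a x y (x powr (1/2))) - real (card P) / real phi * real (rough_count x (x powr (1/2)))\<bar>
          \<le> real (card P) * (E + 2) + real (card P)" using 1 by linarith
      also have "\<dots> = real (card P) * (E + 3)" by (simp add: algebra_simps)
      also have "\<dots> \<le> y * (4 * E)" using Py E1 y by (intro mult_mono) auto
      finally show "\<bar>real (count_pairs k a x y (x powr (1/2))) - real (card (primes_coprime_upto k y)) / real (totient k) * real (rough_count x (x powr (1/2)))\<bar>
          \<le> 4 * (x powr (985/1000) * y / real k)" by (simp add: P_def phi_def E_def mult_ac)
    qed
  qed
qed

section \<open>Lower bounds for the main term, and the final theorem\<close>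

lemma card_prime_divisors_le:
  assumes "k > (0::nat)"
  shows "real (card (prime_factors k)) \<le> log 2 (real k)"
proof -
  have "2 ^ card (prime_factors k) = (\<Prod>p\<in>prime_factors k. 2::nat)" by simp
  also have "\<dots> \<le> (\<Prod>p\<in>prime_factors k. p ^ multiplicity p k)"
  proof (rule prod_mono, safe)
    fix p assume p: "p \<in> prime_factors k"
    then have "multiplicity p k > 0" "prime p" by (auto simp: prime_factors_multiplicity)
    then have "p ^ 1 \<le> p ^ multiplicity p k" by (intro power_increasing) (auto simp: prime_gt_0_nat Suc_le_eq)
    then show "2 \<le> p ^ multiplicity p k" using prime_ge_2_nat[OF \<open>prime p\<close>] by simp
  qed
  also have "\<dots> = k" using prime_factorization_nat[of k] assms by simp
  finally have "real (2 ^ card (prime_factors k)) \<le> real k" by (rule of_nat_mono)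
  then show ?thesis using assms by (simp add: le_log_iff powr_realpow)
qed

lemma card_primes_coprime_upto_ge:
  assumes "k > 0"
  shows "real (card (primes_coprime_upto k y)) \<ge> real (card {p. prime p \<and> real p \<le> y}) - log 2 (real k)"
proof -
  have "{p. prime p \<and> real p \<le> y} \<subseteq> primes_coprime_upto k y \<union> prime_factors k"
    using assms prime_imp_coprime_nat by (auto simp: primes_coprime_upto_def in_prime_factors_iff)
  moreover have "finite (primes_coprime_upto k y)"
    by (rule finite_subset[of _ "{..nat \<lfloor>y\<rfloor>}"]) (auto simp: primes_coprime_upto_def le_nat_floor)
  ultimately have "card {p. prime p \<and> real p \<le> y} \<le> card (primes_coprime_upto k y \<union> prime_factors k)"
    by (intro card_mono) auto
  also have "\<dots> \<le> card (primes_coprime_upto k y) + card (prime_factors k)" by (rule card_Un_le)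
  finally show ?thesis using card_prime_divisors_le[OF assms] by linarith
qed

lemma rough_count_ge:
  assumes "x \<ge> 1"
  shows "real (rough_count x (x powr (1/2))) \<ge> real (card {p. prime p \<and> real p \<le> x}) - sqrt x"
proof -
  have "{p. prime p \<and> real p \<le> x} \<subseteq> rough_set x \<union> {1..nat \<lfloor>sqrt x\<rfloor>}"
  proof
    fix p assume "p \<in> {p. prime p \<and> real p \<le> x}"
    then have p: "prime p" "real p \<le> x" by auto
    show "p \<in> rough_set x \<union> {1..nat \<lfloor>sqrt x\<rfloor>}"
    proof (cases "sqrt x \<le> real p")
      case True
      then show ?thesis using prime_in_rough_set[OF p(1) _ p(2)] by simp
    next
      case False
      then show ?thesis using prime_ge_1_nat[OF p(1)] by (simp add: le_nat_floor)
    qed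
  qed
  then have "card {p. prime p \<and> real p \<le> x} \<le> card (rough_set x \<union> {1..nat \<lfloor>sqrt x\<rfloor>})"
    using finite_rough_set by (intro card_mono) auto
  also have "\<dots> \<le> card (rough_set x) + card {1..nat \<lfloor>sqrt x\<rfloor>}" by (rule card_Un_le)
  also have "\<dots> = card (rough_set x) + nat \<lfloor>sqrt x\<rfloor>" by simp
  finally have "real (card {p. prime p \<and> real p \<le> x}) \<le> real (card (rough_set x)) + real (nat \<lfloor>sqrt x\<rfloor>)" by linarith
  moreover have "real (nat \<lfloor>sqrt x\<rfloor>) \<le> sqrt x" using assms by (intro of_nat_floor) auto
  ultimately show ?thesis unfolding rough_count_eq[OF assms] by simp
qed

text \<open>That \<open>k\<close> has the order of x powr \<open>\<delta>\<close> is rendered by the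
  two constants \<open>c\<close> and \<open>C\<close>. The o(1) terms are functions of
  \<open>x\<close> alone, chosen before \<open>k\<close> and \<open>a\<close>, so that both
  estimates are uniform in these.\<close>

theorem theorem2p3:
  assumes "GRH"
  shows "\<exists>\<epsilon>0>0. \<forall>\<epsilon>::real. 0 < \<epsilon> \<and> \<epsilon> < \<epsilon>0 \<longrightarrow>
    (\<forall>(\<delta>::real) (c::real) (C::real). 0 < c \<and> 0 < C \<longrightarrow>
      (1/4 < \<delta> \<and> \<delta> \<le> 1/3 \<longrightarrow>
        (\<exists>(\<eta>::real \<Rightarrow> real) (K::real). (\<eta> \<longlongrightarrow> 0) at_top \<and>
          (\<forall>\<^sub>F x in at_top. \<forall>(k::nat) (a::int).
             2 < k \<and> c * x powr \<delta> \<le> real k \<and> real k \<le> C * x powr \<delta> \<and> coprime a (int k) \<longrightarrow>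
             (let y = x powr \<epsilon> in
               \<bar>real (count_pairs k a x y (x powr (1/2)))
                 - real (card (primes_coprime_upto k y)) / real (totient k)
                   * real (rough_count x (x powr (1/2)))\<bar>
               \<le> K * (x powr (1 - \<epsilon> + \<eta> x) * y / real k))))) \<and>
      (1/3 < \<delta> \<and> \<delta> < 2/5 \<longrightarrow>
        (\<exists>\<eta>::real \<Rightarrow> real. (\<eta> \<longlongrightarrow> 0) at_top \<and>
          (\<forall>\<^sub>F x in at_top. \<forall>(k::nat) (a::int).
             2 < k \<and> c * x powr \<delta> \<le> real k \<and> real k \<le> C * x powr \<delta> \<and> coprime a (int k) \<longrightarrow>
             (let y = x powr \<epsilon> in
               real (count_pairs k a x y (x powr (1/2)))
               \<ge> (0.7533 + \<eta> x) * x * y / (real (totient k) * ln x * ln y))))))"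
\<comment> \<open>With this bound 985/1000 \<le> 1 - \<open>\<epsilon>\<close>, so the fixed saving
  in \<open>GRH_count_pairs\<close> covers the error term with o(1) equal to 0.\<close>
proof (intro exI[of _ "1/100 :: real"] conjI allI impI)
  show "(0::real) < 1/100" by simp
next
  fix \<epsilon> \<delta> c C :: real
  assume \<epsilon>: "0 < \<epsilon> \<and> \<epsilon> < 1/100" and cC: "0 < c \<and> 0 < C" and \<delta>: "1/4 < \<delta> \<and> \<delta> \<le> 1/3"
  have "\<forall>\<^sub>F x in at_top. \<forall>(k::nat) (a::int).
      2 < k \<and> c * x powr \<delta> \<le> real k \<and> real k \<le> C * x powr \<delta> \<and> coprime a (int k) \<longrightarrow>
      (let y = x powr \<epsilon> in
        \<bar>real (count_pairs k a x y (x powr (1/2)))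
          - real (card (primes_coprime_upto k y)) / real (totient k) * real (rough_count x (x powr (1/2)))\<bar>
        \<le> 4 * (x powr (1 - \<epsilon> + 0) * y / real k))"
    using GRH_count_pairs[OF assms conjunct2[OF cC]] eventually_ge_at_top[of "1::real"]
  proof eventually_elim
    case (elim x)
    show ?case unfolding Let_def
    proof (intro allI impI)
      fix k a assume *: "2 < k \<and> c * x powr \<delta> \<le> real k \<and> real k \<le> C * x powr \<delta> \<and> coprime a (int k)"
      have "C * x powr \<delta> \<le> C * x powr (2/5)" using cC \<delta> elim(2) by (intro mult_left_mono powr_mono) auto
      with * have "\<bar>real (count_pairs k a x (x powr \<epsilon>) (x powr (1/2))) - real (card (primes_coprime_upto k (x powr \<epsilon>))) / real (totient k) * real (rough_count x (x powr (1/2)))\<bar>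
          \<le> 4 * (x powr (985/1000) * x powr \<epsilon> / real k)"
        using elim(1) by (meson order_trans powr_ge_zero)
      also have "\<dots> \<le> 4 * (x powr (1 - \<epsilon> + 0) * x powr \<epsilon> / real k)"
        using \<epsilon> elim(2) by (intro mult_left_mono divide_right_mono mult_right_mono powr_mono) auto
      finally show "\<bar>real (count_pairs k a x (x powr \<epsilon>) (x powr (1/2))) - real (card (primes_coprime_upto k (x powr \<epsilon>))) / real (totient k) * real (rough_count x (x powr (1/2)))\<bar>
          \<le> 4 * (x powr (1 - \<epsilon> + 0) * x powr \<epsilon> / real k)" .
    qed
  qed
  then show "\<exists>(\<eta>::real \<Rightarrow> real) (K::real). (\<eta> \<longlongrightarrow> 0) at_top \<and>
          (\<forall>\<^sub>F x in at_top. \<forall>(k::nat) (a::int).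
             2 < k \<and> c * x powr \<delta> \<le> real k \<and> real k \<le> C * x powr \<delta> \<and> coprime a (int k) \<longrightarrow>
             (let y = x powr \<epsilon> in
               \<bar>real (count_pairs k a x y (x powr (1/2)))
                 - real (card (primes_coprime_upto k y)) / real (totient k)
                   * real (rough_count x (x powr (1/2)))\<bar>
               \<le> K * (x powr (1 - \<epsilon> + \<eta> x) * y / real k)))"
    by (intro exI[of _ "\<lambda>_. 0"] exI[of _ 4] conjI tendsto_const)
next
  fix \<epsilon> \<delta> c C :: real
  assume \<epsilon>: "0 < \<epsilon> \<and> \<epsilon> < 1/100" and cC: "0 < c \<and> 0 < C" and \<delta>: "1/3 < \<delta> \<and> \<delta> < 2/5"
  have C: "C > 0" and e: "\<epsilon> > 0" using cC \<epsilon> by auto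
  have "filterlim (\<lambda>x::real. x powr \<epsilon>) at_top at_top" using e by real_asymp
  from eventually_compose_filterlim[OF chebyshev_pi_lower this]
  have piy: "\<forall>\<^sub>F x in at_top. real (card {p. prime p \<and> real p \<le> x powr \<epsilon>}) \<ge> 89/100 * x powr \<epsilon> / ln (x powr \<epsilon>)" .
  \<comment> \<open>The budget of the lower bound: the constant 0.89 of each prime count is cut to
    0.88, once for the at most log 2 k primes dividing \<open>k\<close>, once for the primes below
    sqrt x. The product 0.7744 loses another 0.02 to the error term, and 0.7544 still exceeds
    0.7533; so o(1) can again be 0.\<close>
  have "\<forall>\<^sub>F x::real in at_top. log 2 (C * x powr (2/5)) \<le> 1/100 * (x powr \<epsilon> / (\<epsilon> * ln x))" using C e by real_asymp
  moreover have "\<forall>\<^sub>F x::real in at_top. sqrt x \<le> 1/100 * (x / ln x)" by real_asymp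
  moreover have "\<forall>\<^sub>F x::real in at_top. 4 * x powr (985/1000) \<le> 2/100 * (x / (ln x * (\<epsilon> * ln x)))" using e by real_asymp
  ultimately have "\<forall>\<^sub>F x in at_top. \<forall>(k::nat) (a::int).
      2 < k \<and> c * x powr \<delta> \<le> real k \<and> real k \<le> C * x powr \<delta> \<and> coprime a (int k) \<longrightarrow>
      (let y = x powr \<epsilon> in
        real (count_pairs k a x y (x powr (1/2))) \<ge> (0.7533 + 0) * x * y / (real (totient k) * ln x * ln y))"
    using GRH_count_pairs[OF assms C] eventually_ge_at_top[of "3::real"] chebyshev_pi_lower piy
  proof eventually_elim
    case (elim x)
    have x3: "x \<ge> 3" by (rule elim(5))
    show ?case unfolding Let_def
    proof (intro allI impI)
      fix k a assume *: "2 < k \<and> c * x powr \<delta> \<le> real k \<and> real k \<le> C * x powr \<delta> \<and> coprime a (int k)"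
      define y where "y = x powr \<epsilon>"
      have y: "y > 0" "ln y = \<epsilon> * ln x" using x3 by (auto simp: y_def ln_powr)
      have lx: "ln x > 0" using x3 by simp
      then have ly: "ln y > 0" using y(2) e by simp
      have k0: "k > 0" "real k > 0" using * by auto
      define phi where "phi = real (totient k)"
      have phi: "phi > 0" "phi \<le> real k" using k0 by (auto simp: phi_def totient_le)
      have "C * x powr \<delta> \<le> C * x powr (2/5)" using C \<delta> x3 by (intro mult_left_mono powr_mono) auto
      then have kC: "real k \<le> C * x powr (2/5)" using * by linarith
      define P where "P = real (card (primes_coprime_upto k y))"
      define Q where "Q = real (rough_count x (x powr (1/2)))"
      have "\<bar>real (count_pairs k a x y (x powr (1/2))) - P / phi * Q\<bar> \<le> 4 * (x powr (985/1000) * y / real k)"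
        unfolding P_def Q_def phi_def using elim(4) * kC y(1) by (meson less_imp_le)
      then have 1: "P / phi * Q - 4 * (x powr (985/1000) * y / real k) \<le> real (count_pairs k a x y (x powr (1/2)))" by linarith
      have "4 * (x powr (985/1000) * y / real k) \<le> 4 * (x powr (985/1000) * y / phi)"
        using phi y(1) by (intro mult_left_mono divide_left_mono) auto
      also have "\<dots> = 4 * x powr (985/1000) * (y / phi)" by simp
      also have "\<dots> \<le> 2/100 * (x / (ln x * ln y)) * (y / phi)"
        using elim(3) phi y by (intro mult_right_mono) auto
      finally have 2: "4 * (x powr (985/1000) * y / real k) \<le> 2/100 * (x / (ln x * ln y)) * (y / phi)" .
      have "log 2 (real k) \<le> log 2 (C * x powr (2/5))" using kC k0 by simp
      then have "P \<ge> 89/100 * (y / ln y) - 1/100 * (y / ln y)"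
      proof -
        have "89/100 * (y / ln y) \<le> real (card {p. prime p \<and> real p \<le> y})" using elim(7) by (simp add: y_def)
        moreover have "log 2 (C * x powr (2/5)) \<le> 1/100 * (y / ln y)" using elim(1) unfolding y(2) by (simp add: y_def)
        ultimately show ?thesis
          using card_primes_coprime_upto_ge[OF k0(1), of y] \<open>log 2 (real k) \<le> _\<close> unfolding P_def by argo
      qed
      then have P: "P \<ge> 88/100 * (y / ln y)" by argo
      have "Q \<ge> 89/100 * (x / ln x) - 1/100 * (x / ln x)"
      proof -
        have "89/100 * (x / ln x) \<le> real (card {p. prime p \<and> real p \<le> x})" using elim(6) by simp
        moreover have "real (card {p. prime p \<and> real p \<le> x}) - sqrt x \<le> Q"
          unfolding Q_def by (rule rough_count_ge) (use x3 in simp)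
        ultimately show ?thesis using elim(2) by argo
      qed
      then have Q: "Q \<ge> 88/100 * (x / ln x)" by argo
      have "(88/100 * (y / ln y)) * (88/100 * (x / ln x)) \<le> P * Q"
        using P Q y(1) ly lx x3 by (intro mult_mono) (auto simp: P_def)
      then have "(88/100 * (y / ln y)) * (88/100 * (x / ln x)) / phi \<le> P * Q / phi" using phi by (intro divide_right_mono) auto
      moreover have "(88/100 * (y / ln y)) * (88/100 * (x / ln x)) / phi = 7744/10000 * (x * y / (phi * ln x * ln y))"
        by (simp add: mult_ac)
      moreover have "2/100 * (x / (ln x * ln y)) * (y / phi) = 200/10000 * (x * y / (phi * ln x * ln y))"
        by (simp add: mult_ac)
      moreover have "P / phi * Q = P * Q / phi" by simp
      ultimately have "7544/10000 * (x * y / (phi * ln x * ln y)) \<le> real (count_pairs k a x y (x powr (1/2)))"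
        using 1 2 by argo
      moreover have "0.7533 * (x * y / (phi * ln x * ln y)) \<le> 7544/10000 * (x * y / (phi * ln x * ln y))"
        using x3 y(1) phi lx ly by (intro mult_right_mono) auto
      ultimately have "0.7533 * (x * y / (phi * ln x * ln y)) \<le> real (count_pairs k a x y (x powr (1/2)))"
        by (rule order_trans[rotated])
      then show "(0.7533 + 0) * x * x powr \<epsilon> / (real (totient k) * ln x * ln (x powr \<epsilon>)) \<le> real (count_pairs k a x (x powr \<epsilon>) (x powr (1/2)))"
        unfolding y_def phi_def by (simp add: mult.assoc)
    qed
  qed
  then show "\<exists>\<eta>::real \<Rightarrow> real. (\<eta> \<longlongrightarrow> 0) at_top \<and>
          (\<forall>\<^sub>F x in at_top. \<forall>(k::nat) (a::int).
             2 < k \<and> c * x powr \<delta> \<le> real k \<and> real k \<le> C * x powr \<delta> \<and> coprime a (int k) \<longrightarrow>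
             (let y = x powr \<epsilon> in
               real (count_pairs k a x y (x powr (1/2)))
               \<ge> (0.7533 + \<eta> x) * x * y / (real (totient k) * ln x * ln y)))"
    by (intro exI[of _ "\<lambda>_. 0"] conjI tendsto_const)
qed

end
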